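(* Let $d\ge 3$, $0<q<\frac d2$, and let $V\in \ell_{q,w}(\mathbb Z^d)$, $V\ge 0$. Then $\mathbf B_V\in\Sigma_q$, and $$\|\mathbf B_V\|_{\Sigma_q}\le C\,\|V\|_{\ell_{q,w}},$$ with a constant $C$ depending only on $d$ and $q$. Equivalently, with the same constant $C$, $$N_-(\mathbf H_{\alpha V})\le C^q\alpha^q\|V\|_{\ell_{q,w}}^q\qquad\text{for all }\alpha>0.$$
   Context: The discrete Laplacian on $\mathbb Z^d$ is $(\Delta u)(x)=\sum_{j=1}^d\big(u(x+1_j)+u(x-1_j)-2u(x)\big)$, where $1_j$ is the $j$-th standard basis vector. For $V\ge0$ on $\mathbb Z^d$ and $\alpha>0$, $\mathbf H_{\alpha V}=-\Delta-\alpha V$ is the discrete Schrödinger operator in $\ell_2(\mathbb Z^d)$, and $N_-(\mathbf H_{\alpha V})$ is the number of its negative eigenvalues, counted with multiplicities. For a function $u$ on $\mathbb Z^d$ put $Q_0[u]=\sum_{x\in\mathbb Z^d}\sum_{j=1}^d|u(x+1_j)-u(x)|^2$. For $d\ge3$, $\mathcal H^1=\mathcal H^1(\mathbb Z^d)$ is the completion of the set of finitely supported functions on $\mathbb Z^d$ in the metric generated by $Q_0$; it is a Hilbert space of functions on $\mathbb Z^d$. Birman–Schwinger operator: let $\mathbf b_V[u]=\sum_{x\in\mathbb Z^d}V(x)|u(x)|^2$. If this form is bounded on $\mathcal H^1(\mathbb Z^d)$, $\mathbf B_V$ is the bounded self-adjoint (non-negative for $V\ge0$) operator generated by it in the Hilbert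 space $\mathcal H^1(\mathbb Z^d)$. For a compact non-negative operator $\mathbf T$ with positive eigenvalues $\lambda_1(\mathbf T)\ge\lambda_2(\mathbf T)\ge\dots$ (counted with multiplicities), $n_+(s,\mathbf T)=\#\{j:\lambda_j(\mathbf T)>s\}$, $s>0$. $\Sigma_q$ ($q>0$) is the space of compact operators $\mathbf T$ with finite quasi-norm $\|\mathbf T\|_{\Sigma_q}=\sup_{s>0}s\,n_+(s,|\mathbf T|)^{1/q}=\sup_j j^{1/q}\lambda_j(|\mathbf T|)$, where $|\mathbf T|=(\mathbf T^*\mathbf T)^{1/2}$. For a function $V$ on $\mathbb Z^d$ and $s>0$, $\nu(s,V)=\#\{x\in\mathbb Z^d:|V(x)|>s\}$. The space $\ell_{q,w}(\mathbb Z^d)$ (weak $\ell_q$) consists of the functions $V$ with $V(x)\to0$ as $|x|\to\infty$ and finite quasi-norm $\|V\|_{\ell_{q,w}}=\sup_{s>0}s\,\nu(s,V)^{1/q}$. *)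

theory Defs
  imports "HOL-Analysis.Analysis" "HOL-Library.Function_Algebras"
begin

text \<open>
  Hilbert spaces are spaces of complex-valued functions on a set, given by a carrier \<open>H\<close> and an
  inner product \<open>ip\<close> (linear in the first argument); operators are HOL functions of which only
  the values on \<open>H\<close> matter. Addition of functions is pointwise, from \<open>Function_Algebras\<close>.
\<close>

section \<open>Operators in Hilbert spaces of functions\<close>

definition cscale :: "complex \<Rightarrow> ('x \<Rightarrow> complex) \<Rightarrow> ('x \<Rightarrow> complex)" where
  "cscale c u = (\<lambda>x. c * u x)"

global_interpretation cfun: vector_space cscale
  by unfold_locales (auto simp: cscale_def fun_eq_iff algebra_simps)

definition edim :: "('x \<Rightarrow> complex) set \<Rightarrow> enat" where
  "edim S = (SUP B\<in>{B. finite B \<and> B \<subseteq> S \<and> cfun.independent B}. enat (card B))"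

definition hnorm :: "(('x \<Rightarrow> complex) \<Rightarrow> ('x \<Rightarrow> complex) \<Rightarrow> complex) \<Rightarrow> ('x \<Rightarrow> complex) \<Rightarrow> real" where
  "hnorm ip u = sqrt (Re (ip u u))"

definition linear_op :: "('x \<Rightarrow> complex) set \<Rightarrow> (('x \<Rightarrow> complex) \<Rightarrow> ('x \<Rightarrow> complex)) \<Rightarrow> bool" where
  "linear_op H T \<longleftrightarrow>
     (\<forall>u\<in>H. T u \<in> H) \<and>
     (\<forall>u\<in>H. \<forall>v\<in>H. T (u + v) = T u + T v) \<and>
     (\<forall>c. \<forall>u\<in>H. T (cscale c u) = cscale c (T u))"

definition bounded_op ::
  "('x \<Rightarrow> complex) set \<Rightarrow> (('x \<Rightarrow> complex) \<Rightarrow> ('x \<Rightarrow> complex) \<Rightarrow> complex)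
    \<Rightarrow> (('x \<Rightarrow> complex) \<Rightarrow> ('x \<Rightarrow> complex)) \<Rightarrow> bool" where
  "bounded_op H ip T \<longleftrightarrow>
     linear_op H T \<and> (\<exists>K. \<forall>u\<in>H. hnorm ip (T u) \<le> K * hnorm ip u)"

definition compact_op ::
  "('x \<Rightarrow> complex) set \<Rightarrow> (('x \<Rightarrow> complex) \<Rightarrow> ('x \<Rightarrow> complex) \<Rightarrow> complex)
    \<Rightarrow> (('x \<Rightarrow> complex) \<Rightarrow> ('x \<Rightarrow> complex)) \<Rightarrow> bool" where
  "compact_op H ip T \<longleftrightarrow>
     linear_op H T \<and>
     (\<forall>f :: nat \<Rightarrow> 'x \<Rightarrow> complex.
        (\<forall>n. f n \<in> H) \<and> (\<exists>K. \<forall>n. hnorm ip (f n) \<le> K) \<longrightarrow>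
        (\<exists>r w. strict_mono r \<and> w \<in> H \<and> (\<lambda>n. hnorm ip (T (f (r n)) - w)) \<longlonglongrightarrow> 0))"

definition nonneg_selfadjoint_op ::
  "('x \<Rightarrow> complex) set \<Rightarrow> (('x \<Rightarrow> complex) \<Rightarrow> ('x \<Rightarrow> complex) \<Rightarrow> complex)
    \<Rightarrow> (('x \<Rightarrow> complex) \<Rightarrow> ('x \<Rightarrow> complex)) \<Rightarrow> bool" where
  "nonneg_selfadjoint_op H ip T \<longleftrightarrow>
     bounded_op H ip T \<and>
     (\<forall>u\<in>H. \<forall>v\<in>H. ip (T u) v = ip u (T v)) \<and>
     (\<forall>u\<in>H. 0 \<le> Re (ip (T u) u))"

definition adjoint_op ::
  "('x \<Rightarrow> complex) set \<Rightarrow> (('x \<Rightarrow> complex) \<Rightarrow> ('x \<Rightarrow> complex) \<Rightarrow> complex)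
    \<Rightarrow> (('x \<Rightarrow> complex) \<Rightarrow> ('x \<Rightarrow> complex)) \<Rightarrow> (('x \<Rightarrow> complex) \<Rightarrow> ('x \<Rightarrow> complex))" where
  "adjoint_op H ip T v = (THE w. w \<in> H \<and> (\<forall>u\<in>H. ip (T u) v = ip u w))"

text \<open>
  The non-negative square root of \<open>T\<^sup>* T\<close> is unique as a function on \<open>H\<close> only, and its values outside
  \<open>H\<close> are irrelevant; hence \<open>SOME\<close> rather than \<open>THE\<close>.
\<close>

definition abs_op ::
  "('x \<Rightarrow> complex) set \<Rightarrow> (('x \<Rightarrow> complex) \<Rightarrow> ('x \<Rightarrow> complex) \<Rightarrow> complex)
    \<Rightarrow> (('x \<Rightarrow> complex) \<Rightarrow> ('x \<Rightarrow> complex)) \<Rightarrow> (('x \<Rightarrow> complex) \<Rightarrow> ('x \<Rightarrow> complex))" where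
  "abs_op H ip T =
     (SOME R. nonneg_selfadjoint_op H ip R \<and> (\<forall>u\<in>H. R (R u) = adjoint_op H ip T (T u)))"

definition multiplicity_eig ::
  "('x \<Rightarrow> complex) set \<Rightarrow> (('x \<Rightarrow> complex) \<Rightarrow> ('x \<Rightarrow> complex)) \<Rightarrow> real \<Rightarrow> enat" where
  "multiplicity_eig H T \<mu> = edim {u \<in> H. T u = cscale (complex_of_real \<mu>) u}"

text \<open>
  The number of eigenvalues in \<open>A\<close>, counted with multiplicities: the (possibly infinite) sum of the
  multiplicities over \<open>A\<close>.
\<close>

definition eig_count ::
  "('x \<Rightarrow> complex) set \<Rightarrow> (('x \<Rightarrow> complex) \<Rightarrow> ('x \<Rightarrow> complex)) \<Rightarrow> real set \<Rightarrow> enat" where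
  "eig_count H T A = (SUP F\<in>{F. finite F \<and> F \<subseteq> A}. \<Sum>\<mu>\<in>F. multiplicity_eig H T \<mu>)"

definition n_plus ::
  "('x \<Rightarrow> complex) set \<Rightarrow> real \<Rightarrow> (('x \<Rightarrow> complex) \<Rightarrow> ('x \<Rightarrow> complex)) \<Rightarrow> enat" where
  "n_plus H s T = eig_count H T {s<..}"

definition Sigma_fun ::
  "('x \<Rightarrow> complex) set \<Rightarrow> (('x \<Rightarrow> complex) \<Rightarrow> ('x \<Rightarrow> complex) \<Rightarrow> complex)
    \<Rightarrow> real \<Rightarrow> (('x \<Rightarrow> complex) \<Rightarrow> ('x \<Rightarrow> complex)) \<Rightarrow> real \<Rightarrow> real" where
  "Sigma_fun H ip q T s = s * real (the_enat (n_plus H s (abs_op H ip T))) powr (1 / q)"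

text \<open>
  \<open>the_enat \<infinity>\<close> is unspecified, so \<open>Sigma_class\<close> records the finiteness of \<open>n_plus\<close> (automatic
  for compact operators); likewise \<open>Sigma_norm\<close> is meaningful only on \<open>Sigma_class\<close>.
\<close>

definition Sigma_class ::
  "('x \<Rightarrow> complex) set \<Rightarrow> (('x \<Rightarrow> complex) \<Rightarrow> ('x \<Rightarrow> complex) \<Rightarrow> complex)
    \<Rightarrow> real \<Rightarrow> (('x \<Rightarrow> complex) \<Rightarrow> ('x \<Rightarrow> complex)) set" where
  "Sigma_class H ip q =
     {T. compact_op H ip T \<and>
         (\<forall>s>0. n_plus H s (abs_op H ip T) \<noteq> \<infinity>) \<and>
         bdd_above (Sigma_fun H ip q T ` {0<..})}"

definition Sigma_norm ::
  "('x \<Rightarrow> complex) set \<Rightarrow> (('x \<Rightarrow> complex) \<Rightarrow> ('x \<Rightarrow> complex) \<Rightarrow> complex)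
    \<Rightarrow> real \<Rightarrow> (('x \<Rightarrow> complex) \<Rightarrow> ('x \<Rightarrow> complex)) \<Rightarrow> real" where
  "Sigma_norm H ip q T = (SUP s\<in>{0<..}. Sigma_fun H ip q T s)"


section \<open>The lattice\<close>

text \<open>The lattice \<open>\<int>\<^sup>d\<close> is \<open>int ^ 'd\<close> with \<open>d = CARD('d)\<close>; \<open>axis j 1\<close> is the basis vector \<open>1\<^sub>j\<close>.\<close>

definition laplacian :: "(int ^ 'd \<Rightarrow> complex) \<Rightarrow> (int ^ 'd \<Rightarrow> complex)" where
  "laplacian u = (\<lambda>x. \<Sum>j\<in>UNIV. u (x + axis j 1) + u (x - axis j 1) - 2 * u x)"

definition schroedinger :: "(int ^ 'd \<Rightarrow> real) \<Rightarrow> (int ^ 'd \<Rightarrow> complex) \<Rightarrow> (int ^ 'd \<Rightarrow> complex)" where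
  "schroedinger V u = (\<lambda>x. - laplacian u x - complex_of_real (V x) * u x)"

definition ell2 :: "('x \<Rightarrow> complex) set" where
  "ell2 = {u. (\<lambda>x. (cmod (u x))\<^sup>2) summable_on UNIV}"

definition N_minus :: "(int ^ 'd \<Rightarrow> real) \<Rightarrow> enat" where
  "N_minus V = eig_count ell2 (schroedinger V) {..<0}"

definition Q0 :: "(int ^ 'd \<Rightarrow> complex) \<Rightarrow> real" where
  "Q0 u = (\<Sum>\<^sub>\<infinity>x\<in>UNIV. \<Sum>j\<in>UNIV. (cmod (u (x + axis j 1) - u x))\<^sup>2)"

definition Q0_inner :: "(int ^ 'd \<Rightarrow> complex) \<Rightarrow> (int ^ 'd \<Rightarrow> complex) \<Rightarrow> complex" where
  "Q0_inner u v =
     (\<Sum>\<^sub>\<infinity>x\<in>UNIV. \<Sum>j\<in>UNIV. (u (x + axis j 1) - u x) * cnj (v (x + axis j 1) - v x))"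

text \<open>
  The completion of the finitely supported functions with respect to \<open>Q0\<close>, realised as a space of
  functions: for \<open>d \<ge> 3\<close> point evaluations are continuous with respect to \<open>Q0\<close>, so a
  Cauchy sequence converges pointwise, and it is represented by its pointwise limit.
  The inner product on the completion is again given by the formula \<open>Q0_inner\<close>.
\<close>

definition H1 :: "(int ^ 'd \<Rightarrow> complex) set" where
  "H1 = {u. \<exists>f :: nat \<Rightarrow> int ^ 'd \<Rightarrow> complex.
            (\<forall>n. finite {x. f n x \<noteq> 0}) \<and>
            (\<forall>\<epsilon>>0. \<exists>N. \<forall>m\<ge>N. \<forall>n\<ge>N. sqrt (Q0 (f m - f n)) < \<epsilon>) \<and>
            (\<forall>x. (\<lambda>n. f n x) \<longlonglongrightarrow> u x)}"

definition b_form :: "(int ^ 'd \<Rightarrow> real) \<Rightarrow> (int ^ 'd \<Rightarrow> complex) \<Rightarrow> real" where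
  "b_form V u = (\<Sum>\<^sub>\<infinity>x\<in>UNIV. V x * (cmod (u x))\<^sup>2)"

definition b_sesq ::
  "(int ^ 'd \<Rightarrow> real) \<Rightarrow> (int ^ 'd \<Rightarrow> complex) \<Rightarrow> (int ^ 'd \<Rightarrow> complex) \<Rightarrow> complex" where
  "b_sesq V u v = (\<Sum>\<^sub>\<infinity>x\<in>UNIV. complex_of_real (V x) * u x * cnj (v x))"

text \<open>Summability is required because \<open>infsum\<close> is \<open>0\<close> on non-summable families.\<close>

definition b_form_bounded :: "(int ^ 'd \<Rightarrow> real) \<Rightarrow> bool" where
  "b_form_bounded V \<longleftrightarrow>
     (\<exists>K. \<forall>u\<in>H1. (\<lambda>x. V x * (cmod (u x))\<^sup>2) summable_on UNIV \<and> \<bar>b_form V u\<bar> \<le> K * Q0 u)"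

definition birman_schwinger ::
  "(int ^ 'd \<Rightarrow> real) \<Rightarrow> (int ^ 'd \<Rightarrow> complex) \<Rightarrow> (int ^ 'd \<Rightarrow> complex)" where
  "birman_schwinger V u = (THE w. w \<in> H1 \<and> (\<forall>v\<in>H1. Q0_inner w v = b_sesq V u v))"


section \<open>Weak sequence spaces\<close>

definition nu :: "real \<Rightarrow> (int ^ 'd \<Rightarrow> real) \<Rightarrow> nat" where
  "nu s V = card {x. \<bar>V x\<bar> > s}"

definition vanishes_at_infinity :: "(int ^ 'd \<Rightarrow> real) \<Rightarrow> bool" where
  "vanishes_at_infinity V \<longleftrightarrow>
     (V \<longlongrightarrow> 0) (filtercomap (\<lambda>x. norm (\<chi> i. real_of_int (x $ i))) at_top)"

definition weak_lq :: "real \<Rightarrow> (int ^ 'd \<Rightarrow> real) set" where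
  "weak_lq q =
     {V. vanishes_at_infinity V \<and> bdd_above ((\<lambda>s. s * real (nu s V) powr (1 / q)) ` {0<..})}"

definition weak_lq_norm :: "real \<Rightarrow> (int ^ 'd \<Rightarrow> real) \<Rightarrow> real" where
  "weak_lq_norm q V = (SUP s\<in>{0<..}. s * real (nu s V) powr (1 / q))"

end

theory Submission
  imports Defs "HOL-Complex_Analysis.Great_Picard"
begin

text \<open>
  The proof counts dimensions. For a potential \<open>V\<close> and \<open>\<alpha> > 0\<close>, both \<open>N\<^sub>-(H\<^sub>\<alpha>\<^sub>V)\<close> and \<open>n\<^sub>+(1/\<alpha>, B\<^sub>V)\<close>
  are the largest dimension of a space of functions on which \<open>Q\<^sub>0[u] < \<alpha> b\<^sub>V[u]\<close> for \<open>u \<noteq> 0\<close>: the first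
  number uses functions in \<open>\<ell>\<^sub>2\<close>, the second functions in \<open>H\<^sup>1\<close>, and finitely supported functions are
  dense enough to make no difference. Hence the two counting functions coincide
  (\<open>Birman_Schwinger_principle\<close>), which yields the equivalence of the two estimates with the same
  constant, and only the dimension of such spaces has to be bounded.

  That the two numbers are such dimensions follows from one variational principle. Let \<open>T\<close> be a bounded
  symmetric operator whose form lies below that of a compact operator. If there is an \<open>m\<close>-dimensional
  space on which the form of \<open>T\<close> exceeds \<open>s \<ge> 0\<close>, then \<open>T\<close> has \<open>m\<close> orthonormal eigenvectors with
  eigenvalues above \<open>s\<close>, because the supremum of the form over the unit sphere of the orthogonal
  complement of the eigenvectors found so far is attained as long as it exceeds \<open>s\<close>
  (\<open>maximizer_is_eigenvector\<close>). This covers the compact operator \<open>B\<^sub>V\<close> and the operator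
  \<open>\<Delta> + \<alpha>V\<close>, where \<open>\<Delta> \<le> 0\<close> and multiplication by \<open>\<alpha>V\<close> is compact.

  The dimension bound (\<open>dimension_bound\<close>) replaces Fourier analysis by averages. Let \<open>avg k u\<close> be the
  average of \<open>u\<close> over cubes of side \<open>2\<^sup>k\<close>. Moving a function by a vector of length about \<open>2\<^sup>k\<close> costs a
  factor of that size, so the \<open>\<ell>\<^sub>2\<close>-norm of \<open>u - avg k u\<close> is at most \<open>d 2\<^sup>k\<close> times the square root of
  \<open>Q\<^sub>0[u]\<close>. The same fact bounds the difference of averages over two consecutive
  scales, and summing over all larger scales gives \<open>|avg k u(x)|\<^sup>2 \<le> C 2\<^sup>-\<^sup>k\<^sup>(\<^sup>d\<^sup>-\<^sup>2\<^sup>) Q\<^sub>0[u]\<close>; the series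
  converges exactly because \<open>d \<ge> 3\<close>. Now put \<open>W = \<alpha>V\<close>. The finitely many points with \<open>W > c\<close> take away
  at most \<open>\<nu>(c, W)\<close> dimensions, by passing to functions that vanish there. At a point with
  \<open>\<theta>\<^sup>k\<^sup>+\<^sup>1 < W(x) \<le> \<theta>\<^sup>k \<le> c\<close> compare \<open>u(x)\<close> with \<open>avg k u(x)\<close>. The errors contribute a geometric
  series with ratio \<open>4\<theta>\<close> to the form, so if \<open>\<theta> < 1/4\<close> and \<open>c\<close> is small they are a small multiple of
  \<open>Q\<^sub>0[u]\<close>. The averages, summed over a \<open>Q\<^sub>0\<close>-orthonormal system by Bessel's inequality and then
  over the lattice, contribute a geometric series with ratio \<open>\<theta>\<^sup>1\<^sup>-\<^sup>q 2\<^sup>2\<^sup>-\<^sup>d\<close>, where the weak norm of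
  \<open>V\<close> counts the points of each layer. For \<open>\<theta> = 1/4\<close> this ratio is \<open>2\<^sup>2\<^sup>q\<^sup>-\<^sup>d < 1\<close>, so some \<open>\<theta> < 1/4\<close>
  makes both series converge; this is where \<open>q < d/2\<close> enters. An orthonormal system on which
  \<open>b\<^sub>W \<ge> Q\<^sub>0\<close> therefore has at most a constant times \<open>\<alpha>\<^sup>q \<parallel>V\<parallel>\<^sup>q\<close> members.

  The same decomposition, applied to the points outside a large finite set, shows that \<open>b\<^sub>V\<close> is
  bounded on \<open>H\<^sup>1\<close> and that \<open>B\<^sub>V\<close> is compact (\<open>tail_bound\<close>).
\<close>

section \<open>Counting, linear systems and linear combinations\<close>

text \<open>
  Gaussian elimination, in the form in which it is used below: from a family of \<open>card I\<close> vectors,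
  fewer than \<open>card I\<close> linear conditions can be met by a nontrivial combination. Working with
  coefficients avoids extending functionals that are linear on a subspace only.
\<close>
lemma homogeneous_system_nontrivial_solution:
  fixes a :: "'j \<Rightarrow> 'i \<Rightarrow> complex"
  assumes "finite J" "finite I" "card J < card I"
  shows "\<exists>c. (\<exists>i\<in>I. c i \<noteq> 0) \<and> (\<forall>j\<in>J. (\<Sum>i\<in>I. c i * a j i) = 0)"
  using assms
proof (induction J arbitrary: I a rule: finite_induct)
  case empty
  then obtain i where "i \<in> I" by (cases "I = {}") auto
  then show ?case by (intro exI[of _ "\<lambda>_. 1"]) auto
next
  case (insert j J)
  show ?case
  proof (cases "\<forall>i\<in>I. a j i = 0")
    case True
    obtain c where "\<exists>i\<in>I. c i \<noteq> 0" "\<forall>j\<in>J. (\<Sum>i\<in>I. c i * a j i) = 0"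
      using insert.IH[of I a] insert.prems insert.hyps by auto
    then show ?thesis using True by (intro exI[of _ c]) auto
  next
    case False
    then obtain p where p: "p \<in> I" "a j p \<noteq> 0" by blast
    define I' where "I' = I - {p}"
    have fI': "finite I'" and I: "I = insert p I'" and pI': "p \<notin> I'"
      using p insert.prems by (auto simp: I'_def)
    have "card J < card I'" using insert.prems insert.hyps p by (auto simp: I'_def)
    \<comment> \<open>the column \<open>p\<close> serves as pivot of row \<open>j\<close>; the induction hypothesis applies to the eliminated system\<close>
    from insert.IH[OF fI' this, of "\<lambda>k i. a k i - a k p * a j i / a j p"]
    obtain c where c: "\<exists>i\<in>I'. c i \<noteq> 0"
      "\<And>k. k \<in> J \<Longrightarrow> (\<Sum>i\<in>I'. c i * (a k i - a k p * a j i / a j p)) = 0" by blast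
    define c' where "c' = c(p := - (\<Sum>i\<in>I'. c i * a j i) / a j p)"
    have s: "(\<Sum>i\<in>I. c' i * a k i) =
        - (\<Sum>i\<in>I'. c i * a j i) / a j p * a k p + (\<Sum>i\<in>I'. c i * a k i)" for k
    proof -
      have "(\<Sum>i\<in>I'. c' i * a k i) = (\<Sum>i\<in>I'. c i * a k i)"
        using pI' by (intro sum.cong) (auto simp: c'_def)
      then show ?thesis unfolding I using fI' pI' by (simp add: c'_def)
    qed
    have "(\<Sum>i\<in>I. c' i * a j i) = 0" using p by (simp add: s)
    moreover have "(\<Sum>i\<in>I. c' i * a k i) = 0" if "k \<in> J" for k
    proof -
      have "(\<Sum>i\<in>I'. c i * (a k i - a k p * a j i / a j p)) =
         (\<Sum>i\<in>I'. c i * a k i) - (\<Sum>i\<in>I'. c i * a j i) / a j p * a k p"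
        by (simp add: right_diff_distrib sum_subtractf sum_distrib_right sum_divide_distrib ac_simps)
          (simp add: sum_distrib_left ac_simps)
      then show ?thesis using c(2)[OF that] by (simp add: s)
    qed
    moreover have "\<exists>i\<in>I. c' i \<noteq> 0" using c(1) pI' unfolding I c'_def by auto
    ultimately show ?thesis by blast
  qed
qed

lemma sum_fun_apply: "(\<Sum>i\<in>I. f i) x = (\<Sum>i\<in>I. f i x)"
  by (induction I rule: infinite_finite_induct) auto

definition lincomb :: "'i set \<Rightarrow> ('i \<Rightarrow> complex) \<Rightarrow> ('i \<Rightarrow> 'x \<Rightarrow> complex) \<Rightarrow> 'x \<Rightarrow> complex" where
  "lincomb I c v = (\<Sum>i\<in>I. cscale (c i) (v i))"

lemma lincomb_apply: "lincomb I c v x = (\<Sum>i\<in>I. c i * v i x)"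
  by (simp add: lincomb_def sum_fun_apply cscale_def)

lemma cscale_apply [simp]: "cscale c u x = c * u x" by (simp add: cscale_def)

lemma cscale_lincomb: "cscale a (lincomb I c v) = lincomb I (\<lambda>i. a * c i) v"
  by (auto simp: fun_eq_iff lincomb_apply sum_distrib_left mult.assoc)

lemma enat_eqI:
  assumes "\<And>m. enat m \<le> a \<longleftrightarrow> enat m \<le> b"
  shows "a = b"
proof -
  have "a \<le> b" if "\<And>m. enat m \<le> a \<Longrightarrow> enat m \<le> b" for a b :: enat
  proof (cases a)
    case infinity
    then have "enat (Suc n) \<le> b" for n using that by simp
    then show ?thesis by (cases b) (auto dest: spec meta_spec[of _ "the_enat b"])
  qed (use that in auto)
  from this[of a b] this[of b a] show ?thesis using assms by auto
qed

text \<open>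
  A finite bound below a supremum of extended naturals is already reached by a member, since there
  is no natural number between \<open>k\<close> and \<open>Suc k\<close>. The multiplicities and eigenvalue counts are such
  suprema, so this is what makes them witnessed by actual vectors.
\<close>
lemma enat_le_SUP_iff:
  fixes f :: "'a \<Rightarrow> enat"
  assumes "A \<noteq> {}"
  shows "enat m \<le> (SUP x\<in>A. f x) \<longleftrightarrow> (\<exists>x\<in>A. enat m \<le> f x)"
proof
  assume h: "enat m \<le> (SUP x\<in>A. f x)"
  show "\<exists>x\<in>A. enat m \<le> f x"
  proof (cases m)
    case 0 then show ?thesis using assms by (auto simp: zero_enat_def[symmetric])
  next
    case (Suc k)
    then have "enat k < (SUP x\<in>A. f x)" using h by (metis Suc_ile_eq)
    then show ?thesis using Suc by (auto simp: less_SUP_iff Suc_ile_eq)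
  qed
qed (meson SUP_upper2)

lemma enat_le_add_split:
  fixes a b :: enat
  assumes "enat m \<le> a + b"
  obtains k l where "m = k + l" "enat k \<le> a" "enat l \<le> b"
proof (cases a)
  case (enat p)
  show ?thesis
  proof (cases "m \<le> p")
    case True then show ?thesis using that[of m 0] enat by (simp add: zero_enat_def[symmetric])
  next
    case False
    have "enat (m - p) \<le> b" using assms enat False by (cases b) auto
    then show ?thesis using that[of p "m - p"] False enat by simp
  qed
next
  case infinity then show ?thesis using that[of m 0] by (simp add: zero_enat_def[symmetric])
qed

lemma lincomb_in_subspace: "cfun.subspace S \<Longrightarrow> (\<And>i. i \<in> I \<Longrightarrow> v i \<in> S) \<Longrightarrow> lincomb I c v \<in> S"
  unfolding lincomb_def by (intro cfun.subspace_sum cfun.subspace_scale) auto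

lemma cmod_sq_add_le: "(cmod (a + b))\<^sup>2 \<le> 2 * (cmod a)\<^sup>2 + 2 * (cmod b)\<^sup>2"
proof -
  have "(cmod (a + b))\<^sup>2 \<le> (cmod a + cmod b)\<^sup>2" by (intro power_mono norm_triangle_ineq) simp
  also have "\<dots> \<le> 2 * (cmod a)\<^sup>2 + 2 * (cmod b)\<^sup>2"
    using zero_le_power2[of "cmod a - cmod b"] unfolding power2_sum power2_diff by linarith
  finally show ?thesis .
qed

lemma cmod_sum_sq_le: "(cmod (\<Sum>i\<in>I. z i))\<^sup>2 \<le> card I * (\<Sum>i\<in>I. (cmod (z i))\<^sup>2)"
proof -
  have "(cmod (\<Sum>i\<in>I. z i))\<^sup>2 \<le> (\<Sum>i\<in>I. cmod (z i))\<^sup>2" by (intro power_mono norm_sum) simp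
  also have "\<dots> \<le> (\<Sum>i\<in>I. (cmod (z i))\<^sup>2) * card I" by (rule sum_squared_le_sum_of_squares)
  finally show ?thesis by (simp add: mult.commute)
qed

section \<open>Hilbert spaces of functions\<close>

(* Differences are rewritten into sums with cscale (-1), which this rule would undo. *)
declare cfun.scale_minus_left [simp del]

text \<open>
  One locale serves both \<open>\<ell>\<^sub>2\<close> and \<open>H\<^sup>1\<close>. The inner product is constrained on \<open>H\<close> only, because the
  sums that define it need not converge elsewhere.
\<close>
locale hilbert_fun =
  fixes H :: "('x \<Rightarrow> complex) set" and ip :: "('x \<Rightarrow> complex) \<Rightarrow> ('x \<Rightarrow> complex) \<Rightarrow> complex"
  assumes zero_in [simp, intro]: "0 \<in> H"
    and add_in [intro]: "u \<in> H \<Longrightarrow> v \<in> H \<Longrightarrow> u + v \<in> H"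
    and scale_in [intro]: "u \<in> H \<Longrightarrow> cscale c u \<in> H"
    and ip_add_left: "u \<in> H \<Longrightarrow> v \<in> H \<Longrightarrow> w \<in> H \<Longrightarrow> ip (u + v) w = ip u w + ip v w"
    and ip_scale_left: "u \<in> H \<Longrightarrow> w \<in> H \<Longrightarrow> ip (cscale c u) w = c * ip u w"
    and ip_cnj: "u \<in> H \<Longrightarrow> v \<in> H \<Longrightarrow> ip v u = cnj (ip u v)"
    and ip_nonneg: "u \<in> H \<Longrightarrow> 0 \<le> Re (ip u u)"
    and ip_definite: "u \<in> H \<Longrightarrow> Re (ip u u) = 0 \<Longrightarrow> u = 0"
    and complete: "(\<And>n. f n \<in> H) \<Longrightarrow>
        (\<And>e. e > 0 \<Longrightarrow> \<exists>N::nat. \<forall>m\<ge>N. \<forall>n\<ge>N. hnorm ip (f m - f n) < e) \<Longrightarrow>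
        \<exists>w\<in>H. (\<lambda>n. hnorm ip (f n - w)) \<longlonglongrightarrow> 0"
begin

abbreviation nrm :: "('x \<Rightarrow> complex) \<Rightarrow> real" where "nrm \<equiv> hnorm ip"

lemma minus_eq_cscale: "- u = cscale (-1) u" for u :: "'x \<Rightarrow> complex"
  by (auto simp: fun_eq_iff)

lemma diff_eq_cscale: "u - v = u + cscale (-1) v" for u :: "'x \<Rightarrow> complex"
  by (auto simp: fun_eq_iff)

lemma minus_in [intro]: "u \<in> H \<Longrightarrow> - u \<in> H" by (simp add: minus_eq_cscale scale_in)

lemma diff_in [intro]: "u \<in> H \<Longrightarrow> v \<in> H \<Longrightarrow> u - v \<in> H"
  by (simp add: diff_eq_cscale scale_in add_in)

lemma lincomb_in [intro]: "(\<And>i. i \<in> I \<Longrightarrow> v i \<in> H) \<Longrightarrow> lincomb I c v \<in> H"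
  unfolding lincomb_def
  by (induction I rule: infinite_finite_induct) auto

lemma ip_add_right: "u \<in> H \<Longrightarrow> v \<in> H \<Longrightarrow> w \<in> H \<Longrightarrow> ip w (u + v) = ip w u + ip w v"
  using ip_cnj[of "u + v" w] ip_cnj[of u w] ip_cnj[of v w]
  by (simp add: ip_add_left add_in)

lemma ip_scale_right: "u \<in> H \<Longrightarrow> w \<in> H \<Longrightarrow> ip w (cscale c u) = cnj c * ip w u"
  using ip_cnj[of "cscale c u" w] ip_cnj[of u w] by (simp add: ip_scale_left scale_in)

lemma ip_diff_left: "u \<in> H \<Longrightarrow> v \<in> H \<Longrightarrow> w \<in> H \<Longrightarrow> ip (u - v) w = ip u w - ip v w"
  by (simp add: diff_eq_cscale ip_add_left ip_scale_left scale_in)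

lemma ip_diff_right: "u \<in> H \<Longrightarrow> v \<in> H \<Longrightarrow> w \<in> H \<Longrightarrow> ip w (u - v) = ip w u - ip w v"
  by (simp add: diff_eq_cscale ip_add_right ip_scale_right scale_in)

lemma ip_zero_left [simp]: "w \<in> H \<Longrightarrow> ip 0 w = 0"
  using ip_add_left[of 0 0 w] by simp

lemma ip_zero_right [simp]: "w \<in> H \<Longrightarrow> ip w 0 = 0"
  using ip_add_right[of 0 0 w] by simp

lemma ip_lincomb_left:
  assumes "w \<in> H" "\<And>i. i \<in> I \<Longrightarrow> v i \<in> H"
  shows "ip (lincomb I c v) w = (\<Sum>i\<in>I. c i * ip (v i) w)"
  using assms(2)
proof (induction I rule: infinite_finite_induct)
  case (insert i I)
  have "lincomb (insert i I) c v = cscale (c i) (v i) + lincomb I c v"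
    using insert.hyps by (simp add: lincomb_def)
  moreover have "lincomb I c v \<in> H" using insert.prems by auto
  moreover have "v i \<in> H" using insert.prems by auto
  ultimately have "ip (lincomb (insert i I) c v) w = c i * ip (v i) w + ip (lincomb I c v) w"
    using assms(1) by (simp only: ip_add_left ip_scale_left scale_in)
  then show ?case using insert by simp
qed (use assms(1) in \<open>simp_all add: lincomb_def\<close>)

lemma ip_lincomb_right:
  assumes "w \<in> H" "\<And>i. i \<in> I \<Longrightarrow> v i \<in> H"
  shows "ip w (lincomb I c v) = (\<Sum>i\<in>I. cnj (c i) * ip w (v i))"
proof -
  have "ip w (lincomb I c v) = cnj (\<Sum>i\<in>I. c i * ip (v i) w)"
    using assms by (subst ip_cnj[of "lincomb I c v"]) (auto simp: ip_lincomb_left)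
  also have "\<dots> = (\<Sum>i\<in>I. cnj (c i) * ip w (v i))"
    using assms by (auto intro!: sum.cong simp: ip_cnj[of _ w])
  finally show ?thesis .
qed

lemma ip_self: "u \<in> H \<Longrightarrow> ip u u = complex_of_real ((nrm u)\<^sup>2)"
  using ip_cnj[of u u] ip_nonneg[of u] by (auto simp: hnorm_def complex_eq_iff)

lemma nrm_sq: "u \<in> H \<Longrightarrow> (nrm u)\<^sup>2 = Re (ip u u)"
  using ip_nonneg[of u] by (simp add: hnorm_def)

lemma nrm_nonneg [simp]: "u \<in> H \<Longrightarrow> 0 \<le> nrm u" using ip_nonneg by (simp add: hnorm_def)

lemma nrm_zero [simp]: "nrm 0 = 0" by (simp add: hnorm_def)

lemma nrm_eq_0: "u \<in> H \<Longrightarrow> nrm u = 0 \<longleftrightarrow> u = 0"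
  using ip_definite[of u] nrm_sq[of u] by fastforce

lemma nrm_scale: "u \<in> H \<Longrightarrow> nrm (cscale c u) = cmod c * nrm u"
proof -
  assume u: "u \<in> H"
  have "ip (cscale c u) (cscale c u) = complex_of_real ((cmod c)\<^sup>2 * (nrm u)\<^sup>2)"
  proof -
    have "ip (cscale c u) (cscale c u) = (c * cnj c) * ip u u"
      using u by (simp add: ip_scale_left ip_scale_right scale_in)
    then show ?thesis using u
      by (simp only: ip_self complex_norm_square[symmetric] of_real_mult)
  qed
  then have "nrm (cscale c u) = sqrt ((cmod c * nrm u)\<^sup>2)"
    by (simp add: hnorm_def power_mult_distrib del: real_sqrt_abs)
  then show ?thesis using u by simp
qed

lemma nrm_minus: "u \<in> H \<Longrightarrow> nrm (- u) = nrm u"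
  by (simp add: minus_eq_cscale nrm_scale)

lemma nrm_minus_commute: "u \<in> H \<Longrightarrow> v \<in> H \<Longrightarrow> nrm (u - v) = nrm (v - u)"
  using nrm_minus[OF diff_in[of u v]] by simp

lemma nrm_sq_add:
  "u \<in> H \<Longrightarrow> v \<in> H \<Longrightarrow> (nrm (u + v))\<^sup>2 = (nrm u)\<^sup>2 + 2 * Re (ip u v) + (nrm v)\<^sup>2"
  using ip_cnj[of u v] by (simp add: nrm_sq add_in ip_add_left ip_add_right)

lemma nrm_sq_diff:
  "u \<in> H \<Longrightarrow> v \<in> H \<Longrightarrow> (nrm (u - v))\<^sup>2 = (nrm u)\<^sup>2 - 2 * Re (ip u v) + (nrm v)\<^sup>2"
  using ip_cnj[of u v] by (simp add: nrm_sq diff_in ip_diff_left ip_diff_right)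

lemma Cauchy_Schwarz:
  assumes "u \<in> H" "v \<in> H"
  shows "cmod (ip u v) \<le> nrm u * nrm v"
proof (cases "v = 0")
  case True then show ?thesis using assms by simp
next
  case False
  define t where "t = ip u v"
  have v: "(nrm v)\<^sup>2 > 0" using False assms nrm_eq_0 by simp
  have "0 \<le> (nrm (cscale ((nrm v)\<^sup>2) u - cscale t v))\<^sup>2" by simp
  also have "\<dots> = ((nrm v)\<^sup>2)\<^sup>2 * (nrm u)\<^sup>2 - 2 * ((nrm v)\<^sup>2 * (cmod t)\<^sup>2) + (cmod t)\<^sup>2 * (nrm v)\<^sup>2"
  proof -
    have "cnj t * ip u v = complex_of_real ((cmod t)\<^sup>2)"
      by (simp add: t_def complex_norm_square mult.commute del: of_real_power)
    then have "ip (cscale ((nrm v)\<^sup>2) u) (cscale t v) = complex_of_real ((nrm v)\<^sup>2 * (cmod t)\<^sup>2)"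
      using assms by (simp add: ip_scale_left ip_scale_right scale_in del: of_real_power)
    then have "Re (ip (cscale ((nrm v)\<^sup>2) u) (cscale t v)) = (nrm v)\<^sup>2 * (cmod t)\<^sup>2"
      by (simp del: of_real_power)
    then show ?thesis using assms
      by (simp add: nrm_sq_diff scale_in nrm_scale power_mult_distrib norm_power del: of_real_power)
  qed
  also have "\<dots> = (nrm v)\<^sup>2 * ((nrm u * nrm v)\<^sup>2 - (cmod t)\<^sup>2)"
    by (simp add: algebra_simps power2_eq_square)
  finally have "(cmod t)\<^sup>2 \<le> (nrm u * nrm v)\<^sup>2" using v
    by (simp add: zero_le_mult_iff)
  then show ?thesis unfolding t_def by (rule power2_le_imp_le) (use assms in simp)
qed

lemma nrm_triangle: "u \<in> H \<Longrightarrow> v \<in> H \<Longrightarrow> nrm (u + v) \<le> nrm u + nrm v"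
proof (rule power2_le_imp_le)
  assume uv: "u \<in> H" "v \<in> H"
  have "Re (ip u v) \<le> nrm u * nrm v"
    using Cauchy_Schwarz[OF uv] complex_Re_le_cmod[of "ip u v"] by linarith
  then show "(nrm (u + v))\<^sup>2 \<le> (nrm u + nrm v)\<^sup>2"
    using uv by (simp add: nrm_sq_add power2_sum)
qed simp

lemma nrm_triangle_diff: "u \<in> H \<Longrightarrow> v \<in> H \<Longrightarrow> w \<in> H \<Longrightarrow> nrm (u - w) \<le> nrm (u - v) + nrm (v - w)"
  using nrm_triangle[of "u - v" "v - w"] by (simp add: diff_in)

lemma abs_nrm_diff: "u \<in> H \<Longrightarrow> v \<in> H \<Longrightarrow> \<bar>nrm u - nrm v\<bar> \<le> nrm (u - v)"
  using nrm_triangle_diff[of u v 0] nrm_triangle_diff[of v u 0] nrm_minus_commute[of u v] by simp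

lemma nrm_tendsto:
  assumes "\<And>n. f n \<in> H" "w \<in> H" "(\<lambda>n. nrm (f n - w)) \<longlonglongrightarrow> 0"
  shows "(\<lambda>n. nrm (f n)) \<longlonglongrightarrow> nrm w"
proof -
  have "(\<lambda>n. nrm (f n) - nrm w) \<longlonglongrightarrow> 0"
    by (rule Lim_null_comparison[OF _ assms(3)])
       (use assms abs_nrm_diff in auto)
  then show ?thesis by (simp add: LIM_zero_iff)
qed

lemma ip_tendsto:
  assumes "\<And>n. f n \<in> H" "w \<in> H" "(\<lambda>n. nrm (f n - w)) \<longlonglongrightarrow> 0" "v \<in> H"
  shows "(\<lambda>n. ip (f n) v) \<longlonglongrightarrow> ip w v"
proof -
  have "(\<lambda>n. nrm (f n - w) * nrm v) \<longlonglongrightarrow> 0" by (rule tendsto_mult_left_zero[OF assms(3)])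
  moreover have "cmod (ip (f n) v - ip w v) \<le> nrm (f n - w) * nrm v" for n
    using Cauchy_Schwarz[of "f n - w" v] assms by (simp add: ip_diff_left diff_in)
  ultimately have "(\<lambda>n. ip (f n) v - ip w v) \<longlonglongrightarrow> 0"
    by (intro Lim_null_comparison[OF _ \<open>(\<lambda>n. nrm (f n - w) * nrm v) \<longlonglongrightarrow> 0\<close>]) auto
  then show ?thesis by (simp add: LIM_zero_iff)
qed

lemma eq_if_ip_eq:
  assumes "w \<in> H" "z \<in> H" "\<And>v. v \<in> H \<Longrightarrow> ip w v = ip z v"
  shows "w = z"
proof -
  have "ip (w - z) (w - z) = 0" using assms by (simp add: ip_diff_left diff_in)
  then have "w - z = 0" using ip_definite[of "w - z"] assms by auto
  then show ?thesis by simp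
qed

subsection \<open>Riesz representation\<close>

text \<open>
  The representing vector minimises \<open>J u = \<parallel>u\<parallel>\<^sup>2 - 2 Re \<phi>(u)\<close>: by the parallelogram law a minimising
  sequence is Cauchy, and the first variation at the minimiser vanishes.
\<close>
lemma Riesz_representation:
  assumes lin: "\<And>u v. u \<in> H \<Longrightarrow> v \<in> H \<Longrightarrow> phi (u + v) = phi u + phi v"
    "\<And>c u. u \<in> H \<Longrightarrow> phi (cscale c u) = c * phi u"
    and bd: "\<And>u. u \<in> H \<Longrightarrow> cmod (phi u) \<le> K * nrm u"
  shows "\<exists>w\<in>H. \<forall>v\<in>H. phi v = ip v w"
proof -
  define J where "J u = (nrm u)\<^sup>2 - 2 * Re (phi u)" for u
  have J_ge: "- K\<^sup>2 \<le> J u" if "u \<in> H" for u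
  proof -
    have "Re (phi u) \<le> K * nrm u" using bd[OF that] complex_Re_le_cmod[of "phi u"] by linarith
    moreover have "0 \<le> (nrm u - K)\<^sup>2" by simp
    ultimately show ?thesis unfolding J_def power2_diff by (simp add: mult.commute)
  qed
  have bdd: "bdd_below (J ` H)" using J_ge by (intro bdd_belowI[of _ "- K\<^sup>2"]) auto
  define m where "m = Inf (J ` H)"
  have m_le: "m \<le> J u" if "u \<in> H" for u unfolding m_def using bdd that by (intro cInf_lower) auto
  have "\<exists>u\<in>H. J u < m + 1 / Suc n" for n
  proof -
    have "m < m + 1 / Suc n" by simp
    then show ?thesis unfolding m_def
      using cInf_lessD[of "J ` H" "m + 1 / Suc n"] zero_in m_def by (metis (no_types, lifting) empty_iff imageE image_eqI)
  qed
  then obtain f where f: "\<And>n. f n \<in> H" "\<And>n. J (f n) < m + 1 / Suc n" by metis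
  have par: "(nrm (u - v))\<^sup>2 \<le> 2 * (J u - m) + 2 * (J v - m)" if uv: "u \<in> H" "v \<in> H" for u v
  proof -
    have h: "cscale (1/2) (u + v) \<in> H" using uv by auto
    have "J (cscale (1/2) (u + v)) = (nrm (u + v))\<^sup>2 / 4 - Re (phi u) - Re (phi v)"
      using uv unfolding J_def
      by (simp add: nrm_scale add_in lin power_mult_distrib power2_eq_square add_divide_distrib)
    moreover have "(nrm (u + v))\<^sup>2 = 2 * (nrm u)\<^sup>2 + 2 * (nrm v)\<^sup>2 - (nrm (u - v))\<^sup>2"
      using uv by (simp add: nrm_sq_add nrm_sq_diff)
    ultimately have "4 * m \<le> 2 * (nrm u)\<^sup>2 + 2 * (nrm v)\<^sup>2 - (nrm (u - v))\<^sup>2 - 4 * Re (phi u) - 4 * Re (phi v)"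
      using m_le[OF h] by linarith
    then show ?thesis unfolding J_def right_diff_distrib by argo
  qed
  have "\<exists>w\<in>H. (\<lambda>n. nrm (f n - w)) \<longlonglongrightarrow> 0"
  proof (rule complete)
    fix e :: real assume e: "e > 0"
    obtain N :: nat where "1 / Suc N < e\<^sup>2 / 4"
      using nat_approx_posE[of "e\<^sup>2 / 4"] e by auto
    then have N: "4 / Suc N < e\<^sup>2" by simp
    have "nrm (f k - f n) < e" if "k \<ge> N" "n \<ge> N" for k n
    proof (rule power2_less_imp_less)
      have "1 / Suc k \<le> 1 / Suc N" "1 / Suc n \<le> 1 / Suc N" using that by (auto simp: frac_le)
      then have "J (f k) - m \<le> 1 / Suc N" "J (f n) - m \<le> 1 / Suc N"
        using f(2)[of k] f(2)[of n] by linarith+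
      moreover have "4 / Suc N = 2 * (1 / Suc N) + 2 * (1 / real (Suc N))" by simp
      ultimately have "(nrm (f k - f n))\<^sup>2 \<le> 4 / Suc N"
        using par[OF f(1) f(1), of k n] by argo
      then show "(nrm (f k - f n))\<^sup>2 < e\<^sup>2" using N by linarith
    qed (use e in simp)
    then show "\<exists>N. \<forall>m\<ge>N. \<forall>n\<ge>N. nrm (f m - f n) < e" by blast
  qed (use f in auto)
  then obtain w where w: "w \<in> H" "(\<lambda>n. nrm (f n - w)) \<longlonglongrightarrow> 0" by blast
  have "J w \<le> m"
  proof -
    have "(\<lambda>n. phi (f n) - phi w) \<longlonglongrightarrow> 0"
    proof (rule Lim_null_comparison)
      show "(\<lambda>n. K * nrm (f n - w)) \<longlonglongrightarrow> 0" by (rule tendsto_mult_right_zero[OF w(2)])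
      have "phi (f n - w) = phi (f n) - phi w" for n
        using f(1)[of n] w(1) by (simp add: diff_eq_cscale[of "f n" w] lin scale_in)
      then have "cmod (phi (f n) - phi w) \<le> K * nrm (f n - w)" for n
        using bd[of "f n - w"] f w by auto
      then show "\<forall>\<^sub>F n in sequentially. cmod (phi (f n) - phi w) \<le> K * nrm (f n - w)" by simp
    qed
    then have "(\<lambda>n. phi (f n)) \<longlonglongrightarrow> phi w" by (simp add: LIM_zero_iff)
    then have "(\<lambda>n. J (f n)) \<longlonglongrightarrow> J w"
      unfolding J_def using nrm_tendsto[OF f(1) w] by (intro tendsto_intros)
    moreover have "(\<lambda>n. m + 1 / Suc n) \<longlonglongrightarrow> m + 0"
      by (intro tendsto_add tendsto_const LIMSEQ_Suc[OF lim_1_over_n])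
    ultimately show ?thesis
      using f(2) by (intro LIMSEQ_le[of "\<lambda>n. J (f n)" "J w" "\<lambda>n. m + 1 / Suc n" m]) (auto intro: less_imp_le)
  qed
  have re: "Re (phi v) = Re (ip v w)" if v: "v \<in> H" for v
  proof -
    have q: "0 \<le> 2 * t * (Re (ip v w) - Re (phi v)) + t\<^sup>2 * (nrm v)\<^sup>2" for t :: real
    proof -
      have "J w \<le> J (w + cscale t v)" using \<open>J w \<le> m\<close> m_le v w by (meson add_in order.trans scale_in)
      moreover have "Re (ip w v) = Re (ip v w)" using ip_cnj[OF v w(1)] by simp
      moreover have "J (w + cscale t v) = (nrm w)\<^sup>2 + 2 * t * Re (ip w v) + t\<^sup>2 * (nrm v)\<^sup>2
          - 2 * Re (phi w) - 2 * t * Re (phi v)"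
        using v w unfolding J_def
        by (simp add: nrm_sq_add scale_in lin nrm_scale ip_scale_right power_mult_distrib)
      ultimately show ?thesis unfolding J_def by (simp add: algebra_simps)
    qed
    define D where "D = Re (ip v w) - Re (phi v)"
    have "D = 0"
    proof (rule ccontr)
      assume "D \<noteq> 0"
      have "0 \<le> 2 * t * D + t\<^sup>2 * (nrm v)\<^sup>2" for t using q[of t] unfolding D_def .
      note nonneg = this
      \<comment> \<open>a step in the direction of \<open>v\<close> that makes the quadratic polynomial in \<open>t\<close> negative unless \<open>D = 0\<close>\<close>
      define P where "P = (nrm v)\<^sup>2 + 1"
      have P: "P > 0" by (simp add: P_def add_nonneg_pos)
      define t where "t = - D / P"
      have "t\<^sup>2 * (nrm v)\<^sup>2 \<le> t\<^sup>2 * P" by (intro mult_left_mono) (auto simp: P_def)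
      also have "\<dots> = t * (t * P)" by (simp add: power2_eq_square)
      also have "t * P = - D" using P by (simp add: t_def)
      finally have "0 \<le> t * D" using nonneg[of t] by simp
      moreover have "t * D < 0" using P \<open>D \<noteq> 0\<close> by (simp add: t_def power2_eq_square[symmetric])
      ultimately show False by simp
    qed
    then show ?thesis unfolding D_def by simp
  qed
  have "phi v = ip v w" if v: "v \<in> H" for v
    using re[OF v] re[of "cscale \<i> v"] v w(1) by (auto simp: lin ip_scale_left complex_eq_iff)
  then show ?thesis using w by blast
qed

definition orthonormal :: "('x \<Rightarrow> complex) set \<Rightarrow> bool" where
  "orthonormal E \<longleftrightarrow> finite E \<and> E \<subseteq> H \<and> (\<forall>u\<in>E. nrm u = 1) \<and>
     (\<forall>u\<in>E. \<forall>v\<in>E. u \<noteq> v \<longrightarrow> ip u v = 0)"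

lemma orthonormalD:
  assumes "orthonormal E"
  shows "finite E" "u \<in> E \<Longrightarrow> u \<in> H" "u \<in> E \<Longrightarrow> nrm u = 1"
    "u \<in> E \<Longrightarrow> v \<in> E \<Longrightarrow> u \<noteq> v \<Longrightarrow> ip u v = 0"
  using assms by (auto simp: orthonormal_def)

lemma orthonormal_empty [simp]: "orthonormal {}" by (simp add: orthonormal_def)

lemma orthonormal_ip:
  assumes "orthonormal E" "u \<in> E" "v \<in> E"
  shows "ip u v = (if u = v then 1 else 0)"
  using assms orthonormalD[OF assms(1)] ip_self[of u] by auto

lemma orthonormal_insert:
  assumes "orthonormal E" "w \<in> H" "nrm w = 1" "\<And>e. e \<in> E \<Longrightarrow> ip w e = 0"
  shows "orthonormal (insert w E)" "card (insert w E) = Suc (card E)"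
proof -
  have "ip e w = 0" if "e \<in> E" for e
    using ip_cnj[of w e] assms that orthonormalD(2)[OF assms(1)] by simp
  then show "orthonormal (insert w E)" using assms by (auto simp: orthonormal_def)
  have "w \<notin> E" using assms(2,3,4) ip_self[of w] by force
  then show "card (insert w E) = Suc (card E)" using orthonormalD(1)[OF assms(1)] by simp
qed

lemma ip_lincomb_orthonormal:
  assumes "orthonormal E" "e \<in> E"
  shows "ip (lincomb E c (\<lambda>e. e)) e = c e"
proof -
  have "ip (lincomb E c (\<lambda>e. e)) e = (\<Sum>f\<in>E. c f * ip f e)"
    using assms orthonormalD[OF assms(1)] by (intro ip_lincomb_left) auto
  also have "\<dots> = (\<Sum>f\<in>E. if f = e then c f else 0)"
    using assms by (intro sum.cong) (auto simp: orthonormal_ip)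
  finally show ?thesis using assms orthonormalD[OF assms(1)] by simp
qed

lemma nrm_sq_lincomb_orthonormal:
  assumes "orthonormal E"
  shows "(nrm (lincomb E c (\<lambda>e. e)))\<^sup>2 = (\<Sum>e\<in>E. (cmod (c e))\<^sup>2)"
proof -
  let ?u = "lincomb E c (\<lambda>e. e)"
  have u: "?u \<in> H" using orthonormalD[OF assms] by auto
  have "ip ?u ?u = (\<Sum>e\<in>E. cnj (c e) * ip ?u e)"
    using u orthonormalD[OF assms] by (intro ip_lincomb_right) auto
  also have "\<dots> = (\<Sum>e\<in>E. complex_of_real ((cmod (c e))\<^sup>2))"
    by (intro sum.cong) (simp_all add: ip_lincomb_orthonormal[OF assms] complex_norm_square
        mult.commute del: of_real_power)
  finally have "ip ?u ?u = complex_of_real (\<Sum>e\<in>E. (cmod (c e))\<^sup>2)" by simp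
  then show ?thesis using u by (simp add: nrm_sq)
qed

text \<open>
  The source of all extensions of orthonormal systems below: Gram--Schmidt, the variational
  principle and the dimension bound all impose fewer conditions than there are dimensions and then
  normalise the solution.
\<close>
lemma unit_vector_in_kernel:
  fixes a :: "'j \<Rightarrow> 'i \<Rightarrow> complex"
  assumes "finite I" "\<And>i. i \<in> I \<Longrightarrow> v i \<in> H"
    and inj: "\<And>c. \<exists>i\<in>I. c i \<noteq> 0 \<Longrightarrow> lincomb I c v \<noteq> 0"
    and "finite J" "card J < card I"
  shows "\<exists>c. (\<exists>i\<in>I. c i \<noteq> 0) \<and> nrm (lincomb I c v) = 1 \<and> (\<forall>j\<in>J. (\<Sum>i\<in>I. c i * a j i) = 0)"
proof -
  obtain c where c: "\<exists>i\<in>I. c i \<noteq> 0" "\<forall>j\<in>J. (\<Sum>i\<in>I. c i * a j i) = 0"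
    using homogeneous_system_nontrivial_solution[OF assms(4,1,5), of a] by blast
  define u where "u = lincomb I c v"
  have u: "u \<in> H" "u \<noteq> 0" using assms(2) inj[OF c(1)] by (auto simp: u_def)
  then have p: "nrm u > 0" using nrm_eq_0[of u] nrm_nonneg[of u] by linarith
  define d where "d = (\<lambda>i. complex_of_real (1 / nrm u) * c i)"
  have "lincomb I d v = cscale (complex_of_real (1 / nrm u)) u"
    unfolding u_def cscale_lincomb d_def ..
  then have "nrm (lincomb I d v) = 1" using u p by (simp add: nrm_scale norm_divide)
  moreover have "\<exists>i\<in>I. d i \<noteq> 0" using c p by (auto simp: d_def)
  moreover have "(\<Sum>i\<in>I. d i * a j i) = 0" if "j \<in> J" for j
  proof -
    have "(\<Sum>i\<in>I. d i * a j i) = complex_of_real (1 / nrm u) * (\<Sum>i\<in>I. c i * a j i)"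
      by (simp add: d_def sum_distrib_left mult.assoc)
    then show ?thesis using c that by simp
  qed
  ultimately show ?thesis by blast
qed

lemma unit_vector_orthogonal:
  assumes "finite I" "\<And>i. i \<in> I \<Longrightarrow> v i \<in> H"
    and "\<And>c. \<exists>i\<in>I. c i \<noteq> 0 \<Longrightarrow> lincomb I c v \<noteq> 0"
    and "orthonormal E" "card E < card I"
  shows "\<exists>c. (\<exists>i\<in>I. c i \<noteq> 0) \<and> nrm (lincomb I c v) = 1 \<and> (\<forall>e\<in>E. ip (lincomb I c v) e = 0)"
proof -
  obtain c where "\<exists>i\<in>I. c i \<noteq> 0" "nrm (lincomb I c v) = 1" "\<forall>e\<in>E. (\<Sum>i\<in>I. c i * ip (v i) e) = 0"
    using unit_vector_in_kernel[OF assms(1,2,3) orthonormalD(1)[OF assms(4)] assms(5),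
        of "\<lambda>e i. ip (v i) e"] by blast
  then show ?thesis using assms orthonormalD(2)[OF assms(4)]
    by (intro exI[of _ c]) (auto simp: ip_lincomb_left)
qed

lemma orthonormal_in_subspace:
  assumes "finite B" "cfun.independent B" "B \<subseteq> S" "cfun.subspace S" "S \<subseteq> H" "k \<le> card B"
  shows "\<exists>E. orthonormal E \<and> E \<subseteq> S \<and> card E = k"
  using \<open>k \<le> card B\<close>
proof (induction k)
  case 0 show ?case by (intro exI[of _ "{}"]) simp
next
  case (Suc k)
  then obtain E where E: "orthonormal E" "E \<subseteq> S" "card E = k" by auto
  have nz: "lincomb B c (\<lambda>b. b) \<noteq> 0" if "\<exists>b\<in>B. c b \<noteq> 0" for c
    using that assms(1,2) unfolding lincomb_def cfun.dependent_finite[OF assms(1)] by blast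
  have BH: "b \<in> H" if "b \<in> B" for b using that assms by blast
  have "card E < card B" using Suc.prems E by simp
  then obtain c where c: "nrm (lincomb B c (\<lambda>b. b)) = 1" "\<forall>e\<in>E. ip (lincomb B c (\<lambda>b. b)) e = 0"
    using unit_vector_orthogonal[OF assms(1) BH nz E(1)] by blast
  have "lincomb B c (\<lambda>b. b) \<in> S" using assms by (intro lincomb_in_subspace) auto
  then show ?case using orthonormal_insert[OF E(1), of "lincomb B c (\<lambda>b. b)"] c E assms
    by (intro exI[of _ "insert (lincomb B c (\<lambda>b. b)) E"]) auto
qed

lemma orthonormal_independent:
  assumes "orthonormal E"
  shows "cfun.independent E"
  unfolding cfun.dependent_finite[OF orthonormalD(1)[OF assms]]
proof clarify
  fix c e assume h: "(\<Sum>v\<in>E. cscale (c v) v) = 0" "e \<in> E" "c e \<noteq> 0"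
  then have "ip (lincomb E c (\<lambda>e. e)) e = 0"
    using orthonormalD(2)[OF assms] by (simp add: lincomb_def)
  then show False using h ip_lincomb_orthonormal[OF assms] by simp
qed

text \<open>
  Independent sets are traded for orthonormal ones, so that multiplicities of different
  eigenvalues can be added by taking unions.
\<close>
lemma edim_ge_iff:
  assumes "cfun.subspace S" "S \<subseteq> H"
  shows "enat m \<le> edim S \<longleftrightarrow> (\<exists>E. orthonormal E \<and> E \<subseteq> S \<and> card E = m)"
proof -
  have ne: "{B. finite B \<and> B \<subseteq> S \<and> cfun.independent B} \<noteq> {}"
    by (auto intro!: exI[of _ "{}"] simp: cfun.independent_empty)
  have iff: "enat m \<le> edim S \<longleftrightarrow> (\<exists>B. finite B \<and> B \<subseteq> S \<and> cfun.independent B \<and> m \<le> card B)"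
    unfolding edim_def enat_le_SUP_iff[OF ne] by auto
  show ?thesis
  proof
    assume "enat m \<le> edim S"
    then obtain B where "finite B" "B \<subseteq> S" "cfun.independent B" "m \<le> card B"
      using iff by blast
    then show "\<exists>E. orthonormal E \<and> E \<subseteq> S \<and> card E = m"
      by (intro orthonormal_in_subspace[OF _ _ _ assms])
  next
    assume "\<exists>E. orthonormal E \<and> E \<subseteq> S \<and> card E = m"
    then obtain E where "orthonormal E" "E \<subseteq> S" "card E = m" by blast
    then show "enat m \<le> edim S"
      unfolding iff using orthonormal_independent orthonormalD(1) by blast
  qed
qed

subsection \<open>Eigenvectors of symmetric operators\<close>
definition symmetric_op :: "(('x \<Rightarrow> complex) \<Rightarrow> ('x \<Rightarrow> complex)) \<Rightarrow> bool" where
  "symmetric_op T \<longleftrightarrow> linear_op H T \<and> (\<forall>u\<in>H. \<forall>v\<in>H. ip (T u) v = ip u (T v))"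

lemma linear_opD:
  assumes "linear_op H T"
  shows "u \<in> H \<Longrightarrow> T u \<in> H" "u \<in> H \<Longrightarrow> v \<in> H \<Longrightarrow> T (u + v) = T u + T v"
    "u \<in> H \<Longrightarrow> T (cscale c u) = cscale c (T u)"
    "u \<in> H \<Longrightarrow> v \<in> H \<Longrightarrow> T (u - v) = T u - T v"
  using assms unfolding linear_op_def diff_eq_cscale by (auto simp: scale_in)

lemma linear_op_0: "linear_op H T \<Longrightarrow> T 0 = 0"
  using linear_opD(4)[of T 0 0] by simp

lemma eigenspace_subspace:
  assumes "linear_op H T"
  shows "cfun.subspace {u \<in> H. T u = cscale \<mu> u}"
  unfolding cfun.subspace_def
  using linear_opD[OF assms] linear_op_0[OF assms]
  by (auto simp: fun_eq_iff algebra_simps)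

text \<open>
  An orthonormal system of eigenvectors with eigenvalues in \<open>A\<close>; the eigenvalues may repeat, so the
  cardinality of \<open>E\<close> counts them with multiplicity.
\<close>
definition eigenvectors :: "(('x \<Rightarrow> complex) \<Rightarrow> ('x \<Rightarrow> complex)) \<Rightarrow> real set \<Rightarrow> ('x \<Rightarrow> complex) set \<Rightarrow> bool" where
  "eigenvectors T A E \<longleftrightarrow> orthonormal E \<and> (\<forall>e\<in>E. \<exists>\<mu>\<in>A. T e = cscale (complex_of_real \<mu>) e)"

lemma eigenvectors_orthogonal:
  assumes "symmetric_op T" "u \<in> H" "v \<in> H" "T u = cscale (complex_of_real \<mu>) u"
    "T v = cscale (complex_of_real \<nu>) v" "\<mu> \<noteq> \<nu>"
  shows "ip u v = 0"
proof -
  have "ip (T u) v = ip u (T v)" using assms by (auto simp: symmetric_op_def)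
  then have "(\<mu> - \<nu>) * ip u v = 0" using assms
    by (simp add: ip_scale_left ip_scale_right algebra_simps)
  then show ?thesis using assms(6) by simp
qed

text \<open>
  Eigenspaces of different eigenvalues are orthogonal, so orthonormal bases of them unite to an
  orthonormal system; conversely, such a system splits according to the eigenvalue. All statements
  about \<open>eig_count\<close> are derived from this description.
\<close>
lemma eig_count_ge_iff:
  assumes T: "symmetric_op T"
  shows "enat m \<le> eig_count H T A \<longleftrightarrow> (\<exists>E. eigenvectors T A E \<and> card E = m)"
proof
  let ?S = "\<lambda>\<mu>::real. {u \<in> H. T u = cscale (complex_of_real \<mu>) u}"
  have lin: "linear_op H T" using T by (simp add: symmetric_op_def)
  have mult: "enat k \<le> multiplicity_eig H T \<mu> \<longleftrightarrow> (\<exists>E. orthonormal E \<and> E \<subseteq> ?S \<mu> \<and> card E = k)" for k \<mu>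
    unfolding multiplicity_eig_def by (intro edim_ge_iff eigenspace_subspace lin) auto
  {
    assume "enat m \<le> eig_count H T A"
    then have "\<exists>F\<in>{F. finite F \<and> F \<subseteq> A}. enat m \<le> (\<Sum>\<mu>\<in>F. multiplicity_eig H T \<mu>)"
      unfolding eig_count_def by (subst (asm) enat_le_SUP_iff) auto
    then obtain F where F: "finite F" "F \<subseteq> A" "enat m \<le> (\<Sum>\<mu>\<in>F. multiplicity_eig H T \<mu>)" by blast
    have "\<exists>E. eigenvectors T F E \<and> card E = m"
      using F(1,3)
    proof (induction F arbitrary: m rule: finite_induct)
      case empty then show ?case
        by (intro exI[of _ "{}"]) (auto simp: eigenvectors_def zero_enat_def)
    next
      case (insert \<mu> F)
      then obtain k l where kl: "m = k + l" "enat k \<le> multiplicity_eig H T \<mu>"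
          "enat l \<le> (\<Sum>\<mu>\<in>F. multiplicity_eig H T \<mu>)"
        by (auto elim: enat_le_add_split)
      obtain E1 where E1: "orthonormal E1" "E1 \<subseteq> ?S \<mu>" "card E1 = k" using mult kl by blast
      obtain E2 where E2: "eigenvectors T F E2" "card E2 = l" using insert.IH kl by blast
      have o2: "orthonormal E2" using E2 by (simp add: eigenvectors_def)
      have orth: "ip u v = 0 \<and> ip v u = 0" if uv: "u \<in> E1" "v \<in> E2" for u v
      proof -
        obtain \<nu> where "\<nu> \<in> F" "T v = cscale (complex_of_real \<nu>) v"
          using E2(1) uv(2) unfolding eigenvectors_def by blast
        moreover have "\<mu> \<noteq> \<nu>" using \<open>\<nu> \<in> F\<close> insert.hyps by auto
        moreover have "u \<in> H" "v \<in> H" "T u = cscale (complex_of_real \<mu>) u"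
          using E1 uv orthonormalD(2)[OF o2] by auto
        ultimately show ?thesis using eigenvectors_orthogonal[OF T] by metis
      qed
      have "E1 \<inter> E2 = {}"
      proof -
        have False if "u \<in> E1" "u \<in> E2" for u
          using orth[OF that] orthonormal_ip[OF E1(1) that(1,1)] by simp
        then show ?thesis by blast
      qed
      then have "card (E1 \<union> E2) = m"
        using orthonormalD(1)[OF E1(1)] orthonormalD(1)[OF o2] E1 E2 kl by (simp add: card_Un_disjoint)
      moreover have "orthonormal (E1 \<union> E2)" using E1(1) o2 orth unfolding orthonormal_def by auto
      moreover have "\<forall>e\<in>E1 \<union> E2. \<exists>\<mu>\<in>insert \<mu> F. T e = cscale (complex_of_real \<mu>) e"
        using E1(2) E2(1) unfolding eigenvectors_def by blast
      ultimately show ?case unfolding eigenvectors_def by blast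
    qed
    then show "\<exists>E. eigenvectors T A E \<and> card E = m"
      using F(2) unfolding eigenvectors_def by blast
  }
  assume "\<exists>E. eigenvectors T A E \<and> card E = m"
  then obtain E where E: "eigenvectors T A E" "card E = m" by blast
  then obtain \<mu> where \<mu>: "\<And>e. e \<in> E \<Longrightarrow> \<mu> e \<in> A \<and> T e = cscale (complex_of_real (\<mu> e)) e"
    unfolding eigenvectors_def by metis
  have oE: "orthonormal E" using E by (simp add: eigenvectors_def)
  have "enat (card {e \<in> E. \<mu> e = y}) \<le> multiplicity_eig H T y" for y
  proof -
    have "orthonormal {e \<in> E. \<mu> e = y}" using oE unfolding orthonormal_def by auto
    moreover have "{e \<in> E. \<mu> e = y} \<subseteq> ?S y" using \<mu> orthonormalD(2)[OF oE] by auto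
    ultimately show ?thesis using mult by blast
  qed
  then have "(\<Sum>y\<in>\<mu> ` E. enat (card {e \<in> E. \<mu> e = y})) \<le> (\<Sum>y\<in>\<mu> ` E. multiplicity_eig H T y)"
    by (intro sum_mono)
  moreover have "card E = (\<Sum>y\<in>\<mu> ` E. card {e \<in> E. \<mu> e = y})"
    using sum.image_gen[of E "\<lambda>_. 1::nat" \<mu>] orthonormalD(1)[OF oE] by simp
  moreover have "(\<Sum>y\<in>Y. enat (f y)) = enat (sum f Y)" for Y :: "real set" and f
    by (induction Y rule: infinite_finite_induct) (auto simp: zero_enat_def)
  moreover have "(\<Sum>y\<in>\<mu> ` E. multiplicity_eig H T y) \<le> eig_count H T A"
    unfolding eig_count_def using \<mu> orthonormalD(1)[OF oE] by (intro SUP_upper) auto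
  ultimately show "enat m \<le> eig_count H T A" using E(2) by (metis order_trans)
qed

lemma adjoint_op_selfadjoint:
  assumes "\<And>u. u \<in> H \<Longrightarrow> T u \<in> H" "\<And>u v. u \<in> H \<Longrightarrow> v \<in> H \<Longrightarrow> ip (T u) v = ip u (T v)" "v \<in> H"
  shows "adjoint_op H ip T v = T v"
  unfolding adjoint_op_def
proof (rule the_equality)
  show "T v \<in> H \<and> (\<forall>u\<in>H. ip (T u) v = ip u (T v))" using assms by auto
next
  fix w assume w: "w \<in> H \<and> (\<forall>u\<in>H. ip (T u) v = ip u w)"
  show "w = T v"
  proof (rule eq_if_ip_eq)
    fix u assume u: "u \<in> H"
    then have "ip u w = ip u (T v)" using w assms by metis
    then show "ip w u = ip (T v) u" using ip_cnj[of u w] ip_cnj[of u "T v"] u w assms by simp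
  qed (use w assms in auto)
qed

lemma nonneg_selfadjoint_symmetric: "nonneg_selfadjoint_op H ip T \<Longrightarrow> symmetric_op T"
  by (simp add: nonneg_selfadjoint_op_def bounded_op_def symmetric_op_def)

text \<open>
  If \<open>R\<^sup>2 = T\<^sup>2\<close> and \<open>T u = \<mu> u\<close>, then \<open>(R + \<mu>)(R - \<mu>)u = 0\<close>, and \<open>R + \<mu>\<close> is injective for
  \<open>R \<ge> 0\<close> and \<open>\<mu> > 0\<close>. This identifies the positive eigenvalues of \<open>|T|\<close> without the uniqueness
  of the square root.
\<close>
lemma square_root_eigenvector:
  assumes R: "nonneg_selfadjoint_op H ip R" and T: "linear_op H T"
    and RT: "\<And>u. u \<in> H \<Longrightarrow> R (R u) = T (T u)"
    and u: "u \<in> H" "T u = cscale (complex_of_real \<mu>) u" and \<mu>: "\<mu> > 0"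
  shows "R u = cscale (complex_of_real \<mu>) u"
proof -
  have lin: "linear_op H R" using R by (simp add: nonneg_selfadjoint_op_def bounded_op_def)
  define w where "w = R u - cscale (complex_of_real \<mu>) u"
  have w: "w \<in> H" unfolding w_def using u linear_opD[OF lin] by auto
  have "R w = R (R u) - cscale (complex_of_real \<mu>) (R u)"
    unfolding w_def using u linear_opD[OF lin] by (simp add: scale_in)
  also have "R (R u) = cscale (complex_of_real \<mu>) (cscale (complex_of_real \<mu>) u)"
    using RT[OF u(1)] u linear_opD(3)[OF T] by simp
  also have "\<dots> - cscale (complex_of_real \<mu>) (R u) = cscale (- complex_of_real \<mu>) w"
    unfolding w_def by (auto simp: fun_eq_iff algebra_simps)
  finally have "R w = cscale (- complex_of_real \<mu>) w" .
  then have "Re (ip (R w) w) = - \<mu> * (nrm w)\<^sup>2"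
    using w by (simp add: ip_scale_left ip_self del: of_real_power)
  moreover have "0 \<le> Re (ip (R w) w)" using R w unfolding nonneg_selfadjoint_op_def by blast
  ultimately have "(nrm w)\<^sup>2 \<le> 0" using \<mu> by (simp add: mult_le_0_iff)
  then have "w = 0" using nrm_eq_0[OF w] by simp
  then show ?thesis by (simp add: w_def)
qed

lemma n_plus_abs_op:
  assumes T: "nonneg_selfadjoint_op H ip T" and s: "s \<ge> 0"
  shows "n_plus H s (abs_op H ip T) = n_plus H s T"
proof -
  have lin: "linear_op H T" and sym: "\<And>u v. u \<in> H \<Longrightarrow> v \<in> H \<Longrightarrow> ip (T u) v = ip u (T v)"
    using T by (auto simp: nonneg_selfadjoint_op_def bounded_op_def)
  have adj: "adjoint_op H ip T (T u) = T (T u)" if "u \<in> H" for u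
    using that by (intro adjoint_op_selfadjoint linear_opD[OF lin] sym)
  define R where "R = abs_op H ip T"
  have "nonneg_selfadjoint_op H ip R \<and> (\<forall>u\<in>H. R (R u) = adjoint_op H ip T (T u))"
    unfolding R_def abs_op_def
    by (rule someI[of _ T]) (use T adj in auto)
  then have R: "nonneg_selfadjoint_op H ip R" and RR: "\<And>u. u \<in> H \<Longrightarrow> R (R u) = T (T u)"
    using adj by auto
  have linR: "linear_op H R" using R by (simp add: nonneg_selfadjoint_op_def bounded_op_def)
  have eq: "R e = cscale (complex_of_real \<mu>) e \<longleftrightarrow> T e = cscale (complex_of_real \<mu>) e"
    if "e \<in> H" "\<mu> > s" for e \<mu>
    using square_root_eigenvector[OF R lin RR that(1), of \<mu>]
      square_root_eigenvector[OF T linR RR[symmetric] that(1), of \<mu>] that s by auto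
  have "eigenvectors R {s<..} E \<longleftrightarrow> eigenvectors T {s<..} E" for E
  proof (cases "orthonormal E")
    case True
    have "(\<exists>\<mu>\<in>{s<..}. R e = cscale (complex_of_real \<mu>) e) \<longleftrightarrow>
        (\<exists>\<mu>\<in>{s<..}. T e = cscale (complex_of_real \<mu>) e)" if "e \<in> E" for e
      using eq[OF orthonormalD(2)[OF True that]] by auto
    then show ?thesis unfolding eigenvectors_def by simp
  qed (simp add: eigenvectors_def)
  then show ?thesis unfolding R_def[symmetric] n_plus_def
    by (intro enat_eqI) (simp add: eig_count_ge_iff nonneg_selfadjoint_symmetric R T)
qed

subsection \<open>The variational principle\<close>
lemma nrm_minus_le: "u \<in> H \<Longrightarrow> v \<in> H \<Longrightarrow> nrm (u - v) \<le> nrm u + nrm v"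
  using nrm_triangle_diff[of u 0 v] nrm_minus[of v] by simp

text \<open>
  If the form of \<open>\<Lambda> - T\<close> is nonnegative along the line through \<open>u\<close> in the direction of the residual
  \<open>r = (\<Lambda> - T)u\<close>, then a small value of the form at \<open>u\<close> forces a small residual; otherwise a
  step along \<open>- r\<close> would make the form negative.
\<close>
lemma residual_bound:
  assumes T: "symmetric_op T" and bd: "\<And>u. u \<in> H \<Longrightarrow> nrm (T u) \<le> C * nrm u"
    and C: "0 \<le> C" and \<Lambda>: "0 < \<Lambda>" and u: "u \<in> H" "nrm u = 1"
    and r_def: "r = cscale (complex_of_real \<Lambda>) u - T u"
    and max: "\<And>t. Re (ip (T (u - cscale (complex_of_real t) r)) (u - cscale (complex_of_real t) r))
        \<le> \<Lambda> * (nrm (u - cscale (complex_of_real t) r))\<^sup>2"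
  shows "(nrm r)\<^sup>2 \<le> (\<Lambda> + C) * (\<Lambda> - Re (ip (T u) u))"
proof -
  have lin: "linear_op H T" and sym: "\<And>u v. u \<in> H \<Longrightarrow> v \<in> H \<Longrightarrow> ip (T u) v = ip u (T v)"
    using T by (auto simp: symmetric_op_def)
  note [simp] = linear_opD(1)[OF lin] diff_in add_in scale_in
  have rH [simp]: "r \<in> H" using u by (simp add: r_def)
  define q where "q u = Re (ip (T u) u)" for u
  have q_ge: "- (C * (nrm r)\<^sup>2) \<le> q r"
  proof -
    have "\<bar>q r\<bar> \<le> nrm (T r) * nrm r"
      unfolding q_def using Cauchy_Schwarz[of "T r" r] abs_Re_le_cmod[of "ip (T r) r"] by simp
    also have "\<dots> \<le> C * nrm r * nrm r" using bd[OF rH] by (intro mult_right_mono) auto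
    finally show ?thesis by (simp add: power2_eq_square mult.assoc)
  qed
  \<comment> \<open>the minimum point of \<open>- 2 t \<parallel>r\<parallel>\<^sup>2 + t\<^sup>2 (\<Lambda> + C) \<parallel>r\<parallel>\<^sup>2\<close>\<close>
  define t where "t = 1 / (\<Lambda> + C)"
  have t: "t > 0" "t * (\<Lambda> + C) = 1" using \<Lambda> C by (auto simp: t_def)
  let ?v = "cscale (complex_of_real t) r"
  have e1: "q (u - ?v) = q u - 2 * t * Re (ip (T u) r) + t\<^sup>2 * q r"
  proof -
    have "ip (T r) u = cnj (ip (T u) r)" using sym[of r u] ip_cnj[of "T u" r] u by simp
    then show ?thesis unfolding q_def using u
      by (simp add: linear_opD(3,4)[OF lin] ip_diff_left ip_diff_right ip_scale_left ip_scale_right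
          power2_eq_square algebra_simps)
  qed
  have e2: "(nrm (u - ?v))\<^sup>2 = 1 - 2 * t * Re (ip u r) + t\<^sup>2 * (nrm r)\<^sup>2"
    using t u by (simp add: nrm_sq_diff nrm_scale ip_scale_right power_mult_distrib)
  have e3: "q (u - ?v) \<le> \<Lambda> * (nrm (u - ?v))\<^sup>2" unfolding q_def by (rule max)
  have e4: "\<Lambda> * Re (ip u r) - Re (ip (T u) r) = (nrm r)\<^sup>2"
  proof -
    have "ip r r = \<Lambda> * ip u r - ip (T u) r"
      using u rH by (subst (1) r_def) (simp only: ip_diff_left ip_scale_left linear_opD(1)[OF lin] scale_in)
    then show ?thesis by (simp add: nrm_sq)
  qed
  have e5: "t\<^sup>2 * (\<Lambda> * (nrm r)\<^sup>2 - q r) \<le> t\<^sup>2 * ((\<Lambda> + C) * (nrm r)\<^sup>2)"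
    using q_ge by (intro mult_left_mono) (auto simp: algebra_simps)
  have e6: "t\<^sup>2 * ((\<Lambda> + C) * (nrm r)\<^sup>2) = t * (nrm r)\<^sup>2"
  proof -
    have "t\<^sup>2 * ((\<Lambda> + C) * (nrm r)\<^sup>2) = (t * (\<Lambda> + C)) * (t * (nrm r)\<^sup>2)"
      by (simp add: power2_eq_square mult.assoc mult.left_commute)
    then show ?thesis unfolding t(2) by simp
  qed
  have arith: "2 * t * R \<le> \<Lambda> - a + t * R"
    if "x = a - 2 * t * B + t\<^sup>2 * p" "y = 1 - 2 * t * A + t\<^sup>2 * R" "x \<le> \<Lambda> * y"
      "\<Lambda> * A - B = R" "t\<^sup>2 * (\<Lambda> * R - p) \<le> t * R" for x y a p A B R
  proof -
    have "2 * t * R = 2 * (t * \<Lambda> * A) - 2 * (t * B)"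
      unfolding that(4)[symmetric] by (simp add: algebra_simps)
    moreover have "\<Lambda> * y = \<Lambda> - 2 * (t * \<Lambda> * A) + t\<^sup>2 * (\<Lambda> * R)"
      unfolding that(2) by (simp add: algebra_simps)
    moreover have "t\<^sup>2 * (\<Lambda> * R - p) = t\<^sup>2 * (\<Lambda> * R) - t\<^sup>2 * p" by (rule right_diff_distrib)
    ultimately show ?thesis using that(1,3,5) by linarith
  qed
  have "2 * t * (nrm r)\<^sup>2 \<le> \<Lambda> - q u + t * (nrm r)\<^sup>2"
    by (rule arith[OF e1 e2 e3 e4 order_trans[OF e5 eq_refl[OF e6]]])
  then have "t * (nrm r)\<^sup>2 \<le> \<Lambda> - q u" by simp
  then have "(\<Lambda> + C) * (t * (nrm r)\<^sup>2) \<le> (\<Lambda> + C) * (\<Lambda> - q u)"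
    using \<Lambda> C by (intro mult_left_mono) auto
  moreover have "(\<Lambda> + C) * (t * (nrm r)\<^sup>2) = (t * (\<Lambda> + C)) * (nrm r)\<^sup>2"
    by (simp only: mult.assoc mult.left_commute)
  ultimately show ?thesis unfolding t(2) q_def by simp
qed

text \<open>
  Along a subsequence \<open>K (f n)\<close> converges, hence so does \<open>(\<Lambda> - (T - K)) (f n)\<close>. Since the form of
  \<open>T - K\<close> is nonpositive, \<open>\<Lambda> - (T - K)\<close> is bounded below by \<open>\<Lambda> > 0\<close>, so \<open>f n\<close> itself converges.
\<close>
lemma approximate_eigenvectors_converge:
  assumes T: "symmetric_op T" and bd: "\<And>u. u \<in> H \<Longrightarrow> nrm (T u) \<le> C * nrm u"
    and K: "compact_op H ip K" and TK: "\<And>u. u \<in> H \<Longrightarrow> Re (ip (T u) u) \<le> Re (ip (K u) u)"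
    and \<Lambda>0: "\<Lambda> > 0" and fH: "\<And>n. f n \<in> H" and f1: "\<And>n. nrm (f n) = 1"
    and r0: "(\<lambda>n. nrm (cscale (complex_of_real \<Lambda>) (f n) - T (f n))) \<longlonglongrightarrow> 0"
  shows "\<exists>\<rho> u. strict_mono \<rho> \<and> u \<in> H \<and> (\<lambda>n. nrm (f (\<rho> n) - u)) \<longlonglongrightarrow> 0 \<and> T u = cscale (complex_of_real \<Lambda>) u"
proof -
  have lin: "linear_op H T" using T by (simp add: symmetric_op_def)
  have linK: "linear_op H K" using K by (simp add: compact_op_def)
  note [simp] = linear_opD(1)[OF lin] linear_opD(1)[OF linK] diff_in add_in scale_in fH
  define r where "r n = cscale (complex_of_real \<Lambda>) (f n) - T (f n)" for n
  have rH [simp]: "r n \<in> H" for n by (simp add: r_def)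
  obtain \<rho> z where \<rho>: "strict_mono \<rho>" and z: "z \<in> H" "(\<lambda>n. nrm (K (f (\<rho> n)) - z)) \<longlonglongrightarrow> 0"
    using K f1 fH unfolding compact_op_def by (metis order_refl)
  define g where "g n = f (\<rho> n)" for n
  have gH [simp]: "g n \<in> H" for n by (simp add: g_def)
  define y where "y n = r (\<rho> n) + K (g n)" for n
  have yH [simp]: "y n \<in> H" for n by (simp add: y_def)
  have rg0: "(\<lambda>n. nrm (r (\<rho> n))) \<longlonglongrightarrow> 0"
    using LIMSEQ_subseq_LIMSEQ[OF r0 \<rho>] by (simp add: o_def r_def)
  have yz: "(\<lambda>n. nrm (y n - z)) \<longlonglongrightarrow> 0"
  proof (rule Lim_null_comparison)
    show "(\<lambda>n. nrm (r (\<rho> n)) + nrm (K (g n) - z)) \<longlonglongrightarrow> 0"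
      using tendsto_add[OF rg0 z(2)] by (simp add: g_def)
    have "nrm (y n - z) \<le> nrm (r (\<rho> n)) + nrm (K (g n) - z)" for n
    proof -
      have "y n - z = r (\<rho> n) + (K (g n) - z)" by (simp add: y_def algebra_simps)
      then show ?thesis using nrm_triangle[of "r (\<rho> n)" "K (g n) - z"] z(1) by (simp only:) simp
    qed
    then show "\<forall>\<^sub>F n in sequentially. norm (nrm (y n - z)) \<le> nrm (r (\<rho> n)) + nrm (K (g n) - z)"
      using z by simp
  qed
  \<comment> \<open>coercivity of \<open>\<Lambda> - (T - K)\<close>\<close>
  have coer: "\<Lambda> * nrm (g m - g n) \<le> nrm (y m - y n)" for m n
  proof (cases "nrm (g m - g n) = 0")
    case False
    let ?h = "g m - g n"
    have "0 \<le> nrm ?h" by simp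
    then have p: "nrm ?h > 0" using False by (metis order_le_less)
    have yy: "y m - y n = (cscale (complex_of_real \<Lambda>) ?h - T ?h) + K ?h"
      unfolding y_def r_def g_def
      by (simp add: linear_opD(4)[OF lin] linear_opD(4)[OF linK]) (auto simp: fun_eq_iff algebra_simps)
    have "\<Lambda> * (nrm ?h)\<^sup>2 \<le> Re (ip (y m - y n) ?h)"
      unfolding yy using TK[of ?h]
      by (simp add: ip_add_left ip_diff_left[of "cscale _ _"] ip_scale_left ip_self del: of_real_power)
    also have "\<dots> \<le> nrm (y m - y n) * nrm ?h"
      using Cauchy_Schwarz[of "y m - y n" ?h] complex_Re_le_cmod[of "ip (y m - y n) ?h"] by simp
    finally have "\<Lambda> * nrm ?h * nrm ?h \<le> nrm (y m - y n) * nrm ?h"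
      by (simp add: power2_eq_square mult.assoc)
    then show ?thesis using p by (rule mult_right_le_imp_le)
  qed simp
  have "\<exists>u\<in>H. (\<lambda>n. nrm (g n - u)) \<longlonglongrightarrow> 0"
  proof (rule complete)
    fix e :: real assume e: "e > 0"
    then have "\<Lambda> * e / 2 > 0" using \<Lambda>0 by simp
    then have "\<forall>\<^sub>F n in sequentially. nrm (y n - z) < \<Lambda> * e / 2"
      using order_tendstoD(2)[OF yz] by blast
    then obtain N where N: "\<And>n. n \<ge> N \<Longrightarrow> nrm (y n - z) < \<Lambda> * e / 2"
      unfolding eventually_sequentially by blast
    have "nrm (g m - g n) < e" if "m \<ge> N" "n \<ge> N" for m n
    proof -
      have "\<Lambda> * nrm (g m - g n) \<le> nrm (y m - z) + nrm (y n - z)"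
        using coer[of m n] nrm_triangle_diff[OF yH z(1) yH, of m n] nrm_minus_commute[OF z(1) yH, of n]
        by argo
      also have "\<dots> < \<Lambda> * e" using N[OF that(1)] N[OF that(2)] by argo
      finally show ?thesis using \<Lambda>0 by simp
    qed
    then show "\<exists>N. \<forall>m\<ge>N. \<forall>n\<ge>N. nrm (g m - g n) < e" by blast
  qed simp
  then obtain u where u: "u \<in> H" "(\<lambda>n. nrm (g n - u)) \<longlonglongrightarrow> 0" by blast
  have "T u = cscale (complex_of_real \<Lambda>) u"
  proof -
    let ?d = "cscale (complex_of_real \<Lambda>) u - T u"
    have "nrm ?d \<le> nrm (r (\<rho> n)) + (\<Lambda> + C) * nrm (g n - u)" for n
    proof -
      let ?h = "g n - u"
      let ?e = "cscale (complex_of_real \<Lambda>) ?h - T ?h"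
      have d_eq: "?d = r (\<rho> n) - ?e"
        unfolding r_def g_def using u
        by (simp add: linear_opD(4)[OF lin]) (auto simp: fun_eq_iff algebra_simps)
      have "nrm ?d = nrm (r (\<rho> n) - ?e)" by (rule arg_cong[OF d_eq])
      moreover have "nrm (r (\<rho> n) - ?e) \<le> nrm (r (\<rho> n)) + nrm ?e"
        using u by (intro nrm_minus_le) auto
      moreover have "nrm ?e \<le> nrm (cscale (complex_of_real \<Lambda>) ?h) + nrm (T ?h)"
        using u by (intro nrm_minus_le) auto
      moreover have "nrm (cscale (complex_of_real \<Lambda>) ?h) = \<Lambda> * nrm ?h"
        using u \<Lambda>0 by (subst nrm_scale) auto
      ultimately have "nrm ?d \<le> nrm (r (\<rho> n)) + (\<Lambda> * nrm ?h + nrm (T ?h))" by argo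
      moreover have "nrm (T ?h) \<le> C * nrm ?h" using bd[of ?h] u by simp
      ultimately show ?thesis unfolding distrib_right by argo
    qed
    moreover have "(\<lambda>n. nrm (r (\<rho> n)) + (\<Lambda> + C) * nrm (g n - u)) \<longlonglongrightarrow> 0"
      using tendsto_add[OF rg0 tendsto_mult_right_zero[OF u(2), of "\<Lambda> + C"]] by simp
    ultimately have "nrm ?d \<le> 0" by (meson LIMSEQ_le_const)
    moreover have "0 \<le> nrm ?d" using u by simp
    ultimately have "nrm ?d = 0" by (rule order_antisym)
    then have "?d = 0" using nrm_eq_0[of ?d] u by simp
    then show ?thesis by simp
  qed
  then show ?thesis using \<rho> u unfolding g_def by blast
qed

text \<open>
  The orthogonal complement of eigenvectors is invariant under \<open>T\<close>, so the residuals of a maximising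
  sequence in it stay in it and tend to zero; a limit point is the required eigenvector.
\<close>
lemma maximizer_is_eigenvector:
  assumes T: "symmetric_op T" and bd: "\<And>u. u \<in> H \<Longrightarrow> nrm (T u) \<le> C * nrm u"
    and K: "compact_op H ip K" and TK: "\<And>u. u \<in> H \<Longrightarrow> Re (ip (T u) u) \<le> Re (ip (K u) u)"
    and E: "eigenvectors T A E" and s: "s \<ge> 0"
    and w: "w \<in> H" "\<And>e. e \<in> E \<Longrightarrow> ip w e = 0" "nrm w = 1" "s < Re (ip (T w) w)"
  shows "\<exists>\<mu>>s. \<exists>u\<in>H. nrm u = 1 \<and> (\<forall>e\<in>E. ip u e = 0) \<and> T u = cscale (complex_of_real \<mu>) u"
proof -
  have lin: "linear_op H T" and sym: "\<And>u v. u \<in> H \<Longrightarrow> v \<in> H \<Longrightarrow> ip (T u) v = ip u (T v)"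
    using T by (auto simp: symmetric_op_def)
  note [simp] = linear_opD(1)[OF lin] diff_in add_in scale_in
  have EH: "\<And>e. e \<in> E \<Longrightarrow> e \<in> H" using E orthonormalD(2) by (auto simp: eigenvectors_def)
  define M where "M = {u \<in> H. \<forall>e\<in>E. ip u e = 0}"
  have MH: "u \<in> H" if "u \<in> M" for u using that by (simp add: M_def)
  have M_diff: "u - v \<in> M" if "u \<in> M" "v \<in> M" for u v
    using that EH by (auto simp: M_def ip_diff_left)
  have M_scale: "cscale c u \<in> M" if "u \<in> M" for c u
    using that EH by (auto simp: M_def ip_scale_left)
  have M_T: "T u \<in> M" if "u \<in> M" for u
  proof -
    have "ip (T u) e = 0" if e: "e \<in> E" for e
    proof -
      obtain \<mu> where "T e = cscale \<mu> e" using E e unfolding eigenvectors_def by blast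
      then show ?thesis using sym[of u e] \<open>u \<in> M\<close> e EH[OF e] by (simp add: M_def ip_scale_right)
    qed
    then show ?thesis using that by (simp add: M_def)
  qed
  define q where "q u = Re (ip (T u) u)" for u
  have q_le: "\<bar>q u\<bar> \<le> C * (nrm u)\<^sup>2" if "u \<in> H" for u
  proof -
    have "\<bar>q u\<bar> \<le> nrm (T u) * nrm u"
      unfolding q_def using Cauchy_Schwarz[of "T u" u] abs_Re_le_cmod[of "ip (T u) u"] that
      by simp
    also have "\<dots> \<le> C * nrm u * nrm u" using bd[OF that] that by (intro mult_right_mono) auto
    finally show ?thesis by (simp add: power2_eq_square mult.assoc)
  qed
  have q_scale: "q (cscale (complex_of_real t) u) = t\<^sup>2 * q u" if "u \<in> H" for t u
    unfolding q_def using that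
    by (simp add: linear_opD(3)[OF lin] ip_scale_left ip_scale_right power2_eq_square)
  define \<Lambda> where "\<Lambda> = (SUP u\<in>{u\<in>M. nrm u = 1}. q u)"
  have bdd: "bdd_above (q ` {u\<in>M. nrm u = 1})"
    using q_le MH by (intro bdd_aboveI[of _ C]) force
  have wM: "w \<in> {u\<in>M. nrm u = 1}" using w by (auto simp: M_def)
  have \<Lambda>s: "\<Lambda> > s" unfolding \<Lambda>_def using w(4) cSUP_upper[OF wM bdd] by (simp add: q_def)
  then have \<Lambda>0: "\<Lambda> > 0" using s by simp
  have C0: "C \<ge> 0" using q_le[OF w(1)] w(3) by simp
  have q\<Lambda>: "q u \<le> \<Lambda> * (nrm u)\<^sup>2" if u: "u \<in> M" for u
  proof (cases "u = 0")
    case True then show ?thesis by (simp add: q_def linear_op_0[OF lin])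
  next
    case False
    then have p: "nrm u > 0" using nrm_eq_0[OF MH[OF u]] nrm_nonneg[OF MH[OF u]] by (simp add: less_le)
    define t where "t = 1 / nrm u"
    have "nrm (cscale (complex_of_real t) u) = 1"
      unfolding nrm_scale[OF MH[OF u]] using p by (simp add: t_def norm_divide)
    then have "cscale (complex_of_real t) u \<in> {u\<in>M. nrm u = 1}" using M_scale[OF u] by blast
    then have "q (cscale (complex_of_real t) u) \<le> \<Lambda>" unfolding \<Lambda>_def by (intro cSUP_upper bdd)
    then have "t\<^sup>2 * q u \<le> \<Lambda>" by (simp only: q_scale[OF MH[OF u]])
    then show ?thesis using p by (simp add: t_def field_simps)
  qed
  have "\<exists>u\<in>{u\<in>M. nrm u = 1}. \<Lambda> - 1 / Suc n < q u" for n
  proof -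
    have "\<Lambda> - 1 / Suc n < \<Lambda>" by simp
    then show ?thesis unfolding \<Lambda>_def
      using less_cSUP_iff[OF _ bdd] wM by (metis (no_types, lifting) empty_iff \<Lambda>_def)
  qed
  then have "\<forall>n. \<exists>u. u \<in> M \<and> nrm u = 1 \<and> \<Lambda> - 1 / Suc n < q u" by blast
  then obtain f where "\<forall>n. f n \<in> M \<and> nrm (f n) = 1 \<and> \<Lambda> - 1 / Suc n < q (f n)"
    by (rule choice[THEN exE])
  then have f: "\<And>n. f n \<in> M" "\<And>n. nrm (f n) = 1" "\<And>n. \<Lambda> - 1 / Suc n < q (f n)" by auto
  have fH [simp]: "f n \<in> H" for n using f MH by auto
  define r where "r n = cscale (complex_of_real \<Lambda>) (f n) - T (f n)" for n
  have rM: "r n \<in> M" for n unfolding r_def using f M_diff M_scale M_T by auto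
  have rH [simp]: "r n \<in> H" for n using rM MH by auto
  have r_bound: "(nrm (r n))\<^sup>2 \<le> (\<Lambda> + C) / Suc n" for n
  proof -
    have "(nrm (r n))\<^sup>2 \<le> (\<Lambda> + C) * (\<Lambda> - Re (ip (T (f n)) (f n)))"
      by (rule residual_bound[OF T bd C0 \<Lambda>0 fH f(2) r_def], assumption, fold q_def)
         (intro q\<Lambda> M_diff M_scale f(1) rM)
    also have "\<dots> \<le> (\<Lambda> + C) * (1 / Suc n)"
      using f(3)[of n] \<Lambda>0 C0 unfolding q_def by (intro mult_left_mono) linarith+
    finally show ?thesis by simp
  qed
  have r0: "(\<lambda>n. nrm (r n)) \<longlonglongrightarrow> 0"
  proof -
    have "(\<lambda>n. (\<Lambda> + C) * (1 / Suc n)) \<longlonglongrightarrow> 0"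
      by (intro tendsto_mult_right_zero LIMSEQ_Suc[OF lim_1_over_n])
    then have "(\<lambda>n. (nrm (r n))\<^sup>2) \<longlonglongrightarrow> 0"
      by (rule Lim_null_comparison[rotated]) (use r_bound in auto)
    from tendsto_real_sqrt[OF this] show ?thesis by simp
  qed
  obtain \<rho> u where u: "u \<in> H" "(\<lambda>n. nrm (f (\<rho> n) - u)) \<longlonglongrightarrow> 0" "T u = cscale (complex_of_real \<Lambda>) u"
    using approximate_eigenvectors_converge[OF T bd K TK \<Lambda>0 fH f(2) r0[unfolded r_def]] by blast
  have "nrm u = 1"
  proof -
    have "(\<lambda>n. nrm (f (\<rho> n))) \<longlonglongrightarrow> nrm u" by (rule nrm_tendsto) (use u in auto)
    then show ?thesis using f(2) by (simp add: LIMSEQ_const_iff)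
  qed
  moreover have "ip u e = 0" if "e \<in> E" for e
  proof -
    have "(\<lambda>n. ip (f (\<rho> n)) e) \<longlonglongrightarrow> ip u e" by (rule ip_tendsto) (use u EH that in auto)
    moreover have "ip (f (\<rho> n)) e = 0" for n using f(1) that by (simp add: M_def)
    ultimately show ?thesis by (simp add: LIMSEQ_const_iff)
  qed
  ultimately show ?thesis using u \<Lambda>s by blast
qed

text \<open>
  The easy direction of the min-max principle is \<open>eigenvectors_form_greater\<close>; this is the one that
  produces eigenvectors. An orthonormal system of eigenvectors that is too small for \<open>I\<close> leaves a
  unit vector in the span of \<open>v\<close> orthogonal to it, at which the form still exceeds \<open>s\<close>, and can
  therefore be enlarged.
\<close>
lemma variational_principle:
  assumes T: "symmetric_op T" and bd: "\<And>u. u \<in> H \<Longrightarrow> nrm (T u) \<le> C * nrm u"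
    and K: "compact_op H ip K" and TK: "\<And>u. u \<in> H \<Longrightarrow> Re (ip (T u) u) \<le> Re (ip (K u) u)"
    and s: "s \<ge> 0" and I: "finite I" "\<And>i. i \<in> I \<Longrightarrow> v i \<in> H"
    and pos: "\<And>c. \<exists>i\<in>I. c i \<noteq> 0 \<Longrightarrow>
       s * (nrm (lincomb I c v))\<^sup>2 < Re (ip (T (lincomb I c v)) (lincomb I c v))"
  shows "enat (card I) \<le> eig_count H T {s<..}"
proof (rule ccontr)
  assume neg: "\<not> ?thesis"
  have lin: "linear_op H T" using T by (simp add: symmetric_op_def)
  have small: "card E < card I" if "eigenvectors T {s<..} E" for E
  proof (rule ccontr)
    assume "\<not> card E < card I"
    then have "enat (card I) \<le> enat (card E)" by simp
    also have "\<dots> \<le> eig_count H T {s<..}" using that eig_count_ge_iff[OF T] by blast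
    finally show False using neg by simp
  qed
  have "eigenvectors T {s<..} {}" by (simp add: eigenvectors_def)
  then obtain E where E: "eigenvectors T {s<..} E"
    "\<And>E'. eigenvectors T {s<..} E' \<Longrightarrow> card E' \<le> card E"
    using ex_has_greatest_nat[of "eigenvectors T {s<..}" "{}" card "card I"] small less_imp_le by metis
  have oE: "orthonormal E" using E by (simp add: eigenvectors_def)
  have "lincomb I c v \<noteq> 0" if "\<exists>i\<in>I. c i \<noteq> 0" for c
    using pos[OF that] linear_op_0[OF lin] by auto
  then obtain c where c: "\<exists>i\<in>I. c i \<noteq> 0" "nrm (lincomb I c v) = 1" "\<forall>e\<in>E. ip (lincomb I c v) e = 0"
    using unit_vector_orthogonal[of I v E] I oE small[OF E(1)] by blast
  have "lincomb I c v \<in> H" using I by blast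
  then obtain \<mu> u where u: "\<mu> > s" "u \<in> H" "nrm u = 1" "\<forall>e\<in>E. ip u e = 0" "T u = cscale (complex_of_real \<mu>) u"
    using maximizer_is_eigenvector[OF T bd K TK E(1) s, of "lincomb I c v"] c pos[OF c(1)] by auto
  have "eigenvectors T {s<..} (insert u E)"
    using orthonormal_insert(1)[OF oE, of u] u E(1) unfolding eigenvectors_def by auto
  moreover have "card (insert u E) = Suc (card E)" using orthonormal_insert(2)[OF oE, of u] u by auto
  ultimately show False using E(2) by fastforce
qed

text \<open>
  Bounded point evaluations give a pointwise convergent subsequence; finitely many coordinates then
  control the operator up to a small multiple of the norm. Both \<open>B\<^sub>V\<close> and multiplication by a
  vanishing potential satisfy this criterion.
\<close>
lemma compact_opI:
  assumes ctbl: "countable (UNIV :: 'x set)" and lin: "linear_op H K"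
    and eval: "\<And>u x. u \<in> H \<Longrightarrow> cmod (u x) \<le> A * nrm u"
    and small: "\<And>e. e > 0 \<Longrightarrow> \<exists>F D. finite F \<and> 0 \<le> D \<and>
      (\<forall>u\<in>H. (nrm (K u))\<^sup>2 \<le> D * (\<Sum>x\<in>F. (cmod (u x))\<^sup>2) + e * (nrm u)\<^sup>2)"
  shows "compact_op H ip K"
  unfolding compact_op_def
proof (intro conjI lin allI impI)
  fix f :: "nat \<Rightarrow> 'x \<Rightarrow> complex"
  assume "(\<forall>n. f n \<in> H) \<and> (\<exists>B. \<forall>n. nrm (f n) \<le> B)"
  then obtain B where f: "\<And>n. f n \<in> H" and B: "\<And>n. nrm (f n) \<le> B" by blast
  have B0: "0 \<le> B" using nrm_nonneg[OF f[of 0]] B[of 0] by linarith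
  have pt: "norm (f n x) \<le> \<bar>A\<bar> * B" for n x
  proof -
    have "cmod (f n x) \<le> A * nrm (f n)" by (rule eval[OF f])
    also have "\<dots> \<le> \<bar>A\<bar> * nrm (f n)" using f by (intro mult_right_mono) auto
    also have "\<dots> \<le> \<bar>A\<bar> * B" using B by (intro mult_left_mono) auto
    finally show ?thesis .
  qed
  obtain r where r: "strict_mono (r :: nat \<Rightarrow> nat)" "\<And>x. \<exists>l. (\<lambda>n. f (r n) x) \<longlonglongrightarrow> l"
    using function_convergent_subsequence[OF ctbl, of f "\<bar>A\<bar> * B"] pt by (metis UNIV_I)
  define g where "g n = f (r n)" for n
  have gH: "g n \<in> H" for n using f by (simp add: g_def)
  have gd: "g m - g n \<in> H" for m n using gH by auto
  have Kd: "K (g m) - K (g n) = K (g m - g n)" for m n using linear_opD(4)[OF lin gH gH] by simp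
  obtain l where l: "\<And>x. (\<lambda>n. g n x) \<longlonglongrightarrow> l x" using r(2) unfolding g_def by metis
  have "\<exists>w\<in>H. (\<lambda>n. nrm (K (g n) - w)) \<longlonglongrightarrow> 0"
  proof (rule complete)
    show "K (g n) \<in> H" for n using linear_opD(1)[OF lin gH] .
    fix e :: real assume e: "e > 0"
    \<comment> \<open>differences of the sequence have norm at most \<open>2 B\<close>, and \<open>\<delta> (2 B)\<^sup>2 \<le> e\<^sup>2 / 2\<close>\<close>
    define \<delta> where "\<delta> = e\<^sup>2 / (8 * B\<^sup>2 + 8)"
    have \<delta>: "\<delta> > 0" using e by (simp add: \<delta>_def add_nonneg_pos)
    obtain F D where FD: "finite F" "0 \<le> D"
      "\<And>u. u \<in> H \<Longrightarrow> (nrm (K u))\<^sup>2 \<le> D * (\<Sum>x\<in>F. (cmod (u x))\<^sup>2) + \<delta> * (nrm u)\<^sup>2"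
      using small[OF \<delta>] by blast
    have "(\<lambda>n. D * (\<Sum>x\<in>F. (2 * cmod (g n x - l x))\<^sup>2)) \<longlonglongrightarrow> D * (\<Sum>x\<in>F. (2 * cmod (l x - l x))\<^sup>2)"
      by (intro tendsto_intros l)
    then have "\<forall>\<^sub>F n in sequentially. D * (\<Sum>x\<in>F. (2 * cmod (g n x - l x))\<^sup>2) < e\<^sup>2 / 4"
      by (rule order_tendstoD(2)) (use e in simp)
    then obtain N where N: "\<And>n. n \<ge> N \<Longrightarrow> D * (\<Sum>x\<in>F. (2 * cmod (g n x - l x))\<^sup>2) < e\<^sup>2 / 4"
      unfolding eventually_sequentially by blast
    have "nrm (K (g m) - K (g n)) < e" if mn: "m \<ge> N" "n \<ge> N" for m n
    proof (rule power2_less_imp_less)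
      have "(cmod (g m x - g n x))\<^sup>2 \<le> (2 * cmod (g m x - l x))\<^sup>2 / 2 + (2 * cmod (g n x - l x))\<^sup>2 / 2" for x
        using cmod_sq_add_le[of "g m x - l x" "l x - g n x"] by (simp add: norm_minus_commute power_mult_distrib)
      then have "(\<Sum>x\<in>F. (cmod (g m x - g n x))\<^sup>2) \<le>
          (\<Sum>x\<in>F. (2 * cmod (g m x - l x))\<^sup>2 / 2 + (2 * cmod (g n x - l x))\<^sup>2 / 2)" by (intro sum_mono)
      also have "\<dots> = (\<Sum>x\<in>F. (2 * cmod (g m x - l x))\<^sup>2) / 2 + (\<Sum>x\<in>F. (2 * cmod (g n x - l x))\<^sup>2) / 2"
        by (simp add: sum.distrib sum_divide_distrib)
      finally have "D * (\<Sum>x\<in>F. (cmod (g m x - g n x))\<^sup>2) \<le>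
         D * ((\<Sum>x\<in>F. (2 * cmod (g m x - l x))\<^sup>2) / 2 + (\<Sum>x\<in>F. (2 * cmod (g n x - l x))\<^sup>2) / 2)"
        using FD(2) by (intro mult_left_mono)
      also have "\<dots> = D * (\<Sum>x\<in>F. (2 * cmod (g m x - l x))\<^sup>2) / 2 + D * (\<Sum>x\<in>F. (2 * cmod (g n x - l x))\<^sup>2) / 2"
        by (simp only: distrib_left times_divide_eq_right)
      also have "\<dots> \<le> e\<^sup>2 / 4" using N[OF mn(1)] N[OF mn(2)] by linarith
      finally have 1: "D * (\<Sum>x\<in>F. (cmod (g m x - g n x))\<^sup>2) \<le> e\<^sup>2 / 4" .
      have "nrm (g m - g n) \<le> B + B"
        using nrm_minus_le[OF gH gH, of m n] B[of "r m"] B[of "r n"] unfolding g_def by argo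
      then have "nrm (g m - g n) \<le> 2 * B" by argo
      then have "(nrm (g m - g n))\<^sup>2 \<le> (2 * B)\<^sup>2" using gd by (intro power_mono) auto
      then have "\<delta> * (nrm (g m - g n))\<^sup>2 \<le> \<delta> * (2 * B)\<^sup>2" using \<delta> by (intro mult_left_mono) auto
      also have "\<dots> \<le> \<delta> * ((8 * B\<^sup>2 + 8) / 2)" using \<delta> by (intro mult_left_mono) auto
      also have "\<dots> = e\<^sup>2 / 2" by (simp add: \<delta>_def add_nonneg_eq_0_iff)
      finally have 2: "\<delta> * (nrm (g m - g n))\<^sup>2 \<le> e\<^sup>2 / 2" .
      have "(nrm (K (g m - g n)))\<^sup>2 \<le> D * (\<Sum>x\<in>F. (cmod ((g m - g n) x))\<^sup>2) + \<delta> * (nrm (g m - g n))\<^sup>2"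
        by (rule FD(3)[OF gd])
      moreover have "D * (\<Sum>x\<in>F. (cmod ((g m - g n) x))\<^sup>2) = D * (\<Sum>x\<in>F. (cmod (g m x - g n x))\<^sup>2)" by simp
      moreover have "0 < e\<^sup>2" using e by simp
      ultimately show "(nrm (K (g m) - K (g n)))\<^sup>2 < e\<^sup>2" unfolding Kd using 1 2 by argo
    qed (use e in simp)
    then show "\<exists>N. \<forall>m\<ge>N. \<forall>n\<ge>N. nrm (K (g m) - K (g n)) < e" by blast
  qed
  then show "\<exists>r w. strict_mono r \<and> w \<in> H \<and> (\<lambda>n. nrm (K (f (r n)) - w)) \<longlonglongrightarrow> 0"
    using r(1) unfolding g_def by blast
qed

lemma nrm_sum_le: "(\<And>i. i \<in> I \<Longrightarrow> w i \<in> H) \<Longrightarrow> sum w I \<in> H \<and> nrm (sum w I) \<le> (\<Sum>i\<in>I. nrm (w i))"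
proof (induction I rule: infinite_finite_induct)
  case (insert i I)
  then have IH: "sum w I \<in> H" "nrm (sum w I) \<le> (\<Sum>i\<in>I. nrm (w i))" and i: "w i \<in> H" by auto
  have e: "sum w (insert i I) = w i + sum w I" using insert.hyps by simp
  have "nrm (w i + sum w I) \<le> nrm (w i) + nrm (sum w I)" by (rule nrm_triangle[OF i IH(1)])
  then have "nrm (w i + sum w I) \<le> nrm (w i) + (\<Sum>i\<in>I. nrm (w i))" using IH(2) by argo
  then have "nrm (w i + sum w I) \<le> (\<Sum>i\<in>insert i I. nrm (w i))"
    by (simp only: sum.insert[OF insert.hyps])
  then show ?case unfolding e using add_in[OF i IH(1)] by blast
qed simp_all

lemma linear_op_lincomb:
  assumes T: "linear_op H T"
  shows "(\<And>i. i \<in> I \<Longrightarrow> v i \<in> H) \<Longrightarrow> T (lincomb I c v) = lincomb I c (\<lambda>i. T (v i))"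
proof (induction I rule: infinite_finite_induct)
  case (insert i I)
  have e: "lincomb (insert i I) c v = cscale (c i) (v i) + lincomb I c v" for v :: "'a \<Rightarrow> 'x \<Rightarrow> complex"
    using insert.hyps by (simp add: lincomb_def)
  have m: "lincomb I c v \<in> H" using insert.prems by auto
  have i: "v i \<in> H" using insert.prems by auto
  have "T (cscale (c i) (v i) + lincomb I c v) = cscale (c i) (T (v i)) + T (lincomb I c v)"
    using linear_opD(2)[OF T scale_in[OF i] m] linear_opD(3)[OF T i] by simp
  moreover have "T (lincomb I c v) = lincomb I c (\<lambda>i. T (v i))" using insert by blast
  ultimately show ?case unfolding e by (simp only:)
qed (simp_all add: lincomb_def linear_op_0[OF T])

lemma ip_tendsto2:
  assumes "\<And>n. x n \<in> H" "\<And>n. y n \<in> H" "a \<in> H" "b \<in> H"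
    "(\<lambda>n. nrm (x n - a)) \<longlonglongrightarrow> 0" "(\<lambda>n. nrm (y n - b)) \<longlonglongrightarrow> 0"
  shows "(\<lambda>n. ip (x n) (y n)) \<longlonglongrightarrow> ip a b"
proof -
  have "(\<lambda>n. nrm (x n - a) * nrm (y n) + nrm a * nrm (y n - b)) \<longlonglongrightarrow> 0 * nrm b + nrm a * 0"
    using nrm_tendsto[OF assms(2,4,6)] by (intro tendsto_intros assms)
  moreover have "cmod (ip (x n) (y n) - ip a b) \<le> nrm (x n - a) * nrm (y n) + nrm a * nrm (y n - b)" for n
  proof -
    have e: "ip (x n) (y n) - ip a b = ip (x n - a) (y n) + ip a (y n - b)"
      using assms by (simp add: ip_diff_left ip_diff_right)
    have "cmod (ip (x n - a) (y n)) \<le> nrm (x n - a) * nrm (y n)" "cmod (ip a (y n - b)) \<le> nrm a * nrm (y n - b)"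
      using assms by (auto intro!: Cauchy_Schwarz)
    then show ?thesis unfolding e using norm_triangle_ineq[of "ip (x n - a) (y n)" "ip a (y n - b)"] by argo
  qed
  ultimately have "(\<lambda>n. ip (x n) (y n) - ip a b) \<longlonglongrightarrow> 0"
    by (intro Lim_null_comparison[of "\<lambda>n. ip (x n) (y n) - ip a b"]) auto
  then show ?thesis by (simp add: LIM_zero_iff)
qed

lemma eigenvectors_form:
  assumes T: "linear_op H T" and E: "orthonormal E" and \<mu>: "\<And>e. e \<in> E \<Longrightarrow> T e = cscale (complex_of_real (\<mu> e)) e"
  shows "Re (ip (T (lincomb E c (\<lambda>e. e))) (lincomb E c (\<lambda>e. e))) = (\<Sum>e\<in>E. \<mu> e * (cmod (c e))\<^sup>2)"
proof -
  let ?u = "lincomb E c (\<lambda>e. e)" and ?d = "\<lambda>e. c e * complex_of_real (\<mu> e)"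
  note EH = orthonormalD(2)[OF E]
  have "T ?u = lincomb E c (\<lambda>e. T e)" using EH by (intro linear_op_lincomb[OF T])
  also have "\<dots> = lincomb E ?d (\<lambda>e. e)"
    unfolding lincomb_def using \<mu> by (intro sum.cong) auto
  finally have Tu: "T ?u = lincomb E ?d (\<lambda>e. e)" .
  have "ip (T ?u) ?u = (\<Sum>e\<in>E. cnj (c e) * ip (T ?u) e)"
    by (intro ip_lincomb_right linear_opD(1)[OF T] lincomb_in EH)
  also have "\<dots> = (\<Sum>e\<in>E. complex_of_real (\<mu> e * (cmod (c e))\<^sup>2))"
    unfolding Tu by (intro sum.cong) (simp_all add: ip_lincomb_orthonormal[OF E] complex_norm_square mult_ac del: of_real_power)
  finally show ?thesis by simp
qed

lemma eigenvectors_form_greater: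
  assumes T: "linear_op H T" and E: "eigenvectors T {s<..} E" and c: "\<exists>e\<in>E. c e \<noteq> 0"
  shows "s * (nrm (lincomb E c (\<lambda>e. e)))\<^sup>2 < Re (ip (T (lincomb E c (\<lambda>e. e))) (lincomb E c (\<lambda>e. e)))"
proof -
  have o: "orthonormal E" using E by (simp add: eigenvectors_def)
  have "\<forall>e\<in>E. \<exists>m. s < m \<and> T e = cscale (complex_of_real m) e" using E by (auto simp: eigenvectors_def)
  then obtain \<mu> where \<mu>: "\<And>e. e \<in> E \<Longrightarrow> s < \<mu> e \<and> T e = cscale (complex_of_real (\<mu> e)) e" by metis
  have "(\<Sum>e\<in>E. s * (cmod (c e))\<^sup>2) < (\<Sum>e\<in>E. \<mu> e * (cmod (c e))\<^sup>2)"
  proof (rule sum_strict_mono_ex1)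
    show "finite E" using orthonormalD(1)[OF o] .
    show "\<forall>e\<in>E. s * (cmod (c e))\<^sup>2 \<le> \<mu> e * (cmod (c e))\<^sup>2" using \<mu> by (meson less_imp_le mult_right_mono zero_le_power2)
    obtain e where "e \<in> E" "c e \<noteq> 0" using c by blast
    then show "\<exists>e\<in>E. s * (cmod (c e))\<^sup>2 < \<mu> e * (cmod (c e))\<^sup>2"
      using \<mu>[of e] by (intro bexI[of _ e] mult_strict_right_mono) auto
  qed
  moreover have "Re (ip (T (lincomb E c (\<lambda>e. e))) (lincomb E c (\<lambda>e. e))) = (\<Sum>e\<in>E. \<mu> e * (cmod (c e))\<^sup>2)"
    using \<mu> by (intro eigenvectors_form[OF T o]) auto
  ultimately show ?thesis by (simp add: nrm_sq_lincomb_orthonormal[OF o] sum_distrib_left)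
qed

lemma eig_count_uminus:
  assumes T: "symmetric_op T"
  shows "eig_count H (\<lambda>u. - T u) {..<0} = eig_count H T {0<..}"
proof -
  have lin: "linear_op H T" and sym: "\<And>u v. u \<in> H \<Longrightarrow> v \<in> H \<Longrightarrow> ip (T u) v = ip u (T v)"
    using T by (auto simp: symmetric_op_def)
  have neg: "symmetric_op (\<lambda>u. - T u)"
    unfolding symmetric_op_def linear_op_def minus_eq_cscale
    using linear_opD[OF lin] sym
    by (auto simp: scale_in ip_scale_left ip_scale_right fun_eq_iff algebra_simps)
  have eq: "- T e = cscale (complex_of_real \<mu>) e \<longleftrightarrow> T e = cscale (complex_of_real (- \<mu>)) e" for \<mu> e
    by (auto simp: fun_eq_iff minus_equation_iff[of "T e _"] eq_commute)
  have "(\<exists>\<mu>\<in>{..<0}. - T e = cscale (complex_of_real \<mu>) e) \<longleftrightarrow> (\<exists>\<mu>\<in>{0<..}. T e = cscale (complex_of_real \<mu>) e)" for e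
  proof
    assume "\<exists>\<mu>\<in>{..<0}. - T e = cscale (complex_of_real \<mu>) e"
    then obtain \<mu> where "\<mu> < 0" "T e = cscale (complex_of_real (- \<mu>)) e" unfolding eq by auto
    then show "\<exists>\<mu>\<in>{0<..}. T e = cscale (complex_of_real \<mu>) e" by (intro bexI[of _ "- \<mu>"]) auto
  next
    assume "\<exists>\<mu>\<in>{0<..}. T e = cscale (complex_of_real \<mu>) e"
    then obtain \<mu> where "\<mu> > 0" "T e = cscale (complex_of_real (- (- \<mu>))) e" by auto
    then show "\<exists>\<mu>\<in>{..<0}. - T e = cscale (complex_of_real \<mu>) e" unfolding eq by (intro bexI[of _ "- \<mu>"]) auto
  qed
  then show ?thesis
    by (intro enat_eqI) (simp add: eig_count_ge_iff T neg eigenvectors_def)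
qed

end

section \<open>Square-summable functions\<close>
lemma pointwise_limit_exists:
  assumes "\<And>e. e > 0 \<Longrightarrow> \<exists>N::nat. \<forall>m\<ge>N. \<forall>n\<ge>N. cmod (f m x - f n x) < e"
  shows "\<exists>l. (\<lambda>n. f n x) \<longlonglongrightarrow> l"
  using assms by (simp add: Cauchy_convergent_iff[symmetric] convergent_def[symmetric] Cauchy_iff)

definition sqsum :: "('x \<Rightarrow> complex) \<Rightarrow> real" where
  "sqsum u = (\<Sum>\<^sub>\<infinity>x\<in>UNIV. (cmod (u x))\<^sup>2)"

definition ip2 :: "('x \<Rightarrow> complex) \<Rightarrow> ('x \<Rightarrow> complex) \<Rightarrow> complex" where
  "ip2 u v = (\<Sum>\<^sub>\<infinity>x\<in>UNIV. u x * cnj (v x))"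

lemma ell2_summable: "u \<in> ell2 \<Longrightarrow> (\<lambda>x. (cmod (u x))\<^sup>2) summable_on UNIV"
  by (simp add: ell2_def)

lemma sqsum_nonneg: "0 \<le> sqsum u"
  unfolding sqsum_def by (intro infsum_nonneg) simp

lemma ell2_if_bounded:
  assumes "\<And>E. finite E \<Longrightarrow> (\<Sum>x\<in>E. (cmod (u x))\<^sup>2) \<le> C"
  shows "u \<in> ell2" "sqsum u \<le> C"
proof -
  have s: "(\<lambda>x. (cmod (u x))\<^sup>2) summable_on UNIV"
    using assms by (intro nonneg_bdd_above_summable_on bdd_aboveI[of _ C]) auto
  show "u \<in> ell2" using s by (simp add: ell2_def)
  show "sqsum u \<le> C" unfolding sqsum_def by (rule infsum_le_finite_sums[OF s assms])
qed

lemma finite_sum_le_sqsum: "u \<in> ell2 \<Longrightarrow> finite E \<Longrightarrow> (\<Sum>x\<in>E. (cmod (u x))\<^sup>2) \<le> sqsum u"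
  unfolding sqsum_def by (intro finite_sum_le_infsum ell2_summable) auto

lemma cmod_sq_le_sqsum: "u \<in> ell2 \<Longrightarrow> (cmod (u x))\<^sup>2 \<le> sqsum u"
  using finite_sum_le_sqsum[of u "{x}"] by simp

lemma ell2_product_summable:
  assumes "u \<in> ell2" "v \<in> ell2"
  shows "(\<lambda>x. u x * cnj (v x)) summable_on UNIV"
proof (rule Infinite_Sum.abs_summable_summable, rule Infinite_Sum.abs_summable_on_comparison_test')
  show "(\<lambda>x. (cmod (u x))\<^sup>2 + (cmod (v x))\<^sup>2) summable_on UNIV"
    using assms by (intro summable_on_add ell2_summable)
  fix x
  have "0 \<le> (cmod (u x) - cmod (v x))\<^sup>2" by simp
  then have "2 * (cmod (u x) * cmod (v x)) \<le> (cmod (u x))\<^sup>2 + (cmod (v x))\<^sup>2"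
    by (simp add: power2_diff)
  moreover have "0 \<le> cmod (u x) * cmod (v x)" by simp
  ultimately have "cmod (u x) * cmod (v x) \<le> (cmod (u x))\<^sup>2 + (cmod (v x))\<^sup>2" by linarith
  then show "norm (u x * cnj (v x)) \<le> (cmod (u x))\<^sup>2 + (cmod (v x))\<^sup>2" by (simp add: norm_mult)
qed

lemma ip2_self: "u \<in> ell2 \<Longrightarrow> ip2 u u = complex_of_real (sqsum u)"
proof -
  assume u: "u \<in> ell2"
  have "((\<lambda>x. (cmod (u x))\<^sup>2) has_sum sqsum u) UNIV"
    unfolding sqsum_def using ell2_summable[OF u] by (rule has_sum_infsum)
  then have "((\<lambda>x. complex_of_real ((cmod (u x))\<^sup>2)) has_sum complex_of_real (sqsum u)) UNIV"
    by (rule has_sum_of_real)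
  then show ?thesis unfolding ip2_def
    by (intro infsumI) (simp add: complex_norm_square del: of_real_power)
qed

lemma hnorm_ip2: "u \<in> ell2 \<Longrightarrow> hnorm ip2 u = sqrt (sqsum u)"
  by (simp add: hnorm_def ip2_self)

lemma ell2_zero: "0 \<in> ell2" by (simp add: ell2_def zero_fun_def)

lemma ell2_add:
  assumes "u \<in> ell2" "v \<in> ell2" shows "u + v \<in> ell2"
proof -
  have "(\<lambda>x. 2 * (cmod (u x))\<^sup>2 + 2 * (cmod (v x))\<^sup>2) summable_on UNIV"
    using assms by (intro summable_on_add summable_on_cmult_right ell2_summable)
  then have "(\<lambda>x. (cmod (u x + v x))\<^sup>2) summable_on UNIV"
    by (rule summable_on_comparison_test) (use cmod_sq_add_le in auto)
  then show ?thesis by (simp add: ell2_def)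
qed

lemma ell2_scale: "u \<in> ell2 \<Longrightarrow> cscale c u \<in> ell2"
  by (auto simp: ell2_def norm_mult power_mult_distrib intro: summable_on_cmult_right)

lemma ell2_diff: "u \<in> ell2 \<Longrightarrow> v \<in> ell2 \<Longrightarrow> u - v \<in> ell2"
proof -
  have "u - v = u + cscale (-1) v" by (auto simp: fun_eq_iff)
  then show "u \<in> ell2 \<Longrightarrow> v \<in> ell2 \<Longrightarrow> u - v \<in> ell2" by (metis ell2_add ell2_scale)
qed

lemma ell2_Fatou:
  assumes lim: "\<And>x. (\<lambda>n. g n x) \<longlonglongrightarrow> w x"
    and bd: "\<And>n. n \<ge> N \<Longrightarrow> g n \<in> ell2 \<and> sqsum (g n) \<le> C"
  shows "w \<in> ell2" "sqsum w \<le> C"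
proof -
  have "(\<Sum>x\<in>E. (cmod (w x))\<^sup>2) \<le> C" if "finite E" for E
  proof (rule LIMSEQ_le_const2)
    show "(\<lambda>n. \<Sum>x\<in>E. (cmod (g n x))\<^sup>2) \<longlonglongrightarrow> (\<Sum>x\<in>E. (cmod (w x))\<^sup>2)"
      by (intro tendsto_intros lim)
    show "\<exists>N. \<forall>n\<ge>N. (\<Sum>x\<in>E. (cmod (g n x))\<^sup>2) \<le> C"
      using finite_sum_le_sqsum[OF _ that] bd by (meson order_trans)
  qed
  then show "w \<in> ell2" "sqsum w \<le> C" using ell2_if_bounded by blast+
qed

text \<open>
  The limit is prescribed pointwise, so that the lemma serves for \<open>\<ell>\<^sub>2\<close> itself and for gradients,
  whose pointwise limit is again a gradient.
\<close>
lemma ell2_Cauchy_limit: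
  assumes f: "\<And>n. f n \<in> ell2" and lim: "\<And>x. (\<lambda>n. f n x) \<longlonglongrightarrow> w x"
    and C: "\<And>e. e > 0 \<Longrightarrow> \<exists>N::nat. \<forall>m\<ge>N. \<forall>n\<ge>N. sqsum (f m - f n) \<le> e"
  shows "w \<in> ell2" "(\<lambda>n. sqsum (f n - w)) \<longlonglongrightarrow> 0"
proof -
  have d: "f m - f n \<in> ell2" for m n
    using f by (intro ell2_diff)
  have *: "f n - w \<in> ell2 \<and> sqsum (f n - w) \<le> e"
    if N: "\<forall>m\<ge>N. \<forall>n\<ge>N. sqsum (f m - f n) \<le> e" "n \<ge> N" for e N n
  proof -
    have l: "(\<lambda>m. (f n - f m) x) \<longlonglongrightarrow> (f n - w) x" for x
      by (auto intro!: tendsto_intros lim)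
    show ?thesis using ell2_Fatou[of "\<lambda>m. f n - f m" "f n - w" N e] l N d by auto
  qed
  obtain N where "\<forall>m\<ge>N. \<forall>n\<ge>N. sqsum (f m - f n) \<le> 1" using C[of 1] by auto
  then have "f N - w \<in> ell2" using * by blast
  moreover have "w = f N + cscale (-1) (f N - w)" by (auto simp: fun_eq_iff)
  ultimately show "w \<in> ell2" using ell2_add[OF f ell2_scale] by metis
  show "(\<lambda>n. sqsum (f n - w)) \<longlonglongrightarrow> 0"
    unfolding LIMSEQ_iff
  proof (intro allI impI)
    fix r :: real assume "r > 0"
    then obtain N where "\<forall>m\<ge>N. \<forall>n\<ge>N. sqsum (f m - f n) \<le> r / 2" using C[of "r / 2"] by auto
    then have "\<forall>n\<ge>N. sqsum (f n - w) \<le> r / 2" using * by blast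
    moreover have "r / 2 < r" using \<open>r > 0\<close> by simp
    ultimately have "\<forall>n\<ge>N. sqsum (f n - w) < r" by (meson le_less_trans)
    then show "\<exists>no. \<forall>n\<ge>no. norm (sqsum (f n - w) - 0) < r"
      unfolding real_norm_def diff_zero abs_of_nonneg[OF sqsum_nonneg] by blast
  qed
qed

interpretation ell2: hilbert_fun "ell2 :: ('x \<Rightarrow> complex) set" ip2
proof (standard, goal_cases)
  case 1 show ?case by (rule ell2_zero)
next
  case (2 u v) then show ?case by (rule ell2_add)
next
  case (3 u c) then show ?case by (rule ell2_scale)
next
  case (4 u v w)
  then show ?case unfolding ip2_def
    by (simp add: distrib_right infsum_add ell2_product_summable)
next
  case (5 u w c)
  then show ?case unfolding ip2_def
    by (simp add: mult.assoc infsum_cmult_right')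
next
  case (6 u v)
  then show ?case unfolding ip2_def by (simp add: infsum_cnj[symmetric] mult.commute del: infsum_cnj)
next
  case (7 u) then show ?case by (simp add: ip2_self sqsum_nonneg)
next
  case (8 u)
  then have "sqsum u = 0" by (simp add: ip2_self)
  then have "(cmod (u x))\<^sup>2 \<le> 0" for x using cmod_sq_le_sqsum[OF 8(1), of x] by simp
  then show ?case by (simp add: fun_eq_iff)
next
  case (9 f)
  have d: "f m - f n \<in> ell2" for m n
    by (intro ell2_diff 9(1))
  have "\<exists>l. (\<lambda>n. f n x) \<longlonglongrightarrow> l" for x
  proof (rule pointwise_limit_exists)
    fix e :: real assume "e > 0"
    then obtain N where N: "\<forall>m\<ge>N. \<forall>n\<ge>N. hnorm ip2 (f m - f n) < e" using 9(2) by blast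
    have "cmod (f m x - f n x) \<le> hnorm ip2 (f m - f n)" for m n
      using cmod_sq_le_sqsum[OF d, of m n x] by (simp add: hnorm_ip2 d real_le_rsqrt)
    then show "\<exists>N. \<forall>m\<ge>N. \<forall>n\<ge>N. cmod (f m x - f n x) < e" using N by (meson le_less_trans)
  qed
  then obtain w where w: "\<And>x. (\<lambda>n. f n x) \<longlonglongrightarrow> w x" by metis
  have C: "\<exists>N. \<forall>m\<ge>N. \<forall>n\<ge>N. sqsum (f m - f n) \<le> e" if e: "e > 0" for e
  proof -
    obtain N where N: "\<forall>m\<ge>N. \<forall>n\<ge>N. hnorm ip2 (f m - f n) < sqrt e"
      using 9(2)[of "sqrt e"] e by auto
    have "\<forall>m\<ge>N. \<forall>n\<ge>N. sqsum (f m - f n) \<le> e" using N by (auto simp: hnorm_ip2 d intro: less_imp_le)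
    then show ?thesis by blast
  qed
  have L: "w \<in> ell2" "(\<lambda>n. sqsum (f n - w)) \<longlonglongrightarrow> 0" using ell2_Cauchy_limit[OF 9(1) w C] by auto
  have "f n - w \<in> ell2" for n
    by (intro ell2_diff 9(1) L(1))
  then have "(\<lambda>n. hnorm ip2 (f n - w)) \<longlonglongrightarrow> 0"
    using tendsto_real_sqrt[OF L(2)] by (simp add: hnorm_ip2)
  then show ?case using L(1) by blast
qed

lemma ell2_finite_support: "finite {x. u x \<noteq> 0} \<Longrightarrow> u \<in> ell2"
proof -
  assume fin: "finite {x. u x \<noteq> 0}"
  have "(\<lambda>x. (cmod (u x))\<^sup>2) summable_on UNIV \<longleftrightarrow> (\<lambda>x. (cmod (u x))\<^sup>2) summable_on {x. u x \<noteq> 0}"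
    by (rule summable_on_cong_neutral) auto
  then show "u \<in> ell2" using fin by (simp add: ell2_def)
qed

lemma ip2_complex_Cauchy_Schwarz: "u \<in> ell2 \<Longrightarrow> v \<in> ell2 \<Longrightarrow> cmod (ip2 u v) \<le> sqrt (sqsum u) * sqrt (sqsum v)"
  using ell2.Cauchy_Schwarz[of u v] by (simp add: hnorm_ip2)

lemma infsum_finite_sum:
  fixes f :: "'j \<Rightarrow> 'x \<Rightarrow> complex"
  assumes "finite J" "\<And>j. j \<in> J \<Longrightarrow> f j summable_on A"
  shows "(\<Sum>\<^sub>\<infinity>x\<in>A. \<Sum>j\<in>J. f j x) = (\<Sum>j\<in>J. infsum (f j) A)"
proof (rule infsumI)
  show "((\<lambda>x. \<Sum>j\<in>J. f j x) has_sum (\<Sum>j\<in>J. infsum (f j) A)) A"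
    using assms by (induction J rule: finite_induct) (auto intro!: has_sum_add)
qed

lemma ip2_translate: "ip2 (\<lambda>x. u (x + y)) (\<lambda>x. v (x + y)) = ip2 u v" for y :: "'a::ab_group_add"
  unfolding ip2_def
  by (rule infsum_reindex_bij_betw[where f = "\<lambda>x. u x * cnj (v x)"])
     (rule bij_betw_byWitness[where f' = "\<lambda>x. x - y"], auto)

section \<open>The discrete gradient\<close>

text \<open>
  All difference quotients are collected in one function on edges, so that \<open>Q\<^sub>0\<close> becomes the squared
  \<open>\<ell>\<^sub>2\<close>-norm and the \<open>\<ell>\<^sub>2\<close> theory applies.
\<close>
definition grad :: "(int ^ 'd \<Rightarrow> complex) \<Rightarrow> (int ^ 'd) \<times> 'd \<Rightarrow> complex" where
  "grad u = (\<lambda>(x, j). u (x + axis j 1) - u x)"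

lemma grad_add: "grad (u + v) = grad u + grad v"
  by (auto simp: grad_def fun_eq_iff)

lemma grad_diff: "grad (u - v) = grad u - grad v"
  by (auto simp: grad_def fun_eq_iff)

lemma grad_scale: "grad (cscale c u) = cscale c (grad u)"
  by (auto simp: grad_def fun_eq_iff algebra_simps)

lemma Q0_eq_sqsum:
  fixes u :: "int ^ 'd::finite \<Rightarrow> complex"
  assumes "grad u \<in> ell2"
  shows "Q0 u = sqsum (grad u)"
proof -
  have "(\<Sum>\<^sub>\<infinity>x\<in>UNIV. \<Sum>\<^sub>\<infinity>j\<in>UNIV. (cmod (grad u (x, j)))\<^sup>2) =
      (\<Sum>\<^sub>\<infinity>p\<in>UNIV \<times> UNIV. (cmod (grad u p))\<^sup>2)"
    by (rule infsum_Sigma_banach) (use ell2_summable[OF assms] in simp)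
  then show ?thesis by (simp add: Q0_def sqsum_def grad_def)
qed

lemma Q0_inner_eq_ip2:
  fixes u :: "int ^ 'd::finite \<Rightarrow> complex"
  assumes "grad u \<in> ell2" "grad v \<in> ell2"
  shows "Q0_inner u v = ip2 (grad u) (grad v)"
proof -
  have "(\<Sum>\<^sub>\<infinity>x\<in>UNIV. \<Sum>\<^sub>\<infinity>j\<in>UNIV. grad u (x, j) * cnj (grad v (x, j))) =
      (\<Sum>\<^sub>\<infinity>p\<in>UNIV \<times> UNIV. grad u p * cnj (grad v p))"
    by (rule infsum_Sigma_banach) (use ell2_product_summable[OF assms] in simp)
  then show ?thesis by (simp add: Q0_inner_def ip2_def grad_def)
qed

lemma sqsum_translate: "sqsum (\<lambda>x. u (x + y)) = sqsum u" for y :: "'a::ab_group_add"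
  unfolding sqsum_def
  by (rule infsum_reindex_bij_betw[where f = "\<lambda>x. (cmod (u x))\<^sup>2"])
     (rule bij_betw_byWitness[where f' = "\<lambda>x. x - y"], auto)

lemma ell2_translate: "u \<in> ell2 \<Longrightarrow> (\<lambda>x. u (x + y)) \<in> ell2" for y :: "'a::ab_group_add"
proof -
  assume u: "u \<in> ell2"
  have "(\<lambda>x. (cmod (u (x + y)))\<^sup>2) summable_on UNIV \<longleftrightarrow> (\<lambda>x. (cmod (u x))\<^sup>2) summable_on UNIV"
    by (rule summable_on_reindex_bij_betw)
     (rule bij_betw_byWitness[where f' = "\<lambda>x. x - y"], auto)
  then show ?thesis using u by (simp add: ell2_def)
qed

lemma grad_ell2_of_ell2:
  fixes u :: "int ^ 'd::finite \<Rightarrow> complex"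
  assumes u: "u \<in> ell2"
  shows "grad u \<in> ell2" "sqsum (grad u) \<le> 4 * CARD('d) * sqsum u"
proof -
  have "(\<Sum>p\<in>E. (cmod (grad u p))\<^sup>2) \<le> 4 * CARD('d) * sqsum u" if E: "finite E" for E
  proof -
    have "(\<Sum>p\<in>E. (cmod (grad u p))\<^sup>2) \<le> (\<Sum>p\<in>fst ` E \<times> UNIV. (cmod (grad u p))\<^sup>2)"
      using E by (intro sum_mono2) force+
    also have "\<dots> = (\<Sum>j\<in>UNIV. \<Sum>x\<in>fst ` E. (cmod (grad u (x, j)))\<^sup>2)"
      by (subst sum.swap) (simp add: sum.cartesian_product)
    also have "\<dots> \<le> (\<Sum>j\<in>(UNIV::'d set). 4 * sqsum u)"
    proof (rule sum_mono)
      fix j :: 'd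
      have "(\<Sum>x\<in>fst ` E. (cmod (grad u (x, j)))\<^sup>2) \<le>
          (\<Sum>x\<in>fst ` E. 2 * (cmod (u (x + axis j 1)))\<^sup>2 + 2 * (cmod (u x))\<^sup>2)"
        using cmod_sq_add_le[of "u (x + axis j 1)" "- u x" for x]
        by (intro sum_mono) (simp add: grad_def)
      also have "\<dots> = 2 * (\<Sum>x\<in>fst ` E. (cmod (u (x + axis j 1)))\<^sup>2) + 2 * (\<Sum>x\<in>fst ` E. (cmod (u x))\<^sup>2)"
        by (simp add: sum.distrib sum_distrib_left)
      also have "\<dots> \<le> 2 * sqsum u + 2 * sqsum u"
        using E u finite_sum_le_sqsum[OF ell2_translate[OF u, of "axis j 1"], of "fst ` E"]
        by (intro add_mono mult_left_mono finite_sum_le_sqsum) (auto simp: sqsum_translate)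
      finally show "(\<Sum>x\<in>fst ` E. (cmod (grad u (x, j)))\<^sup>2) \<le> 4 * sqsum u" by simp
    qed
    finally show ?thesis by simp
  qed
  then show "grad u \<in> ell2" "sqsum (grad u) \<le> 4 * CARD('d) * sqsum u"
    using ell2_if_bounded by blast+
qed

subsection \<open>Translations and averages over dyadic cubes\<close>
lemma ell2_sum_bound:
  assumes "u \<in> ell2" "v \<in> ell2" "sqsum u \<le> a\<^sup>2" "sqsum v \<le> b\<^sup>2" "0 \<le> a" "0 \<le> b"
  shows "u + v \<in> ell2" "sqsum (u + v) \<le> (a + b)\<^sup>2"
proof -
  show w: "u + v \<in> ell2" using assms by (intro ell2_add)
  have "sqrt (sqsum (u + v)) \<le> sqrt (sqsum u) + sqrt (sqsum v)"
    using ell2.nrm_triangle[OF assms(1,2)] assms w by (simp add: hnorm_ip2)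
  also have "\<dots> \<le> a + b" using assms by (intro add_mono real_le_lsqrt) auto
  finally show "sqsum (u + v) \<le> (a + b)\<^sup>2"
    using sqrt_le_D by blast
qed

text \<open>
  The price of moving by \<open>y\<close> in units of the root of the energy, uniformly in \<open>u\<close>. It is subadditive
  in \<open>y\<close>, and a unit step costs at most one.
\<close>
definition shift_cost :: "int ^ 'd \<Rightarrow> nat \<Rightarrow> bool" where
  "shift_cost y n \<longleftrightarrow> (\<forall>u. grad u \<in> ell2 \<longrightarrow>
     (\<lambda>x. u (x + y) - u x) \<in> ell2 \<and> sqsum (\<lambda>x. u (x + y) - u x) \<le> (real n * sqrt (Q0 u))\<^sup>2)"

lemma shift_cost_0: "shift_cost 0 0"
  using ell2_zero by (auto simp: shift_cost_def sqsum_def zero_fun_def)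

lemma Q0_nonneg: "0 \<le> Q0 u"
  unfolding Q0_def by (intro infsum_nonneg sum_nonneg) auto

lemma shift_cost_add:
  fixes y z :: "int ^ 'd::finite"
  assumes "shift_cost y m" "shift_cost z n"
  shows "shift_cost (y + z) (m + n)"
  unfolding shift_cost_def
proof (intro allI impI)
  fix u :: "int ^ 'd \<Rightarrow> complex" assume u: "grad u \<in> ell2"
  let ?v = "\<lambda>x. u (x + z) - u x" and ?w = "\<lambda>x. u (x + y) - u x"
  have v: "?v \<in> ell2" "sqsum ?v \<le> (real n * sqrt (Q0 u))\<^sup>2"
    and w: "?w \<in> ell2" "sqsum ?w \<le> (real m * sqrt (Q0 u))\<^sup>2"
    using assms u unfolding shift_cost_def by blast+
  have t: "(\<lambda>x. ?v (x + y)) \<in> ell2" "sqsum (\<lambda>x. ?v (x + y)) \<le> (real n * sqrt (Q0 u))\<^sup>2"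
    using ell2_translate[OF v(1), of y] v(2) sqsum_translate[of ?v y] by simp_all
  have "(\<lambda>x. u (x + (y + z)) - u x) = ?w + (\<lambda>x. ?v (x + y))"
    by (auto simp: fun_eq_iff add.assoc)
  then show "(\<lambda>x. u (x + (y + z)) - u x) \<in> ell2 \<and>
     sqsum (\<lambda>x. u (x + (y + z)) - u x) \<le> (real (m + n) * sqrt (Q0 u))\<^sup>2"
    using ell2_sum_bound[OF w(1) t(1) w(2) t(2)] Q0_nonneg[of u] by (simp add: distrib_right)
qed

lemma shift_cost_axis: "shift_cost (axis j 1 :: int ^ 'd::finite) 1"
  unfolding shift_cost_def
proof (intro allI impI)
  fix u :: "int ^ 'd \<Rightarrow> complex" assume u: "grad u \<in> ell2"
  have "(\<Sum>x\<in>E. (cmod (u (x + axis j 1) - u x))\<^sup>2) \<le> Q0 u" if "finite E" for E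
  proof -
    have "(\<Sum>x\<in>E. (cmod (u (x + axis j 1) - u x))\<^sup>2) = (\<Sum>p\<in>(\<lambda>x. (x, j)) ` E. (cmod (grad u p))\<^sup>2)"
      by (subst sum.reindex) (auto simp: inj_on_def grad_def)
    also have "\<dots> \<le> sqsum (grad u)" using that by (intro finite_sum_le_sqsum[OF u]) auto
    finally show ?thesis by (simp add: Q0_eq_sqsum[OF u])
  qed
  then show "(\<lambda>x. u (x + axis j 1) - u x) \<in> ell2 \<and>
     sqsum (\<lambda>x. u (x + axis j 1) - u x) \<le> (real 1 * sqrt (Q0 u))\<^sup>2"
    using ell2_if_bounded[of "\<lambda>x. u (x + axis j 1) - u x" "Q0 u"] Q0_nonneg[of u] by simp
qed

lemma shift_cost_axis_mult: "shift_cost (axis j (int n) :: int ^ 'd::finite) n"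
proof (induction n)
  case 0 have "axis j (int 0) = (0 :: int ^ 'd)" by (simp add: vec_eq_iff axis_def)
  then show ?case using shift_cost_0 by (simp only:)
next
  case (Suc n)
  have "axis j (int (Suc n)) = (axis j (int n) + axis j 1 :: int ^ 'd)" by (simp add: vec_eq_iff axis_def)
  then show ?case using shift_cost_add[OF Suc shift_cost_axis[of j]] by simp
qed

lemma shift_cost_mono: "shift_cost (y :: int ^ 'a::finite) m \<Longrightarrow> m \<le> n \<Longrightarrow> shift_cost y n"
  unfolding shift_cost_def
proof (intro allI impI)
  fix u :: "int ^ 'a \<Rightarrow> complex"
  assume h: "\<forall>u. grad u \<in> ell2 \<longrightarrow> (\<lambda>x. u (x + y) - u x) \<in> ell2 \<and>
      sqsum (\<lambda>x. u (x + y) - u x) \<le> (real m * sqrt (Q0 u))\<^sup>2" "m \<le> n" "grad u \<in> ell2"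
  have "(real m * sqrt (Q0 u))\<^sup>2 \<le> (real n * sqrt (Q0 u))\<^sup>2"
    using h(2) Q0_nonneg[of u] by (intro power_mono mult_right_mono) auto
  then show "(\<lambda>x. u (x + y) - u x) \<in> ell2 \<and> sqsum (\<lambda>x. u (x + y) - u x) \<le> (real n * sqrt (Q0 u))\<^sup>2"
    using h(1,3) by (meson order_trans)
qed

definition cube :: "nat \<Rightarrow> (int ^ 'd) set" where
  "cube n = {y. \<forall>i. 0 \<le> y $ i \<and> y $ i < int n}"

lemma shift_cost_cube:
  fixes y :: "int ^ 'd::finite"
  assumes "\<forall>i. 0 \<le> y $ i \<and> y $ i \<le> int n"
  shows "shift_cost y (CARD('d) * n)"
proof -
  have "shift_cost (\<Sum>j\<in>J. axis j (y $ j)) (card J * n)" if "finite J" for J :: "'d set"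
    using that
  proof (induction J rule: finite_induct)
    case empty then show ?case using shift_cost_0 by simp
  next
    case (insert j J)
    have "0 \<le> y $ j" "nat (y $ j) \<le> n" using assms by (auto simp: nat_le_iff)
    then have "shift_cost (axis j (y $ j)) n"
      using shift_cost_mono[OF shift_cost_axis_mult[of j "nat (y $ j)"], of n] by simp
    then show ?case using shift_cost_add[OF _ insert.IH] insert.hyps by simp
  qed
  from this[of UNIV] have "shift_cost (\<Sum>j\<in>UNIV. axis j (y $ j)) (CARD('d) * n)" by simp
  also have "(\<Sum>j\<in>UNIV. axis j (y $ j)) = y"
    by (simp add: vec_eq_iff axis_def if_distrib[of "\<lambda>f. f $ _"] cong: if_cong)
  finally show ?thesis .
qed

lemma cube_bij: "bij_betw (\<lambda>f. \<chi> i. f i) (PiE UNIV (\<lambda>_. {0..<int n})) (cube n :: (int ^ 'd::finite) set)"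
  by (rule bij_betw_byWitness[where f' = "\<lambda>y i. y $ i"]) (auto simp: cube_def vec_eq_iff PiE_def Pi_def)

lemma finite_cube [simp]: "finite (cube n :: (int ^ 'd::finite) set)"
  using bij_betw_finite[OF cube_bij[where 'd='d, of n]] by (auto intro: finite_PiE)

lemma card_cube: "card (cube n :: (int ^ 'd::finite) set) = n ^ CARD('d)"
  using bij_betw_same_card[OF cube_bij[where 'd='d, of n]] by (simp add: card_PiE)

definition avg :: "nat \<Rightarrow> (int ^ 'd \<Rightarrow> complex) \<Rightarrow> int ^ 'd \<Rightarrow> complex" where
  "avg k u x = (\<Sum>y\<in>cube (2 ^ k). u (x + y)) / of_nat (card (cube (2 ^ k) :: (int ^ 'd) set))"

lemma avg_lincomb: "avg k (lincomb I c v) x = (\<Sum>i\<in>I. c i * avg k (v i) x)"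
  unfolding avg_def lincomb_apply
  by (subst sum.swap) (simp add: sum_distrib_left sum_divide_distrib)

lemma card_cube_pos: "0 < card (cube (2 ^ k) :: (int ^ 'd::finite) set)"
  by (simp add: card_cube)

lemma cube_nonempty: "(cube (2 ^ k) :: (int ^ 'd::finite) set) \<noteq> {}"
  using card_cube_pos[where 'd='d, of k] by fastforce

text \<open>
  The difference \<open>u - avg k u\<close> is an average of differences \<open>u - u(\<cdot> + y)\<close> with \<open>y\<close> in a cube of
  side \<open>2\<^sup>k\<close>, each of which costs at most \<open>d 2\<^sup>k\<close>; convexity of the square does the rest.
\<close>
lemma avg_smoothing_bound:
  fixes u :: "int ^ 'd::finite \<Rightarrow> complex"
  assumes u: "grad u \<in> ell2" and E: "finite E"
  shows "(\<Sum>x\<in>E. (cmod (u x - avg k u x))\<^sup>2) \<le> (CARD('d) * 2 ^ k)\<^sup>2 * Q0 u"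
proof -
  let ?Y = "cube (2 ^ k) :: (int ^ 'd) set"
  let ?n = "real (card ?Y)"
  have n: "?n > 0" using card_cube_pos[where 'd='d, of k] by simp
  have pt: "(cmod (u x - avg k u x))\<^sup>2 \<le> (\<Sum>y\<in>?Y. (cmod (u (x + y) - u x))\<^sup>2) / ?n" for x
  proof -
    have "u x - avg k u x = - (\<Sum>y\<in>?Y. u (x + y) - u x) / of_nat (card ?Y)"
    proof -
      have "complex_of_nat (card ?Y) \<noteq> 0" using cube_nonempty[where 'd='d, of k] by simp
      then show ?thesis unfolding avg_def sum_subtractf by (simp add: diff_divide_distrib)
    qed
    then have "(cmod (u x - avg k u x))\<^sup>2 = (cmod (\<Sum>y\<in>?Y. u (x + y) - u x))\<^sup>2 / ?n\<^sup>2"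
      by (simp add: norm_divide power_divide)
    also have "\<dots> \<le> (?n * (\<Sum>y\<in>?Y. (cmod (u (x + y) - u x))\<^sup>2)) / ?n\<^sup>2"
      by (intro divide_right_mono cmod_sum_sq_le) simp
    finally show ?thesis using cube_nonempty[where 'd='d, of k] by (simp add: power2_eq_square)
  qed
  have "(\<Sum>x\<in>E. (cmod (u x - avg k u x))\<^sup>2) \<le> (\<Sum>x\<in>E. (\<Sum>y\<in>?Y. (cmod (u (x + y) - u x))\<^sup>2) / ?n)"
    by (intro sum_mono pt)
  also have "\<dots> = (\<Sum>y\<in>?Y. \<Sum>x\<in>E. (cmod (u (x + y) - u x))\<^sup>2) / ?n"
    by (subst sum.swap) (simp add: sum_divide_distrib)
  also have "\<dots> \<le> (\<Sum>y\<in>?Y. (CARD('d) * 2 ^ k)\<^sup>2 * Q0 u) / ?n"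
  proof (intro divide_right_mono sum_mono)
    fix y assume "y \<in> ?Y"
    then have "shift_cost y (CARD('d) * 2 ^ k)"
      by (intro shift_cost_cube) (auto simp: cube_def less_imp_le)
    then have m: "(\<lambda>x. u (x + y) - u x) \<in> ell2"
       "sqsum (\<lambda>x. u (x + y) - u x) \<le> (real (CARD('d) * 2 ^ k) * sqrt (Q0 u))\<^sup>2"
      using u unfolding shift_cost_def by blast+
    show "(\<Sum>x\<in>E. (cmod (u (x + y) - u x))\<^sup>2) \<le> (CARD('d) * 2 ^ k)\<^sup>2 * Q0 u"
      using order_trans[OF finite_sum_le_sqsum[OF m(1) E] m(2)] Q0_nonneg[of u]
      by (simp add: power_mult_distrib)
  qed simp
  also have "\<dots> = (CARD('d) * 2 ^ k)\<^sup>2 * Q0 u" using cube_nonempty[where 'd='d, of k] by simp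
  finally show ?thesis .
qed

text \<open>
  A cube of side \<open>2n\<close> is tiled by \<open>2\<^sup>d\<close> cubes of side \<open>n\<close>; on coordinates this is division with
  remainder by \<open>n\<close>.
\<close>
lemma cube_doubling:
  "bij_betw (\<lambda>(y, e). y + (\<chi> i. int n * e $ i)) (cube n \<times> cube 2) (cube (2 * n) :: (int ^ 'd::finite) set)"
proof (cases "n = 0")
  case True
  have "cube 0 = ({} :: (int ^ 'd) set)"
    unfolding cube_def by (simp add: set_eq_iff not_less)
  then show ?thesis using True by (simp add: bij_betw_def)
next
  case False
  then have n: "int n > 0" by simp
  show ?thesis
  proof (rule bij_betw_byWitness[where f' = "\<lambda>z. (\<chi> i. z $ i mod int n, \<chi> i. z $ i div int n)"])
    show "\<forall>a\<in>cube n \<times> cube 2. (\<lambda>z. (\<chi> i. z $ i mod int n, \<chi> i. z $ i div int n))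
        ((\<lambda>(y, e). y + (\<chi> i. int n * e $ i)) a) = a"
      using n by (auto simp: cube_def vec_eq_iff)
    show "\<forall>a'\<in>cube (2 * n). (\<lambda>(y, e). y + (\<chi> i. int n * e $ i)) (\<chi> i. a' $ i mod int n, \<chi> i. a' $ i div int n) = a'"
      by (auto simp: vec_eq_iff)
    show "(\<lambda>(y, e). y + (\<chi> i. int n * e $ i)) ` (cube n \<times> cube 2 :: ((int ^ 'd) \<times> (int ^ 'd)) set) \<subseteq> cube (2 * n)"
    proof (rule image_subsetI)
      fix p :: "(int ^ 'd) \<times> (int ^ 'd)" assume p: "p \<in> cube n \<times> cube 2"
      obtain y e where pe: "p = (y, e)" by (cases p)
      have "0 \<le> y $ i + int n * e $ i \<and> y $ i + int n * e $ i < 2 * int n" for i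
      proof -
        have "0 \<le> y $ i" "y $ i < int n" "0 \<le> e $ i \<and> e $ i < 2"
          using p by (auto simp: pe cube_def)
        moreover from this(3) have "e $ i = 0 \<or> e $ i = 1" by presburger
        ultimately show ?thesis by auto
      qed
      then show "(case p of (y, e) \<Rightarrow> y + (\<chi> i. int n * e $ i)) \<in> cube (2 * n)"
        by (simp add: pe cube_def)
    qed
    show "(\<lambda>z. (\<chi> i. z $ i mod int n, \<chi> i. z $ i div int n)) ` cube (2 * n) \<subseteq> cube n \<times> cube 2"
    proof -
      have "a div int n < 2" if "a < 2 * int n" for a
      proof (rule ccontr)
        assume "\<not> a div int n < 2"
        then have "int n * 2 \<le> int n * (a div int n)" using n by (intro mult_left_mono) auto
        also have "\<dots> \<le> a" using mult_div_mod_eq[of "int n" a] pos_mod_sign[OF n, of a] by linarith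
        finally show False using that by simp
      qed
      then show ?thesis using n by (auto simp: cube_def pos_imp_zdiv_nonneg_iff)
    qed
  qed
qed

text \<open>
  Passing from side \<open>2\<^sup>k\<close> to \<open>2\<^sup>k\<^sup>+\<^sup>1\<close> replaces a cube average by the mean of \<open>2\<^sup>d\<close> neighbouring ones. The
  volume \<open>(2\<^sup>k)\<^sup>d\<close> of the small cube appears in the denominator because the translation bound is an
  \<open>\<ell>\<^sub>2\<close> bound, of which a single average sees only the normalised sum over one cube.
\<close>
lemma avg_increment_bound:
  fixes u :: "int ^ 'd::finite \<Rightarrow> complex"
  assumes u: "grad u \<in> ell2"
  shows "(cmod (avg k u x - avg (Suc k) u x))\<^sup>2 \<le> (CARD('d) * 2 ^ k)\<^sup>2 / (2 ^ k) ^ CARD('d) * Q0 u"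
proof -
  let ?Y = "cube (2 ^ k) :: (int ^ 'd) set" and ?Z = "cube 2 :: (int ^ 'd) set"
  let ?t = "\<lambda>e. (\<chi> i. int (2 ^ k) * e $ i) :: int ^ 'd"
  let ?n = "real (card ?Y)" and ?m = "real (card ?Z)"
  have n: "?n > 0" "?m > 0" using card_cube_pos[where 'd='d, of k] card_cube_pos[where 'd='d, of 1] by auto
  have card2: "card (cube (2 ^ Suc k) :: (int ^ 'd) set) = card ?Y * card ?Z"
    using bij_betw_same_card[OF cube_doubling[where 'd='d, of "2 ^ k"]] by (simp add: card_cartesian_product)
  have "(\<Sum>y\<in>cube (2 ^ Suc k). u (x + y)) = (\<Sum>(y, e)\<in>?Y \<times> ?Z. u (x + (y + ?t e)))"
    using sum.reindex_bij_betw[OF cube_doubling[where 'd='d, of "2 ^ k"], of "\<lambda>y. u (x + y)"]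
    by (simp add: case_prod_unfold)
  then have "avg (Suc k) u x = (\<Sum>p\<in>?Y \<times> ?Z. u (x + fst p + ?t (snd p))) / of_nat (card ?Y * card ?Z)"
    unfolding avg_def card2 by (simp add: case_prod_unfold add.assoc)
  moreover have "avg k u x = (\<Sum>p\<in>?Y \<times> ?Z. u (x + fst p)) / of_nat (card ?Y * card ?Z)"
  proof -
    have "(\<Sum>p\<in>?Y \<times> ?Z. u (x + fst p)) = of_nat (card ?Z) * (\<Sum>y\<in>?Y. u (x + y))"
      by (simp add: sum.cartesian_product' sum_distrib_left)
    moreover have "?Z \<noteq> {}" using cube_nonempty[where 'd='d, of 1] by simp
    ultimately show ?thesis unfolding avg_def by simp
  qed
  ultimately have "avg (Suc k) u x - avg k u x =
      (\<Sum>p\<in>?Y \<times> ?Z. u (x + fst p + ?t (snd p)) - u (x + fst p)) / of_nat (card ?Y * card ?Z)"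
    by (simp add: sum_subtractf diff_divide_distrib)
  then have "(cmod (avg (Suc k) u x - avg k u x))\<^sup>2 =
      (cmod (\<Sum>p\<in>?Y \<times> ?Z. u (x + fst p + ?t (snd p)) - u (x + fst p)))\<^sup>2 / (?n * ?m)\<^sup>2"
    by (simp add: norm_divide power_divide norm_mult)
  also have "\<dots> \<le> ((?n * ?m) * (\<Sum>p\<in>?Y \<times> ?Z. (cmod (u (x + fst p + ?t (snd p)) - u (x + fst p)))\<^sup>2)) / (?n * ?m)\<^sup>2"
    using cmod_sum_sq_le[of "\<lambda>p. u (x + fst p + ?t (snd p)) - u (x + fst p)" "?Y \<times> ?Z"]
    by (intro divide_right_mono) (simp_all add: card_cartesian_product)
  also have "\<dots> = (\<Sum>e\<in>?Z. \<Sum>y\<in>?Y. (cmod (u (x + y + ?t e) - u (x + y)))\<^sup>2) / (?n * ?m)"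
    using n by (subst sum.swap) (simp add: sum.cartesian_product' power2_eq_square)
  also have "\<dots> \<le> (\<Sum>e\<in>?Z. (CARD('d) * 2 ^ k)\<^sup>2 * Q0 u) / (?n * ?m)"
  proof (intro divide_right_mono sum_mono)
    fix e assume "e \<in> ?Z"
    then have "0 \<le> e $ i" "e $ i \<le> 1" for i unfolding cube_def by (auto dest!: spec[of _ i])
    then have "shift_cost (?t e) (CARD('d) * 2 ^ k)" by (intro shift_cost_cube) auto
    then have m: "(\<lambda>x. u (x + ?t e) - u x) \<in> ell2"
       "sqsum (\<lambda>x. u (x + ?t e) - u x) \<le> (real (CARD('d) * 2 ^ k) * sqrt (Q0 u))\<^sup>2"
      using u unfolding shift_cost_def by blast+
    have "(\<Sum>y\<in>?Y. (cmod (u (x + y + ?t e) - u (x + y)))\<^sup>2) =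
        (\<Sum>z\<in>(\<lambda>y. x + y) ` ?Y. (cmod (u (z + ?t e) - u z))\<^sup>2)"
      by (subst sum.reindex) auto
    also have "\<dots> \<le> (real (CARD('d) * 2 ^ k) * sqrt (Q0 u))\<^sup>2"
      by (rule order_trans[OF finite_sum_le_sqsum[OF m(1)] m(2)]) simp
    finally show "(\<Sum>y\<in>?Y. (cmod (u (x + y + ?t e) - u (x + y)))\<^sup>2) \<le> (CARD('d) * 2 ^ k)\<^sup>2 * Q0 u"
      using Q0_nonneg[of u] by (simp add: power_mult_distrib)
  qed simp
  also have "\<dots> = (CARD('d) * 2 ^ k)\<^sup>2 * Q0 u / ?n"
    using cube_nonempty[where 'd='d, of 1] by simp
  finally show ?thesis by (simp add: norm_minus_commute card_cube)
qed

section \<open>Decay of averages over large scales\<close>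
lemma grad_finite_support:
  fixes u :: "int ^ 'd::finite \<Rightarrow> complex"
  assumes "finite {x. u x \<noteq> 0}"
  shows "grad u \<in> ell2"
  using assms by (intro grad_ell2_of_ell2 ell2_finite_support)

lemma avg_0: "avg 0 u x = u x" for u :: "int ^ 'd::finite \<Rightarrow> complex"
proof -
  have "cube 1 = {0 :: int ^ 'd}" by (auto simp: cube_def vec_eq_iff int_one_le_iff_zero_less) (smt (verit))
  then show ?thesis by (simp add: avg_def)
qed

lemma avg_tendsto:
  fixes u :: "int ^ 'd::finite \<Rightarrow> complex"
  assumes "\<And>x. (\<lambda>n. f n x) \<longlonglongrightarrow> u x"
  shows "(\<lambda>n. avg k (f n) x) \<longlonglongrightarrow> avg k u x"
  unfolding avg_def
  by (intro tendsto_divide tendsto_sum assms tendsto_const) (use cube_nonempty[where 'd='d, of k] in simp)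

text \<open>
  The number \<open>2\<^sup>1\<^sup>-\<^sup>d\<^sup>/\<^sup>2\<close>, by which the bound on \<open>avg k u\<close> improves when \<open>k\<close> increases by one.
\<close>
definition decay :: "nat \<Rightarrow> real" where
  "decay d = 2 / sqrt 2 ^ d"

lemma decay_pos: "0 < decay d" by (simp add: decay_def)

lemma decay_less_1:
  assumes "d \<ge> 3" shows "decay d < 1"
proof -
  have "2 < sqrt 2 ^ 3" by (simp add: power3_eq_cube)
  also have "\<dots> \<le> sqrt 2 ^ d" using assms by (intro power_increasing) auto
  finally show ?thesis by (simp add: decay_def)
qed

lemma decay_sq: "(decay d)\<^sup>2 = 4 / 2 ^ d"
  by (simp add: decay_def power_divide power_mult[symmetric] mult.commute[of d]) (simp add: power_mult)

lemma avg_increment_decay: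
  fixes u :: "int ^ 'd::finite \<Rightarrow> complex"
  assumes "grad u \<in> ell2"
  shows "cmod (avg k u x - avg (Suc k) u x) \<le> CARD('d) * decay CARD('d) ^ k * sqrt (Q0 u)"
proof (rule power2_le_imp_le)
  have "(CARD('d) * decay CARD('d) ^ k * sqrt (Q0 u))\<^sup>2 = (CARD('d))\<^sup>2 * ((decay CARD('d))\<^sup>2) ^ k * Q0 u"
    using Q0_nonneg[of u] by (simp add: power_mult_distrib power_mult[symmetric] mult.commute)
  also have "((decay CARD('d))\<^sup>2) ^ k = (2 ^ k)\<^sup>2 / (2 ^ k) ^ CARD('d)"
    unfolding decay_sq power_divide
    by (simp add: power_mult[symmetric] mult.commute[of k]) (simp add: power_mult)
  finally show "(cmod (avg k u x - avg (Suc k) u x))\<^sup>2 \<le> (CARD('d) * decay CARD('d) ^ k * sqrt (Q0 u))\<^sup>2"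
    using avg_increment_bound[OF assms, of k x] by (simp add: power_mult_distrib)
qed (simp add: decay_pos less_imp_le Q0_nonneg)

lemma avg_tendsto_0:
  fixes u :: "int ^ 'd::finite \<Rightarrow> complex"
  assumes fin: "finite {x. u x \<noteq> 0}"
  shows "(\<lambda>n. avg n u x) \<longlonglongrightarrow> 0"
proof (rule Lim_null_comparison)
  define S where "S = (\<Sum>z\<in>{z. u z \<noteq> 0}. cmod (u z))"
  have S: "0 \<le> S" by (simp add: S_def sum_nonneg)
  show "(\<lambda>n. S * (1 / 2) ^ n) \<longlonglongrightarrow> 0"
    by (intro tendsto_mult_right_zero LIMSEQ_power_zero) simp
  have "cmod (avg n u x) \<le> S * (1 / 2) ^ n" for n
  proof -
    let ?Y = "cube (2 ^ n) :: (int ^ 'd) set"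
    have "(\<Sum>y\<in>?Y. cmod (u (x + y))) = (\<Sum>z\<in>(\<lambda>y. x + y) ` ?Y. cmod (u z))"
      by (subst sum.reindex) auto
    also have "\<dots> = (\<Sum>z\<in>(\<lambda>y. x + y) ` ?Y \<inter> {z. u z \<noteq> 0}. cmod (u z))"
      by (rule sum.mono_neutral_right) auto
    also have "\<dots> \<le> S" unfolding S_def using fin by (intro sum_mono2) auto
    finally have "cmod (\<Sum>y\<in>?Y. u (x + y)) \<le> S" using norm_sum[of "\<lambda>y. u (x + y)" ?Y] by linarith
    then have "cmod (avg n u x) \<le> S / real (card ?Y)"
      by (simp add: avg_def norm_divide divide_right_mono)
    also have "\<dots> \<le> S / 2 ^ n"
    proof -
      have "(2 ^ n :: real) ^ 1 \<le> (2 ^ n) ^ CARD('d)" by (intro power_increasing) (auto simp: Suc_leI)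
      then show ?thesis using S by (intro divide_left_mono) (auto simp: card_cube)
    qed
    finally show ?thesis by (simp add: power_divide)
  qed
  then show "\<forall>\<^sub>F n in sequentially. cmod (avg n u x) \<le> S * (1 / 2) ^ n" by simp
qed

abbreviation gnorm :: "(int ^ 'd \<Rightarrow> complex) \<Rightarrow> real" where
  "gnorm u \<equiv> hnorm ip2 (grad u)"

lemma gnorm_eq: "grad u \<in> ell2 \<Longrightarrow> gnorm u = sqrt (Q0 u)" for u :: "int ^ 'd::finite \<Rightarrow> complex"
  by (simp add: hnorm_ip2 Q0_eq_sqsum)

text \<open>
  The factor \<open>d\<close> of the translation bound times the sum of the geometric series over the scales.
\<close>
definition sobolev :: "nat \<Rightarrow> real" where
  "sobolev d = d / (1 - decay d)"

text \<open>
  Telescoping over all larger scales: for finite support the averages tend to zero, and the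
  increments form a geometric series because \<open>d \<ge> 3\<close>.
\<close>
lemma avg_bound_finite_support:
  fixes u :: "int ^ 'd::finite \<Rightarrow> complex"
  assumes d: "CARD('d) \<ge> 3" and fin: "finite {x. u x \<noteq> 0}"
  shows "cmod (avg k u x) \<le> sobolev CARD('d) * decay CARD('d) ^ k * gnorm u"
proof -
  let ?r = "decay CARD('d)" and ?c = "CARD('d) * gnorm u"
  have g: "grad u \<in> ell2" using fin by (rule grad_finite_support)
  have c: "0 \<le> ?c" using g by simp
  have r: "0 < ?r" "?r < 1" using decay_pos decay_less_1[OF d] by auto
  have tele: "cmod (avg k u x) \<le> ?c * (\<Sum>i<n. ?r ^ (k + i)) + cmod (avg (k + n) u x)" for n
  proof (induction n)
    case (Suc n)
    have "cmod (avg (k + n) u x) \<le> cmod (avg (k + n) u x - avg (Suc (k + n)) u x) + cmod (avg (Suc (k + n)) u x)"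
      using norm_triangle_ineq[of "avg (k + n) u x - avg (Suc (k + n)) u x" "avg (Suc (k + n)) u x"] by simp
    also have "\<dots> \<le> ?c * ?r ^ (k + n) + cmod (avg (Suc (k + n)) u x)"
      using avg_increment_decay[OF g, of "k + n" x] by (simp add: gnorm_eq[OF g] mult_ac)
    finally show ?case using Suc by (simp add: distrib_left)
  qed simp
  have "cmod (avg k u x) \<le> ?c * (?r ^ k / (1 - ?r)) + cmod (avg (k + n) u x)" for n
  proof -
    have "(\<Sum>i<n. ?r ^ i) \<le> (\<Sum>i. ?r ^ i)" using r by (intro sum_le_suminf summable_geometric) auto
    also have "\<dots> = 1 / (1 - ?r)" using r by (intro suminf_geometric) auto
    finally have "(\<Sum>i<n. ?r ^ (k + i)) \<le> ?r ^ k * (1 / (1 - ?r))"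
      using r unfolding power_add sum_distrib_left[symmetric] by (intro mult_left_mono) auto
    then have "?c * (\<Sum>i<n. ?r ^ (k + i)) \<le> ?c * (?r ^ k / (1 - ?r))"
      using c by (intro mult_left_mono) auto
    then show ?thesis using tele[of n] by linarith
  qed
  moreover have "(\<lambda>n. ?c * (?r ^ k / (1 - ?r)) + cmod (avg (k + n) u x)) \<longlonglongrightarrow> ?c * (?r ^ k / (1 - ?r)) + 0"
    using LIMSEQ_ignore_initial_segment[OF avg_tendsto_0[OF fin, of x], of k]
    by (intro tendsto_add tendsto_const tendsto_norm_zero) (simp add: add.commute)
  ultimately have "cmod (avg k u x) \<le> ?c * (?r ^ k / (1 - ?r))" by (auto dest!: LIMSEQ_le_const)
  then show ?thesis by (simp add: sobolev_def mult_ac)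
qed

section \<open>The energy space\<close>

text \<open>
  Gradients of a Cauchy sequence converge in \<open>\<ell>\<^sub>2\<close>, and their limit is the gradient of the pointwise
  limit. So the elements of \<open>H\<^sup>1\<close> have finite energy and are limits in energy.
\<close>
lemma H1D:
  fixes u :: "int ^ 'd::finite \<Rightarrow> complex"
  assumes "u \<in> H1"
  shows "\<exists>f. (\<forall>n. finite {x. f n x \<noteq> 0}) \<and> grad u \<in> ell2 \<and>
     (\<lambda>n::nat. hnorm ip2 (grad (f n) - grad u)) \<longlonglongrightarrow> 0 \<and> (\<forall>x. (\<lambda>n. f n x) \<longlonglongrightarrow> u x)"
proof -
  obtain f where f: "\<And>n::nat. finite {x. f n x \<noteq> 0}"
    "\<And>e. e > 0 \<Longrightarrow> \<exists>N. \<forall>m\<ge>N. \<forall>n\<ge>N. sqrt (Q0 (f m - f n)) < e" "\<And>x. (\<lambda>n. f n x) \<longlonglongrightarrow> u x"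
    using assms unfolding H1_def by blast
  have g: "grad (f n) \<in> ell2" for n using f(1) by (rule grad_finite_support)
  have gd: "grad (f m) - grad (f n) \<in> ell2" for m n using g by (intro ell2_diff)
  have lim: "(\<lambda>n. grad (f n) p) \<longlonglongrightarrow> grad u p" for p
    unfolding grad_def by (cases p) (auto intro!: tendsto_intros f(3))
  have C: "\<exists>N. \<forall>m\<ge>N. \<forall>n\<ge>N. sqsum (grad (f m) - grad (f n)) \<le> e" if "e > 0" for e
  proof -
    have "sqrt e > 0" using that by simp
    then obtain N where N: "\<forall>m\<ge>N. \<forall>n\<ge>N. sqrt (Q0 (f m - f n)) < sqrt e" using f(2) by blast
    have "Q0 (f m - f n) = sqsum (grad (f m) - grad (f n))" for m n
      using Q0_eq_sqsum[of "f m - f n"] gd[of m n] by (simp add: grad_diff)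
    then have "\<forall>m\<ge>N. \<forall>n\<ge>N. sqsum (grad (f m) - grad (f n)) \<le> e"
      using N by (auto intro: less_imp_le)
    then show ?thesis by blast
  qed
  have L: "grad u \<in> ell2" "(\<lambda>n. sqsum (grad (f n) - grad u)) \<longlonglongrightarrow> 0"
    using ell2_Cauchy_limit[OF g lim C] by auto
  have "(\<lambda>n. hnorm ip2 (grad (f n) - grad u)) \<longlonglongrightarrow> 0"
    using tendsto_real_sqrt[OF L(2)] by (simp add: hnorm_ip2 ell2_diff g L(1))
  then show ?thesis using f L(1) by blast
qed

lemma H1I:
  fixes u :: "int ^ 'd::finite \<Rightarrow> complex"
  assumes f: "\<And>n::nat. finite {x. f n x \<noteq> 0}" and u: "grad u \<in> ell2"
    and lim: "(\<lambda>n. hnorm ip2 (grad (f n) - grad u)) \<longlonglongrightarrow> 0" "\<And>x. (\<lambda>n. f n x) \<longlonglongrightarrow> u x"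
  shows "u \<in> H1"
  unfolding H1_def
proof (intro CollectI exI[of _ f] conjI allI impI f lim)
  fix e :: real assume e: "e > 0"
  have g: "grad (f n) \<in> ell2" for n using f by (rule grad_finite_support)
  have "\<forall>\<^sub>F n in sequentially. hnorm ip2 (grad (f n) - grad u) < e / 2"
    using order_tendstoD(2)[OF lim(1), of "e / 2"] e by simp
  then obtain N where N: "\<And>n. n \<ge> N \<Longrightarrow> hnorm ip2 (grad (f n) - grad u) < e / 2"
    unfolding eventually_sequentially by blast
  have "sqrt (Q0 (f m - f n)) < e" if "m \<ge> N" "n \<ge> N" for m n
  proof -
    have "sqrt (Q0 (f m - f n)) = hnorm ip2 (grad (f m) - grad (f n))"
      using gnorm_eq[of "f m - f n"] ell2_diff[OF g g, of m n] by (simp add: grad_diff)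
    moreover have "hnorm ip2 (grad (f m) - grad (f n)) \<le> hnorm ip2 (grad (f m) - grad u) + hnorm ip2 (grad u - grad (f n))"
      by (rule ell2.nrm_triangle_diff[OF g u g])
    moreover have "hnorm ip2 (grad u - grad (f n)) = hnorm ip2 (grad (f n) - grad u)"
      by (rule ell2.nrm_minus_commute[OF u g])
    ultimately show ?thesis using N[OF that(1)] N[OF that(2)] by argo
  qed
  then show "\<exists>N. \<forall>m\<ge>N. \<forall>n\<ge>N. sqrt (Q0 (f m - f n)) < e" by blast
qed

lemma grad_H1: "u \<in> H1 \<Longrightarrow> grad u \<in> ell2" for u :: "int ^ 'd::finite \<Rightarrow> complex"
  using H1D by blast

lemma finite_support_H1:
  fixes u :: "int ^ 'd::finite \<Rightarrow> complex"
  shows "finite {x. u x \<noteq> 0} \<Longrightarrow> u \<in> H1"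
  by (rule H1I[of "\<lambda>_. u"]) (auto simp: grad_finite_support hnorm_def ip2_def)

lemma H1_add:
  fixes u v :: "int ^ 'd::finite \<Rightarrow> complex"
  assumes "u \<in> H1" "v \<in> H1" shows "u + v \<in> H1"
proof -
  obtain f where f: "\<And>n. finite {x. f n x \<noteq> 0}" "grad u \<in> ell2"
    "(\<lambda>n::nat. hnorm ip2 (grad (f n) - grad u)) \<longlonglongrightarrow> 0" "\<And>x. (\<lambda>n. f n x) \<longlonglongrightarrow> u x"
    using H1D[OF assms(1)] by blast
  obtain g where g: "\<And>n. finite {x. g n x \<noteq> 0}" "grad v \<in> ell2"
    "(\<lambda>n::nat. hnorm ip2 (grad (g n) - grad v)) \<longlonglongrightarrow> 0" "\<And>x. (\<lambda>n. g n x) \<longlonglongrightarrow> v x"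
    using H1D[OF assms(2)] by blast
  show ?thesis
  proof (rule H1I[of "\<lambda>n. f n + g n"])
    show fin: "finite {x. (f n + g n) x \<noteq> 0}" for n
      by (rule finite_subset[OF _ finite_UnI[OF f(1)[of n] g(1)[of n]]]) auto
    show s: "grad (u + v) \<in> ell2" unfolding grad_add using f(2) g(2) by (rule ell2_add)
    show "(\<lambda>n. (f n + g n) x) \<longlonglongrightarrow> (u + v) x" for x using f(4) g(4) by (auto intro: tendsto_intros)
    have e: "grad (f n + g n) - grad (u + v) = (grad (f n) - grad u) + (grad (g n) - grad v)" for n
      by (simp add: grad_add)
    have i: "grad (f n) - grad u \<in> ell2" "grad (g n) - grad v \<in> ell2" for n
      by (intro ell2_diff grad_finite_support f(1,2) g(1,2))+
    show "(\<lambda>n. hnorm ip2 (grad (f n + g n) - grad (u + v))) \<longlonglongrightarrow> 0"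
    proof (rule Lim_null_comparison)
      show "(\<lambda>n. hnorm ip2 (grad (f n) - grad u) + hnorm ip2 (grad (g n) - grad v)) \<longlonglongrightarrow> 0"
        using tendsto_add[OF f(3) g(3)] by simp
      show "\<forall>\<^sub>F n in sequentially. norm (hnorm ip2 (grad (f n + g n) - grad (u + v))) \<le>
        hnorm ip2 (grad (f n) - grad u) + hnorm ip2 (grad (g n) - grad v)"
        unfolding e real_norm_def abs_of_nonneg[OF ell2.nrm_nonneg[OF ell2_add[OF i]]]
        by (intro always_eventually allI ell2.nrm_triangle i)
    qed
  qed
qed

lemma H1_scale:
  fixes u :: "int ^ 'd::finite \<Rightarrow> complex"
  assumes "u \<in> H1" shows "cscale c u \<in> H1"
proof -
  obtain f where f: "\<And>n. finite {x. f n x \<noteq> 0}" "grad u \<in> ell2"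
    "(\<lambda>n::nat. hnorm ip2 (grad (f n) - grad u)) \<longlonglongrightarrow> 0" "\<And>x. (\<lambda>n. f n x) \<longlonglongrightarrow> u x"
    using H1D[OF assms(1)] by blast
  show ?thesis
  proof (rule H1I[of "\<lambda>n. cscale c (f n)"])
    show fin: "finite {x. cscale c (f n) x \<noteq> 0}" for n
      by (rule finite_subset[OF _ f(1)[of n]]) auto
    show s: "grad (cscale c u) \<in> ell2" unfolding grad_scale using f(2) by (rule ell2_scale)
    show "(\<lambda>n. cscale c (f n) x) \<longlonglongrightarrow> cscale c u x" for x using f(4) by (auto intro: tendsto_intros)
    have e: "grad (cscale c (f n)) - grad (cscale c u) = cscale c (grad (f n) - grad u)" for n
      by (auto simp: grad_scale fun_eq_iff algebra_simps)
    have i: "grad (f n) - grad u \<in> ell2" for n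
      by (intro ell2_diff grad_finite_support f(1,2))
    show "(\<lambda>n. hnorm ip2 (grad (cscale c (f n)) - grad (cscale c u))) \<longlonglongrightarrow> 0"
      unfolding e ell2.nrm_scale[OF i] by (rule tendsto_mult_right_zero[OF f(3)])
  qed
qed

text \<open>
  Truncations to finite sets converge in \<open>\<ell>\<^sub>2\<close>, and the energy is dominated by the \<open>\<ell>\<^sub>2\<close>-norm.
\<close>
lemma ell2_subset_H1:
  fixes u :: "int ^ 'd::finite \<Rightarrow> complex"
  assumes u: "u \<in> ell2"
  shows "u \<in> H1"
proof -
  obtain e :: "nat \<Rightarrow> int ^ 'd" where e: "range e = UNIV" using uncountable_def[of "UNIV :: (int ^ 'd) set"] by auto
  define f where "f n = (\<lambda>x. if x \<in> e ` {..<n} then u x else 0)" for n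
  have fe: "f n \<in> ell2" for n
    by (rule ell2_finite_support, rule finite_subset[of _ "e ` {..<n}"]) (auto simp: f_def)
  have fu: "f n - u \<in> ell2" for n using fe u by (intro ell2_diff)
  have lim: "(\<lambda>n. f n x) \<longlonglongrightarrow> u x" for x
  proof (rule tendsto_eventually)
    obtain m where "x = e m" using e by (metis UNIV_I imageE)
    then have "f n x = u x" if "n \<ge> Suc m" for n using that by (auto simp: f_def)
    then show "\<forall>\<^sub>F n in sequentially. f n x = u x" unfolding eventually_sequentially by blast
  qed
  have "(\<lambda>n. sqsum (f n - u)) \<longlonglongrightarrow> 0"
  proof -
    have s: "sqsum (f n - u) = sqsum u - (\<Sum>x\<in>e ` {..<n}. (cmod (u x))\<^sup>2)" for n
    proof -
      have "sqsum (f n - u) = (\<Sum>\<^sub>\<infinity>x\<in>UNIV - e ` {..<n}. (cmod (u x))\<^sup>2)"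
        unfolding sqsum_def by (rule infsum_cong_neutral) (auto simp: f_def)
      also have "\<dots> = sqsum u - (\<Sum>\<^sub>\<infinity>x\<in>e ` {..<n}. (cmod (u x))\<^sup>2)"
        unfolding sqsum_def using ell2_summable[OF u] by (intro infsum_Diff) auto
      finally show ?thesis by simp
    qed
    have "(\<lambda>n. \<Sum>x\<in>e ` {..<n}. (cmod (u x))\<^sup>2) \<longlonglongrightarrow> sqsum u"
    proof (rule LIMSEQ_I)
      fix r :: real assume r: "r > 0"
      have "((\<lambda>x. (cmod (u x))\<^sup>2) has_sum sqsum u) UNIV"
        unfolding sqsum_def using ell2_summable[OF u] by (rule has_sum_infsum)
      then have "\<forall>\<^sub>F F in finite_subsets_at_top UNIV. dist (\<Sum>x\<in>F. (cmod (u x))\<^sup>2) (sqsum u) < r"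
        using r unfolding has_sum_def tendsto_iff by blast
      then obtain X where X: "finite X" "\<And>F. finite F \<Longrightarrow> X \<subseteq> F \<Longrightarrow> dist (\<Sum>x\<in>F. (cmod (u x))\<^sup>2) (sqsum u) < r"
        unfolding eventually_finite_subsets_at_top by auto
      have "\<forall>x\<in>X. \<exists>m. x = e m" using e by (metis UNIV_I imageE)
      then obtain m where m: "\<And>x. x \<in> X \<Longrightarrow> x = e (m x)" by metis
      have "X \<subseteq> e ` {..<n}" if "n \<ge> Suc (Max (m ` X))" for n
      proof
        fix x assume "x \<in> X"
        then have "m x \<le> Max (m ` X)" using X by (intro Max_ge) auto
        then show "x \<in> e ` {..<n}" using m[OF \<open>x \<in> X\<close>] that by (metis Suc_le_lessD imageI lessThan_iff order_le_less_trans)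
      qed
      then show "\<exists>no. \<forall>n\<ge>no. norm ((\<Sum>x\<in>e ` {..<n}. (cmod (u x))\<^sup>2) - sqsum u) < r"
        using X(2) unfolding dist_norm by (intro exI[of _ "Suc (Max (m ` X))"]) blast
    qed
    then have "(\<lambda>n. sqsum u - (\<Sum>x\<in>e ` {..<n}. (cmod (u x))\<^sup>2)) \<longlonglongrightarrow> sqsum u - sqsum u"
      by (intro tendsto_intros)
    then show ?thesis by (simp add: s)
  qed
  then have L: "(\<lambda>n. sqrt (4 * CARD('d) * sqsum (f n - u))) \<longlonglongrightarrow> 0"
    using tendsto_real_sqrt[OF tendsto_mult_right_zero, of "\<lambda>n. sqsum (f n - u)" sequentially "4 * CARD('d)"] by simp
  show ?thesis
  proof (rule H1I[of f])
    show "finite {x. f n x \<noteq> 0}" for n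
      by (rule finite_subset[of _ "e ` {..<n}"]) (auto simp: f_def)
    show "grad u \<in> ell2" using u by (rule grad_ell2_of_ell2)
    show "(\<lambda>n. hnorm ip2 (grad (f n) - grad u)) \<longlonglongrightarrow> 0"
    proof (rule Lim_null_comparison[OF _ L], rule always_eventually, rule allI)
      fix n
      show "norm (hnorm ip2 (grad (f n) - grad u)) \<le> sqrt (4 * CARD('d) * sqsum (f n - u))"
        unfolding grad_diff[symmetric] hnorm_ip2[OF grad_ell2_of_ell2(1)[OF fu]]
        using grad_ell2_of_ell2(2)[OF fu, of n] sqsum_nonneg[of "grad (f n - u)"] by (simp only: real_norm_def abs_of_nonneg real_sqrt_ge_zero real_sqrt_le_iff)
    qed
  qed (rule lim)
qed

text \<open>
  The dimension is carried by a type, so the assumption \<open>d \<ge> 3\<close> needs a parameter that mentions it.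
\<close>
locale lattice_ge3 =
  fixes dim :: "'d::finite itself"
  assumes dim3: "CARD('d) \<ge> 3"
begin

lemma avg_bound:
  fixes u :: "int ^ 'd \<Rightarrow> complex"
  assumes "u \<in> H1"
  shows "cmod (avg k u x) \<le> sobolev CARD('d) * decay CARD('d) ^ k * gnorm u"
proof -
  obtain f where f: "\<And>n. finite {x. f n x \<noteq> 0}" "grad u \<in> ell2"
    "(\<lambda>n::nat. hnorm ip2 (grad (f n) - grad u)) \<longlonglongrightarrow> 0" "\<And>x. (\<lambda>n. f n x) \<longlonglongrightarrow> u x"
    using H1D[OF assms(1)] by blast
  have "(\<lambda>n. gnorm (f n)) \<longlonglongrightarrow> gnorm u"
    by (rule ell2.nrm_tendsto[OF grad_finite_support[OF f(1)] f(2,3)])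
  then have "(\<lambda>n. sobolev CARD('d) * decay CARD('d) ^ k * gnorm (f n)) \<longlonglongrightarrow> sobolev CARD('d) * decay CARD('d) ^ k * gnorm u"
    by (intro tendsto_intros)
  moreover have "(\<lambda>n. cmod (avg k (f n) x)) \<longlonglongrightarrow> cmod (avg k u x)"
    by (intro tendsto_norm avg_tendsto f(4))
  ultimately show ?thesis
    using avg_bound_finite_support[OF dim3 f(1)] by (intro LIMSEQ_le) auto
qed

lemma point_evaluation_bound:
  fixes u :: "int ^ 'd \<Rightarrow> complex"
  assumes "u \<in> H1"
  shows "cmod (u x) \<le> sobolev CARD('d) * gnorm u"
  using avg_bound[OF assms, of 0 x] by (simp add: avg_0)

lemma hnorm_Q0_inner:
  fixes u :: "int ^ 'd \<Rightarrow> complex"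
  shows "u \<in> H1 \<Longrightarrow> hnorm Q0_inner u = gnorm u"
  by (simp add: hnorm_def Q0_inner_eq_ip2 grad_H1)

lemma H1_diff: "u \<in> H1 \<Longrightarrow> v \<in> H1 \<Longrightarrow> u - v \<in> H1" for u v :: "int ^ 'd \<Rightarrow> complex"
proof -
  have "u - v = u + cscale (-1) v" by (auto simp: fun_eq_iff)
  then show "u \<in> H1 \<Longrightarrow> v \<in> H1 \<Longrightarrow> u - v \<in> H1" by (metis H1_add H1_scale)
qed

sublocale H1: hilbert_fun "H1 :: (int ^ 'd \<Rightarrow> complex) set" Q0_inner
proof (standard, goal_cases)
  case 1 show ?case by (rule finite_support_H1) simp
next
  case (2 u v) then show ?case by (rule H1_add)
next
  case (3 u c) then show ?case by (rule H1_scale)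
next
  case (4 u v w)
  then show ?case
    using Q0_inner_eq_ip2[OF grad_H1[OF H1_add[OF 4(1,2)]] grad_H1[OF 4(3)]]
    by (simp add: Q0_inner_eq_ip2 grad_H1 grad_add ell2.ip_add_left)
next
  case (5 u w c)
  then show ?case
    using Q0_inner_eq_ip2[OF grad_H1[OF H1_scale[OF 5(1), of c]] grad_H1[OF 5(2)]]
    by (simp add: Q0_inner_eq_ip2 grad_H1 grad_scale ell2.ip_scale_left)
next
  case (6 u v)
  then show ?case using ell2.ip_cnj[of "grad u" "grad v"] by (simp add: Q0_inner_eq_ip2 grad_H1)
next
  case (7 u) then show ?case by (simp add: Q0_inner_eq_ip2 grad_H1 ell2.ip_nonneg)
next
  case (8 u)
  then have "gnorm u = 0" by (simp add: hnorm_def Q0_inner_eq_ip2 grad_H1)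
  then have "cmod (u x) \<le> 0" for x using point_evaluation_bound[OF 8(1), of x] by simp
  then show ?case by (simp add: fun_eq_iff)
next
  case (9 f)
  have g: "grad (f n) \<in> ell2" for n using 9(1) by (rule grad_H1)
  have gd: "grad (f m) - grad (f n) \<in> ell2" for m n using g by (intro ell2_diff)
  have hn: "hnorm Q0_inner (f m - f n) = hnorm ip2 (grad (f m) - grad (f n))" for m n
    using hnorm_Q0_inner[OF H1_diff[OF 9(1) 9(1)]] by (simp add: grad_diff)
  have s0: "sobolev CARD('d) > 0" unfolding sobolev_def using dim3 decay_less_1[OF dim3] by simp
  have "\<exists>l. (\<lambda>n. f n x) \<longlonglongrightarrow> l" for x
  proof (rule pointwise_limit_exists)
    fix e :: real assume "e > 0"
    then have "e / sobolev CARD('d) > 0" using s0 by simp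
    then obtain N where N: "\<forall>m\<ge>N. \<forall>n\<ge>N. hnorm Q0_inner (f m - f n) < e / sobolev CARD('d)" using 9(2) by blast
    have "cmod (f m x - f n x) < e" if "m \<ge> N" "n \<ge> N" for m n
    proof -
      have "cmod (f m x - f n x) \<le> sobolev CARD('d) * hnorm Q0_inner (f m - f n)"
        using point_evaluation_bound[OF H1_diff[OF 9(1) 9(1)], of m n x] by (simp add: hnorm_Q0_inner[OF H1_diff[OF 9(1) 9(1)]])
      also have "\<dots> < sobolev CARD('d) * (e / sobolev CARD('d))" using N that s0 by (intro mult_strict_left_mono) auto
      finally show ?thesis using s0 by simp
    qed
    then show "\<exists>N. \<forall>m\<ge>N. \<forall>n\<ge>N. cmod (f m x - f n x) < e" by blast
  qed
  then obtain w where w: "\<And>x. (\<lambda>n. f n x) \<longlonglongrightarrow> w x" by metis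
  have C: "\<exists>N. \<forall>m\<ge>N. \<forall>n\<ge>N. sqsum (grad (f m) - grad (f n)) \<le> e" if e: "e > 0" for e
  proof -
    obtain N where N: "\<forall>m\<ge>N. \<forall>n\<ge>N. hnorm Q0_inner (f m - f n) < sqrt e"
      using 9(2)[of "sqrt e"] e by auto
    have "\<forall>m\<ge>N. \<forall>n\<ge>N. sqsum (grad (f m) - grad (f n)) \<le> e"
      using N unfolding hn by (auto simp: hnorm_ip2 gd intro: less_imp_le)
    then show ?thesis by blast
  qed
  have lim: "(\<lambda>n. grad (f n) p) \<longlonglongrightarrow> grad w p" for p
    unfolding grad_def by (cases p) (auto intro!: tendsto_intros w)
  have L: "grad w \<in> ell2" "(\<lambda>n. sqsum (grad (f n) - grad w)) \<longlonglongrightarrow> 0"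
    using ell2_Cauchy_limit[OF g lim C] by auto
  have L2: "(\<lambda>n. hnorm ip2 (grad (f n) - grad w)) \<longlonglongrightarrow> 0"
    using tendsto_real_sqrt[OF L(2)] by (simp add: hnorm_ip2 ell2_diff g L(1))
  \<comment> \<open>membership of the limit in \<open>H1\<close> requires finitely supported approximants, chosen diagonally\<close>
  have "\<exists>h. finite {x. h x \<noteq> 0} \<and> hnorm ip2 (grad h - grad (f n)) < 1 / Suc n" for n
  proof -
    obtain h where h: "\<And>m. finite {x. h m x \<noteq> 0}" "(\<lambda>m::nat. hnorm ip2 (grad (h m) - grad (f n))) \<longlonglongrightarrow> 0"
      using H1D[OF 9(1)[of n]] by blast
    have "\<forall>\<^sub>F m in sequentially. hnorm ip2 (grad (h m) - grad (f n)) < 1 / Suc n"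
      using order_tendstoD(2)[OF h(2), of "1 / Suc n"] by simp
    then show ?thesis using h(1) unfolding eventually_sequentially by blast
  qed
  then obtain h where h: "\<And>n. finite {x. h n x \<noteq> 0}" "\<And>n. hnorm ip2 (grad (h n) - grad (f n)) < 1 / Suc n"
    by metis
  have hH: "h n \<in> H1" for n using h(1) by (rule finite_support_H1)
  have gh: "grad (h n) \<in> ell2" for n using h(1) by (rule grad_finite_support)
  have small: "(\<lambda>n. hnorm ip2 (grad (h n) - grad (f n))) \<longlonglongrightarrow> 0"
  proof (rule Lim_null_comparison[OF _ LIMSEQ_Suc[OF lim_1_over_n]], rule always_eventually, rule allI)
    fix n
    show "norm (hnorm ip2 (grad (h n) - grad (f n))) \<le> 1 / real (Suc n)"
      unfolding real_norm_def abs_of_nonneg[OF ell2.nrm_nonneg[OF ell2_diff[OF gh g]]] using h(2)[of n] by (rule less_imp_le)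
  qed
  have "w \<in> H1"
  proof (rule H1I[of h, OF h(1) L(1)])
    show "(\<lambda>n. hnorm ip2 (grad (h n) - grad w)) \<longlonglongrightarrow> 0"
    proof (rule Lim_null_comparison)
      show "(\<lambda>n. hnorm ip2 (grad (h n) - grad (f n)) + hnorm ip2 (grad (f n) - grad w)) \<longlonglongrightarrow> 0"
        using tendsto_add[OF small L2] by simp
      show "\<forall>\<^sub>F n in sequentially. norm (hnorm ip2 (grad (h n) - grad w)) \<le>
         hnorm ip2 (grad (h n) - grad (f n)) + hnorm ip2 (grad (f n) - grad w)"
        unfolding real_norm_def abs_of_nonneg[OF ell2.nrm_nonneg[OF ell2_diff[OF gh L(1)]]]
        by (intro always_eventually allI ell2.nrm_triangle_diff gh g L(1))
    qed
    fix x
    have "(\<lambda>n. h n x - f n x) \<longlonglongrightarrow> 0"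
    proof (rule Lim_null_comparison)
      show "(\<lambda>n. sobolev CARD('d) * hnorm ip2 (grad (h n) - grad (f n))) \<longlonglongrightarrow> 0"
        by (rule tendsto_mult_right_zero[OF small])
      show "\<forall>\<^sub>F n in sequentially. cmod (h n x - f n x) \<le> sobolev CARD('d) * hnorm ip2 (grad (h n) - grad (f n))"
        using point_evaluation_bound[OF H1_diff[OF hH 9(1)], of _ _ x] by (simp add: grad_diff)
    qed
    from tendsto_add[OF this w[of x]] show "(\<lambda>n. h n x) \<longlonglongrightarrow> w x" by simp
  qed
  moreover have "(\<lambda>n. hnorm Q0_inner (f n - w)) \<longlonglongrightarrow> 0"
    using L2 by (simp add: hnorm_Q0_inner[OF H1_diff[OF 9(1) \<open>w \<in> H1\<close>]] grad_diff)
  ultimately show ?case by blast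
qed

end

section \<open>Dyadic layers of the potential\<close>
lemma geometric_sum_tail_le:
  fixes r :: real
  assumes "0 \<le> r" "r < 1" "finite K" "\<And>k. k \<in> K \<Longrightarrow> k0 \<le> k"
  shows "(\<Sum>k\<in>K. r ^ k) \<le> r ^ k0 / (1 - r)"
proof -
  have inj: "inj_on (\<lambda>k. k - k0) K" using assms(4) by (intro inj_onI) (metis le_add_diff_inverse)
  have "(\<Sum>k\<in>K. r ^ k) = (\<Sum>i\<in>(\<lambda>k. k - k0) ` K. r ^ k0 * r ^ i)"
    using assms(4) by (subst sum.reindex[OF inj]) (auto intro!: sum.cong simp: power_add[symmetric])
  also have "\<dots> \<le> (\<Sum>i. r ^ k0 * r ^ i)"
    using assms by (intro sum_le_suminf summable_mult summable_geometric) auto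
  also have "\<dots> = r ^ k0 / (1 - r)" using assms by (subst suminf_mult) (auto simp: suminf_geometric intro: summable_geometric)
  finally show ?thesis .
qed

lemma bounded_finite_sums_tail:
  fixes w :: "'x \<Rightarrow> real"
  assumes bd: "\<And>E. finite E \<Longrightarrow> E \<subseteq> X \<Longrightarrow> sum w E \<le> B" and "\<delta> > 0"
  shows "\<exists>F. finite F \<and> F \<subseteq> X \<and> (\<forall>E. finite E \<and> E \<subseteq> X - F \<longrightarrow> sum w E \<le> \<delta>)"
proof -
  let ?A = "sum w ` {E. finite E \<and> E \<subseteq> X}"
  have bdd: "bdd_above ?A" using bd by (intro bdd_aboveI[of _ B]) auto
  have "Sup ?A - \<delta> < Sup ?A" using \<open>\<delta> > 0\<close> by simp
  then obtain F where F: "finite F" "F \<subseteq> X" "Sup ?A - \<delta> < sum w F"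
    using less_cSup_iff[of ?A "Sup ?A - \<delta>"] bdd by auto
  have "sum w E \<le> \<delta>" if "finite E" "E \<subseteq> X - F" for E
  proof -
    have "sum w (F \<union> E) \<le> Sup ?A" using that F by (intro cSup_upper bdd) auto
    moreover have "sum w (F \<union> E) = sum w F + sum w E" using that F by (intro sum.union_disjoint) auto
    ultimately show ?thesis using F by linarith
  qed
  then show ?thesis using F by blast
qed

text \<open>
  For \<open>0 < w \<le> 1\<close> this is the \<open>k\<close> with \<open>\<theta>\<^sup>k\<^sup>+\<^sup>1 < w \<le> \<theta>\<^sup>k\<close>.
\<close>
definition level :: "real \<Rightarrow> real \<Rightarrow> nat" where
  "level \<theta> w = (LEAST k. \<theta> ^ Suc k < w)"

lemma level_bounds:
  assumes "0 < \<theta>" "\<theta> < 1" "0 < w" "w \<le> 1"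
  shows "\<theta> ^ Suc (level \<theta> w) < w" "w \<le> \<theta> ^ level \<theta> w"
proof -
  have "(\<lambda>k. \<theta> ^ Suc k) \<longlonglongrightarrow> 0" using assms by (intro LIMSEQ_Suc LIMSEQ_power_zero) auto
  then have "\<exists>k. \<theta> ^ Suc k < w" using order_tendstoD(2)[OF _ assms(3)] by (metis eventually_sequentially order_refl)
  then show "\<theta> ^ Suc (level \<theta> w) < w" unfolding level_def by (rule LeastI_ex)
  show "w \<le> \<theta> ^ level \<theta> w"
  proof (cases "level \<theta> w")
    case (Suc k)
    then have "\<not> \<theta> ^ Suc k < w" using not_less_Least[of k "\<lambda>k. \<theta> ^ Suc k < w"] by (simp add: level_def)
    then show ?thesis using Suc by simp
  qed (use assms in simp)
qed

lemma level_ge: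
  assumes "0 < \<theta>" "\<theta> < 1" "0 < w" "w \<le> \<theta> ^ k0"
  shows "k0 \<le> level \<theta> w"
proof (rule ccontr)
  assume "\<not> k0 \<le> level \<theta> w"
  then have "\<theta> ^ k0 \<le> \<theta> ^ Suc (level \<theta> w)" using assms by (intro power_decreasing) auto
  moreover have "w \<le> 1" using assms by (metis order_trans power_le_one less_imp_le)
  ultimately show False using level_bounds(1)[OF assms(1,2,3)] assms(4) by linarith
qed

text \<open>
  On the layer \<open>k\<close> the weight is at most \<open>\<theta>\<^sup>k\<close> and the smoothing error at most \<open>(d 2\<^sup>k)\<^sup>2 Q\<^sub>0[u]\<close>, which
  gives the ratio \<open>4\<theta>\<close>.
\<close>
lemma layer_smoothing_sum:
  fixes u :: "int ^ 'd::finite \<Rightarrow> complex"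
  assumes \<theta>: "0 < \<theta>" "4 * \<theta> < 1" and E: "finite E" "\<And>x. x \<in> E \<Longrightarrow> 0 < W x \<and> W x \<le> \<theta> ^ k0"
    and u: "grad u \<in> ell2"
  shows "(\<Sum>x\<in>E. W x * (cmod (u x - avg (level \<theta> (W x)) u x))\<^sup>2) \<le>
     (real CARD('d))\<^sup>2 * ((4 * \<theta>) ^ k0 / (1 - 4 * \<theta>)) * Q0 u"
proof -
  let ?l = "\<lambda>x. level \<theta> (W x)" and ?g = "\<lambda>x. W x * (cmod (u x - avg (level \<theta> (W x)) u x))\<^sup>2"
  have \<theta>1: "\<theta> < 1" using \<theta> by simp
  have W1: "W x \<le> 1" if "x \<in> E" for x
    using E(2)[OF that] \<theta>(1) \<theta>1 by (metis order_trans power_le_one less_imp_le)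
  have "sum ?g E = (\<Sum>k\<in>?l ` E. \<Sum>x\<in>{x\<in>E. ?l x = k}. ?g x)" by (rule sum.image_gen[OF E(1)])
  also have "\<dots> \<le> (\<Sum>k\<in>?l ` E. (real CARD('d))\<^sup>2 * Q0 u * (4 * \<theta>) ^ k)"
  proof (rule sum_mono)
    fix k
    have "(\<Sum>x\<in>{x\<in>E. ?l x = k}. ?g x) \<le> (\<Sum>x\<in>{x\<in>E. ?l x = k}. \<theta> ^ k * (cmod (u x - avg k u x))\<^sup>2)"
      using level_bounds(2)[OF \<theta>(1) \<theta>1] E(2) W1 by (intro sum_mono) (auto intro!: mult_right_mono)
    also have "\<dots> = \<theta> ^ k * (\<Sum>x\<in>{x\<in>E. ?l x = k}. (cmod (u x - avg k u x))\<^sup>2)"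
      by (simp add: sum_distrib_left)
    also have "\<dots> \<le> \<theta> ^ k * ((CARD('d) * 2 ^ k)\<^sup>2 * Q0 u)"
      using E(1) \<theta> by (intro mult_left_mono avg_smoothing_bound u) auto
    also have "\<dots> = (real CARD('d))\<^sup>2 * Q0 u * (4 * \<theta>) ^ k"
    proof -
      have "(2 ^ k)\<^sup>2 = (4::real) ^ k" by (simp add: power_mult[symmetric] mult.commute[of k]) (simp add: power_mult)
      then show ?thesis by (simp add: power_mult_distrib)
    qed
    finally show "(\<Sum>x\<in>{x\<in>E. ?l x = k}. ?g x) \<le> (real CARD('d))\<^sup>2 * Q0 u * (4 * \<theta>) ^ k" .
  qed
  also have "\<dots> = (real CARD('d))\<^sup>2 * Q0 u * (\<Sum>k\<in>?l ` E. (4 * \<theta>) ^ k)" by (simp add: sum_distrib_left)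
  also have "\<dots> \<le> (real CARD('d))\<^sup>2 * Q0 u * ((4 * \<theta>) ^ k0 / (1 - 4 * \<theta>))"
    using \<theta> E level_ge[OF \<theta>(1) \<theta>1] Q0_nonneg[of u]
    by (intro mult_left_mono geometric_sum_tail_le) auto
  finally show ?thesis by (simp add: mult_ac)
qed

text \<open>
  The layer \<open>k\<close> has at most \<open>N \<theta>\<^sup>-\<^sup>q\<^sup>(\<^sup>k\<^sup>+\<^sup>1\<^sup>)\<close> points, each with weight at most \<open>\<theta>\<^sup>k\<close>.
\<close>
lemma layer_weight_sum:
  assumes \<theta>: "0 < \<theta>" "\<theta> < 1" and E: "finite E" "\<And>x. x \<in> E \<Longrightarrow> 0 < W x \<and> W x \<le> 1"
    and N: "\<And>t. t > 0 \<Longrightarrow> finite {x. W x > t} \<and> real (card {x. W x > t}) \<le> N * t powr (- q)"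
    and r: "0 \<le> r" "\<theta> powr (1 - q) * r < 1"
  shows "(\<Sum>x\<in>E. W x * r ^ level \<theta> (W x)) \<le> \<theta> powr (- q) / (1 - \<theta> powr (1 - q) * r) * N"
proof -
  let ?l = "\<lambda>x. level \<theta> (W x)" and ?g = "\<lambda>x. W x * r ^ level \<theta> (W x)"
  let ?\<sigma> = "\<theta> powr (1 - q) * r"
  have N0: "0 \<le> N" using N[of 1] by simp
  have "sum ?g E = (\<Sum>k\<in>?l ` E. \<Sum>x\<in>{x\<in>E. ?l x = k}. ?g x)" by (rule sum.image_gen[OF E(1)])
  also have "\<dots> \<le> (\<Sum>k\<in>?l ` E. N * \<theta> powr (- q) * ?\<sigma> ^ k)"
  proof (rule sum_mono)
    fix k
    have "(\<Sum>x\<in>{x\<in>E. ?l x = k}. ?g x) \<le> (\<Sum>x\<in>{x\<in>E. ?l x = k}. \<theta> ^ k * r ^ k)"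
      using level_bounds(2)[OF \<theta>] E(2) r by (intro sum_mono) (auto intro!: mult_right_mono)
    also have "\<dots> = real (card {x\<in>E. ?l x = k}) * (\<theta> ^ k * r ^ k)" by simp
    also have "\<dots> \<le> (N * (\<theta> ^ Suc k) powr (- q)) * (\<theta> ^ k * r ^ k)"
    proof (intro mult_right_mono)
      have f: "finite {x. W x > \<theta> ^ Suc k}" "real (card {x. W x > \<theta> ^ Suc k}) \<le> N * (\<theta> ^ Suc k) powr (- q)"
        using N[of "\<theta> ^ Suc k"] \<theta> by auto
      have "{x\<in>E. ?l x = k} \<subseteq> {x. W x > \<theta> ^ Suc k}" using level_bounds(1)[OF \<theta>] E(2) by auto
      then have "real (card {x\<in>E. ?l x = k}) \<le> real (card {x. W x > \<theta> ^ Suc k})"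
        using f by (simp add: card_mono)
      then show "real (card {x\<in>E. ?l x = k}) \<le> N * (\<theta> ^ Suc k) powr (- q)" using f by linarith
    qed (use \<theta> r in simp)
    also have "\<dots> = N * \<theta> powr (- q) * ?\<sigma> ^ k"
    proof -
      have "(\<theta> ^ Suc k) powr (- q) = \<theta> powr (- q) * (\<theta> powr (- q)) ^ k"
      proof -
        have "(\<theta> ^ n) powr (- q) = (\<theta> powr (- q)) ^ n" for n
          using \<theta> by (induction n) (simp_all add: powr_mult)
        from this[of "Suc k"] show ?thesis by simp
      qed
      moreover have "?\<sigma> ^ k = (\<theta> powr (- q)) ^ k * (\<theta> ^ k * r ^ k)"
      proof -
        have "\<theta> powr (1 - q) = \<theta> powr (- q) * \<theta>" using \<theta> by (simp add: powr_mult_base powr_diff powr_minus field_simps)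
        then show ?thesis by (simp add: power_mult_distrib)
      qed
      ultimately show ?thesis by simp
    qed
    finally show "(\<Sum>x\<in>{x\<in>E. ?l x = k}. ?g x) \<le> N * \<theta> powr (- q) * ?\<sigma> ^ k" .
  qed
  also have "\<dots> = N * \<theta> powr (- q) * (\<Sum>k\<in>?l ` E. ?\<sigma> ^ k)" by (simp add: sum_distrib_left)
  also have "\<dots> \<le> N * \<theta> powr (- q) * (?\<sigma> ^ 0 / (1 - ?\<sigma>))"
    using r E N0 by (intro mult_left_mono geometric_sum_tail_le) auto
  finally show ?thesis by (simp add: mult_ac)
qed

lemma exists_layer_ratio:
  fixes q :: real
  assumes "q < real d / 2" "d \<ge> 3"
  shows "\<exists>\<theta>. 0 < \<theta> \<and> 4 * \<theta> < 1 \<and> \<theta> powr (1 - q) * (decay d)\<^sup>2 < 1"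
proof -
  \<comment> \<open>at \<open>\<theta> = 1/4\<close> the ratio is \<open>2\<^sup>2\<^sup>q\<^sup>-\<^sup>d < 1\<close>, and it depends continuously on \<open>\<theta>\<close>\<close>
  have "isCont (\<lambda>\<theta>. \<theta> powr (1 - q) * (decay d)\<^sup>2) (1 / 4 :: real)" by (intro continuous_intros) auto
  then have "((\<lambda>\<theta>. \<theta> powr (1 - q) * (decay d)\<^sup>2) \<longlongrightarrow> (1 / 4) powr (1 - q) * (decay d)\<^sup>2) (at_left (1 / 4))"
    unfolding isCont_def by (rule filterlim_mono) (auto simp: at_le)
  moreover have "(1 / 4) powr (1 - q) * (decay d)\<^sup>2 < 1"
  proof -
    have "(1 / 4 :: real) = 2 powr (- 2)" by (simp add: powr_minus powr_numeral)
    then have "(1 / 4 :: real) powr (1 - q) = (2 powr (- 2)) powr (1 - q)" by (simp only:)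
    also have "\<dots> = 2 powr (2 * q - 2)" by (simp only: powr_powr) (simp add: algebra_simps)
    finally have "(1 / 4 :: real) powr (1 - q) = 2 powr (2 * q - 2)" .
    moreover have "(decay d)\<^sup>2 = 2 powr (2 - real d)"
      by (simp add: decay_sq powr_diff powr_realpow powr_numeral)
    ultimately have "(1 / 4 :: real) powr (1 - q) * (decay d)\<^sup>2 = 2 powr (2 * q - real d)"
      by (simp add: powr_add[symmetric])
    also have "\<dots> < 2 powr 0" using assms by (intro powr_less_mono) auto
    finally show ?thesis by simp
  qed
  ultimately have "\<forall>\<^sub>F \<theta> in at_left (1 / 4). \<theta> powr (1 - q) * (decay d)\<^sup>2 < 1"
    by (rule order_tendstoD(2))
  moreover have "\<forall>\<^sub>F \<theta>::real in at_left (1 / 4). \<theta> \<in> {0<..<1 / 4}"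
    by (rule eventually_at_left_real) simp
  ultimately have "\<forall>\<^sub>F \<theta> in at_left (1 / 4). \<theta> powr (1 - q) * (decay d)\<^sup>2 < 1 \<and> \<theta> \<in> {0<..<1 / 4}"
    by (rule eventually_conj)
  then obtain \<theta> :: real where "\<theta> powr (1 - q) * (decay d)\<^sup>2 < 1 \<and> \<theta> \<in> {0<..<1 / 4}"
    using eventually_happens'[of "at_left (1 / 4 :: real)"] by (metis (mono_tags, lifting) trivial_limit_at_left_real)
  then show ?thesis by (intro exI[of _ \<theta>]) auto
qed

text \<open>
  The weak \<open>\<ell>\<^sub>q\<close> bound \<open>\<nu>(t, W) \<le> N t\<^sup>-\<^sup>q\<close>. Finiteness is stated separately because the cardinality of
  an infinite set is zero.
\<close>
definition weak_bound :: "real \<Rightarrow> (int ^ 'd \<Rightarrow> real) \<Rightarrow> real \<Rightarrow> bool" where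
  "weak_bound q W N \<longleftrightarrow> (\<forall>x. 0 \<le> W x) \<and>
     (\<forall>t>0. finite {x. W x > t} \<and> real (card {x. W x > t}) \<le> N * t powr (- q))"

text \<open>
  The outcome of the layer decomposition with the scales hidden: below the height \<open>c\<close>, replacing
  \<open>u(x)\<close> by \<open>avg (lev x) u x\<close> costs little, and the remaining trace is controlled by the weak norm.
\<close>
definition layered :: "real \<Rightarrow> real \<Rightarrow> (int ^ 'd \<Rightarrow> real) \<Rightarrow> (int ^ 'd \<Rightarrow> nat) \<Rightarrow> real \<Rightarrow> bool" where
  "layered c M W lev N \<longleftrightarrow>
     (\<forall>E. finite E \<and> (\<forall>x\<in>E. 0 < W x \<and> W x \<le> c) \<longrightarrow>
        (\<forall>u. grad u \<in> ell2 \<longrightarrow> (\<Sum>x\<in>E. W x * (cmod (u x - avg (lev x) u x))\<^sup>2) \<le> Q0 u / 8) \<and>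
        (\<Sum>x\<in>E. W x * (decay CARD('d) ^ lev x)\<^sup>2) \<le> M * N)"

lemma exists_layering:
  assumes d: "CARD('d::finite) \<ge> 3" and q: "q < real CARD('d) / 2"
  shows "\<exists>c>0. \<exists>M\<ge>0. \<forall>(W :: int ^ 'd \<Rightarrow> real) N. weak_bound q W N \<longrightarrow> (\<exists>lev. layered c M W lev N)"
proof -
  let ?d = "CARD('d)"
  obtain \<theta> where \<theta>: "0 < \<theta>" "4 * \<theta> < 1" "\<theta> powr (1 - q) * (decay ?d)\<^sup>2 < 1"
    using exists_layer_ratio[OF q d] by blast
  have \<theta>1: "\<theta> < 1" using \<theta> by simp
  have "(\<lambda>k. (real ?d)\<^sup>2 * ((4 * \<theta>) ^ k / (1 - 4 * \<theta>))) \<longlonglongrightarrow> (real ?d)\<^sup>2 * (0 / (1 - 4 * \<theta>))"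
    using \<theta> by (intro tendsto_intros LIMSEQ_power_zero) auto
  then have "\<forall>\<^sub>F k in sequentially. (real ?d)\<^sup>2 * ((4 * \<theta>) ^ k / (1 - 4 * \<theta>)) < 1 / 8"
    by (rule order_tendstoD(2)) simp
  then obtain k0 where k0: "(real ?d)\<^sup>2 * ((4 * \<theta>) ^ k0 / (1 - 4 * \<theta>)) < 1 / 8"
    unfolding eventually_sequentially by blast
  define M where "M = \<theta> powr (- q) / (1 - \<theta> powr (1 - q) * (decay ?d)\<^sup>2)"
  have M: "0 \<le> M" using \<theta> by (simp add: M_def)
  have "layered (\<theta> ^ k0) M W (\<lambda>x. level \<theta> (W x)) N" if W: "weak_bound q W N" for W :: "int ^ 'd \<Rightarrow> real" and N
    unfolding layered_def
  proof (intro allI impI conjI)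
    fix E and u :: "int ^ 'd \<Rightarrow> complex" assume E: "finite E \<and> (\<forall>x\<in>E. 0 < W x \<and> W x \<le> \<theta> ^ k0)"
    {
      assume u: "grad u \<in> ell2"
      have "(\<Sum>x\<in>E. W x * (cmod (u x - avg (level \<theta> (W x)) u x))\<^sup>2) \<le>
         (real ?d)\<^sup>2 * ((4 * \<theta>) ^ k0 / (1 - 4 * \<theta>)) * Q0 u"
        using E by (intro layer_smoothing_sum \<theta> u) auto
      also have "\<dots> \<le> 1 / 8 * Q0 u" using k0 Q0_nonneg[of u] by (intro mult_right_mono) auto
      finally show "(\<Sum>x\<in>E. W x * (cmod (u x - avg (level \<theta> (W x)) u x))\<^sup>2) \<le> Q0 u / 8" by simp
    }
    have "W x \<le> 1" if "x \<in> E" for x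
      using E that \<theta>(1) \<theta>1 by (metis order_trans power_le_one less_imp_le)
    then have "(\<Sum>x\<in>E. W x * ((decay ?d)\<^sup>2) ^ level \<theta> (W x)) \<le> M * N"
      unfolding M_def using E W \<theta>
      by (intro layer_weight_sum \<theta>1) (auto simp: weak_bound_def)
    then show "(\<Sum>x\<in>E. W x * (decay ?d ^ level \<theta> (W x))\<^sup>2) \<le> M * N"
      by (simp add: power_mult[symmetric] mult.commute[of 2])
  qed
  then show ?thesis using M \<theta>(1) by (intro exI[of _ "\<theta> ^ k0"]) auto
qed

context lattice_ge3
begin

lemma sobolev_pos: "sobolev CARD('d) > 0"
  unfolding sobolev_def using dim3 decay_less_1[OF dim3] by simp

text \<open>
  Bessel's inequality for the functional \<open>u \<mapsto> avg k u x\<close>. Its value at the combination with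
  coefficients \<open>cnj (avg k e x)\<close> is the sum in question, whose root is the norm of that combination.
\<close>
lemma Bessel_avg:
  assumes E: "H1.orthonormal E"
  shows "(\<Sum>e\<in>E. (cmod (avg k e x))\<^sup>2) \<le> (sobolev CARD('d) * decay CARD('d) ^ k)\<^sup>2"
proof -
  define c where "c = (\<lambda>e. cnj (avg k e x))"
  define u where "u = lincomb E c (\<lambda>e. e)"
  define S where "S = (\<Sum>e\<in>E. (cmod (avg k e x))\<^sup>2)"
  have S0: "0 \<le> S" by (simp add: S_def sum_nonneg)
  have "avg k u x = (\<Sum>e\<in>E. cnj (avg k e x) * avg k e x)"
    unfolding u_def avg_lincomb c_def ..
  also have "\<dots> = complex_of_real S"
    unfolding S_def of_real_sum by (intro sum.cong) (simp_all add: complex_norm_square mult.commute del: of_real_power)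
  finally have a: "cmod (avg k u x) = S" using S0 by simp
  have uH: "u \<in> H1" unfolding u_def using H1.orthonormalD(2)[OF E] by (intro H1.lincomb_in) auto
  have "(gnorm u)\<^sup>2 = S"
    using H1.nrm_sq_lincomb_orthonormal[OF E, of c] hnorm_Q0_inner[OF uH] by (simp add: u_def S_def c_def)
  then have g: "gnorm u = sqrt S" using uH by (metis ell2.nrm_nonneg grad_H1 real_sqrt_unique)
  have "S \<le> sobolev CARD('d) * decay CARD('d) ^ k * sqrt S"
    using avg_bound[OF uH, of k x] unfolding a g .
  then have "sqrt S * sqrt S \<le> sobolev CARD('d) * decay CARD('d) ^ k * sqrt S" using S0 by simp
  then have "sqrt S \<le> sobolev CARD('d) * decay CARD('d) ^ k"
  proof (cases "S = 0")
    case True then show ?thesis using sobolev_pos decay_pos[of "CARD('d)"] by simp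
  next
    case False
    then have "0 < sqrt S" using S0 by simp
    then show ?thesis using \<open>sqrt S * sqrt S \<le> _\<close> by (rule mult_right_le_imp_le[rotated])
  qed
  then have "(sqrt S)\<^sup>2 \<le> (sobolev CARD('d) * decay CARD('d) ^ k)\<^sup>2" using S0 by (intro power_mono) auto
  then show ?thesis using S0 by (simp add: S_def)
qed

lemma layered_sum_bound:
  fixes W :: "int ^ 'd \<Rightarrow> real"
  assumes L: "layered c M W lev N" and E: "finite E" "\<And>x. x \<in> E \<Longrightarrow> 0 < W x \<and> W x \<le> c" and u: "grad u \<in> ell2"
  shows "(\<Sum>x\<in>E. W x * (cmod (u x))\<^sup>2) \<le> Q0 u / 4 + 2 * (\<Sum>x\<in>E. W x * (cmod (avg (lev x) u x))\<^sup>2)"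
proof -
  have "(\<Sum>x\<in>E. W x * (cmod (u x))\<^sup>2) \<le>
      (\<Sum>x\<in>E. W x * (2 * (cmod (u x - avg (lev x) u x))\<^sup>2 + 2 * (cmod (avg (lev x) u x))\<^sup>2))"
    using cmod_sq_add_le[of "u x - avg (lev x) u x" "avg (lev x) u x" for x] E(2)
    by (intro sum_mono mult_left_mono) (auto intro: less_imp_le)
  also have "\<dots> = 2 * (\<Sum>x\<in>E. W x * (cmod (u x - avg (lev x) u x))\<^sup>2) + 2 * (\<Sum>x\<in>E. W x * (cmod (avg (lev x) u x))\<^sup>2)"
    by (simp add: sum_distrib_left sum.distrib[symmetric] algebra_simps)
  also have "(\<Sum>x\<in>E. W x * (cmod (u x - avg (lev x) u x))\<^sup>2) \<le> Q0 u / 8"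
    using L E u unfolding layered_def by blast
  finally show ?thesis by simp
qed

text \<open>
  The averaged part of the form is at least \<open>1/4\<close> at every member of the system, while its total
  over the system is bounded by the trace. The threshold \<open>3/4\<close> instead of \<open>1\<close> leaves room for
  cutting the infinite sum down to a finite set.
\<close>
lemma orthonormal_count_bound:
  fixes W :: "int ^ 'd \<Rightarrow> real"
  assumes W: "\<And>x. 0 \<le> W x" and L: "layered c M W lev N"
    and E: "H1.orthonormal E" and van: "\<And>e x. e \<in> E \<Longrightarrow> W x > c \<Longrightarrow> e x = 0"
    and big: "\<And>e. e \<in> E \<Longrightarrow> \<exists>X. finite X \<and> 3 / 4 \<le> (\<Sum>x\<in>X. W x * (cmod (e x))\<^sup>2)"
  shows "real (card E) \<le> 4 * (sobolev CARD('d))\<^sup>2 * M * N"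
proof -
  let ?A = "sobolev CARD('d)" and ?r = "decay CARD('d)"
  obtain X where X: "\<And>e. e \<in> E \<Longrightarrow> finite (X e) \<and> 3 / 4 \<le> (\<Sum>x\<in>X e. W x * (cmod (e x))\<^sup>2)"
    using big by metis
  define Y where "Y = {x \<in> \<Union>(X ` E). 0 < W x \<and> W x \<le> c}"
  have finE: "finite E" using H1.orthonormalD(1)[OF E] .
  have finU: "finite (\<Union>(X ` E))" using X finE by auto
  have Y: "finite Y" "\<And>x. x \<in> Y \<Longrightarrow> 0 < W x \<and> W x \<le> c"
    by (rule finite_subset[OF _ finU]) (auto simp: Y_def)
  have each: "1 / 4 \<le> (\<Sum>x\<in>Y. W x * (cmod (avg (lev x) e x))\<^sup>2)" if e: "e \<in> E" for e
  proof -
    have eH: "e \<in> H1" using H1.orthonormalD(2)[OF E e] .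
    have "gnorm e = 1" using H1.orthonormalD(3)[OF E e] hnorm_Q0_inner[OF eH] by simp
    then have "Q0 e = 1" using grad_H1[OF eH] by (simp add: gnorm_eq)
    have "3 / 4 \<le> (\<Sum>x\<in>X e. W x * (cmod (e x))\<^sup>2)" using X[OF e] by blast
    also have "\<dots> \<le> (\<Sum>x\<in>\<Union>(X ` E). W x * (cmod (e x))\<^sup>2)"
      using e W finU by (intro sum_mono2) auto
    also have "\<dots> = (\<Sum>x\<in>Y. W x * (cmod (e x))\<^sup>2)"
    proof -
      have "W x * (cmod (e x))\<^sup>2 = 0" if "\<not> (0 < W x \<and> W x \<le> c)" for x
      proof (cases "W x > c")
        case False
        then have "W x = 0" using that W[of x] by linarith
        then show ?thesis by simp
      qed (simp add: van[OF e])
      then show ?thesis using finU unfolding Y_def by (intro sum.mono_neutral_right) blast+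
    qed
    also have "\<dots> \<le> Q0 e / 4 + 2 * (\<Sum>x\<in>Y. W x * (cmod (avg (lev x) e x))\<^sup>2)"
      by (rule layered_sum_bound[OF L Y grad_H1[OF eH]])
    finally show ?thesis using \<open>Q0 e = 1\<close> by simp
  qed
  have "real (card E) / 4 = (\<Sum>e\<in>E. 1 / 4)" by simp
  also have "\<dots> \<le> (\<Sum>e\<in>E. \<Sum>x\<in>Y. W x * (cmod (avg (lev x) e x))\<^sup>2)" by (intro sum_mono each)
  also have "\<dots> = (\<Sum>x\<in>Y. W x * (\<Sum>e\<in>E. (cmod (avg (lev x) e x))\<^sup>2))"
    by (subst sum.swap) (simp add: sum_distrib_left)
  also have "\<dots> \<le> (\<Sum>x\<in>Y. W x * (?A * ?r ^ lev x)\<^sup>2)"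
    using W by (intro sum_mono mult_left_mono Bessel_avg E) auto
  also have "\<dots> = ?A\<^sup>2 * (\<Sum>x\<in>Y. W x * (?r ^ lev x)\<^sup>2)"
    by (simp add: sum_distrib_left power_mult_distrib mult_ac)
  also have "\<dots> \<le> ?A\<^sup>2 * (M * N)"
    using L Y unfolding layered_def by (intro mult_left_mono) auto
  finally show ?thesis by simp
qed

text \<open>
  A maximal orthonormal system among the combinations that vanish where \<open>W > c\<close> is small by the
  trace bound. Were \<open>I\<close> larger than its size plus the number of those points, one more
  member could be found.
\<close>
lemma dimension_bound:
  fixes W :: "int ^ 'd \<Rightarrow> real"
  assumes W: "weak_bound q W N" and c: "c > 0" and M: "M \<ge> 0" and L: "layered c M W lev N"
    and I: "finite I" "\<And>i. i \<in> I \<Longrightarrow> v i \<in> H1"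
    and pos: "\<And>a. \<exists>i\<in>I. a i \<noteq> 0 \<Longrightarrow> lincomb I a v \<noteq> 0 \<and>
        (\<lambda>x. W x * (cmod (lincomb I a v x))\<^sup>2) summable_on UNIV \<and> Q0 (lincomb I a v) \<le> b_form W (lincomb I a v)"
  shows "real (card I) \<le> (c powr (- q) + 4 * (sobolev CARD('d))\<^sup>2 * M) * N"
proof -
  define F where "F = {x. W x > c}"
  have F: "finite F" "real (card F) \<le> N * c powr (- q)" and W0: "\<And>x. 0 \<le> W x"
    using W c by (auto simp: weak_bound_def F_def)
  let ?B = "4 * (sobolev CARD('d))\<^sup>2 * M * N"
  define P where "P E \<longleftrightarrow> H1.orthonormal E \<and>
     (\<forall>e\<in>E. \<exists>a. (\<exists>i\<in>I. a i \<noteq> 0) \<and> e = lincomb I a v \<and> (\<forall>x\<in>F. e x = 0))" for E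
  have bound: "real (card E) \<le> ?B" if PE: "P E" for E
  proof (rule orthonormal_count_bound[OF W0 L])
    show oE: "H1.orthonormal E" using PE by (simp add: P_def)
    show "e x = 0" if "e \<in> E" "W x > c" for e x using PE that by (auto simp: P_def F_def)
    fix e assume e: "e \<in> E"
    then obtain a where a: "\<exists>i\<in>I. a i \<noteq> 0" "e = lincomb I a v" using PE unfolding P_def by blast
    have eH: "e \<in> H1" using H1.orthonormalD(2)[OF oE e] .
    have "gnorm e = 1" using H1.orthonormalD(3)[OF oE e] hnorm_Q0_inner[OF eH] by simp
    then have "Q0 e = 1" using grad_H1[OF eH] by (simp add: gnorm_eq)
    then have s: "(\<lambda>x. W x * (cmod (e x))\<^sup>2) summable_on UNIV" "3 / 4 < b_form W e"
      using pos[OF a(1)] a(2) by auto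
    show "\<exists>X. finite X \<and> 3 / 4 \<le> (\<Sum>x\<in>X. W x * (cmod (e x))\<^sup>2)"
    proof (rule ccontr)
      assume "\<not> ?thesis"
      then have "b_form W e \<le> 3 / 4" unfolding b_form_def
        by (intro infsum_le_finite_sums s) (meson linorder_le_cases)
      then show False using s by simp
    qed
  qed
  have bound': "\<forall>E. P E \<longrightarrow> card E < Suc (nat \<lceil>?B\<rceil>)" 
  proof (intro allI impI)
    fix E assume "P E"
    from bound[OF this] show "card E < Suc (nat \<lceil>?B\<rceil>)" by linarith
  qed
  have "P {}" by (simp add: P_def)
  from ex_has_greatest_nat[of P, OF this bound']
  obtain E where E: "P E" "\<And>E'. P E' \<Longrightarrow> card E' \<le> card E" by auto
  have oE: "H1.orthonormal E" using E by (simp add: P_def)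
  have "card I \<le> card F + card E"
  proof (rule ccontr)
    assume neg: "\<not> card I \<le> card F + card E"
    \<comment> \<open>the conditions are vanishing at the points of \<open>F\<close> and orthogonality to \<open>E\<close>\<close>
    let ?J = "Inl ` F \<union> Inr ` E"
    let ?a = "\<lambda>j i. case j of Inl x \<Rightarrow> v i x | Inr e \<Rightarrow> Q0_inner (v i) e"
    have fJ: "finite ?J" using F H1.orthonormalD(1)[OF oE] by simp
    have "card ?J = card F + card E"
      using F H1.orthonormalD(1)[OF oE] by (subst card_Un_disjoint) (auto simp: card_image)
    then have cJ: "card ?J < card I" using neg by simp
    have nz: "lincomb I a v \<noteq> 0" if "\<exists>i\<in>I. a i \<noteq> 0" for a using pos[OF that] by simp
    have "\<exists>a. (\<exists>i\<in>I. a i \<noteq> 0) \<and> hnorm Q0_inner (lincomb I a v) = 1 \<and>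
        (\<forall>j\<in>?J. (\<Sum>i\<in>I. a i * ?a j i) = 0)"
      by (rule H1.unit_vector_in_kernel[where a = ?a, OF I(1) _ _ fJ cJ]) (fact I(2), fact nz)
    then obtain a where a: "\<exists>i\<in>I. a i \<noteq> 0" "hnorm Q0_inner (lincomb I a v) = 1"
        "\<forall>j\<in>?J. (\<Sum>i\<in>I. a i * ?a j i) = 0" by (elim exE conjE)
    define w where "w = lincomb I a v"
    have wH: "w \<in> H1" unfolding w_def using I by (intro H1.lincomb_in) auto
    have wF: "w x = 0" if "x \<in> F" for x
      using a(3)[rule_format, of "Inl x"] that by (simp add: w_def lincomb_apply)
    have wE: "Q0_inner w e = 0" if "e \<in> E" for e
      using a(3)[rule_format, of "Inr e"] that I H1.orthonormalD(2)[OF oE that]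
      by (simp add: w_def H1.ip_lincomb_left)
    have "P (insert w E)"
      using E(1) H1.orthonormal_insert(1)[OF oE wH _ wE] a w_def wF unfolding P_def by auto
    moreover have "card (insert w E) = Suc (card E)"
      using H1.orthonormal_insert(2)[OF oE wH _ wE] a w_def by simp
    ultimately show False using E(2) by fastforce
  qed
  then have "real (card I) \<le> real (card F) + real (card E)" by linarith
  also have "\<dots> \<le> N * c powr (- q) + ?B" using F bound[OF E(1)] by linarith
  finally show ?thesis by (simp add: algebra_simps)
qed

text \<open>
  The trace weights have bounded finite sums, hence a small tail; outside a finite set the averaged
  part of the form is therefore as harmless as the smoothing error.
\<close>
lemma tail_bound:
  fixes W :: "int ^ 'd \<Rightarrow> real"
  assumes W: "weak_bound q W N" and c: "c > 0" and L: "layered c M W lev N"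
  shows "\<exists>F. finite F \<and> (\<forall>u\<in>H1. \<forall>E. finite E \<and> E \<inter> F = {} \<longrightarrow> (\<Sum>x\<in>E. W x * (cmod (u x))\<^sup>2) \<le> Q0 u)"
proof -
  let ?A = "sobolev CARD('d)" and ?r = "decay CARD('d)"
  define X where "X = {x. 0 < W x \<and> W x \<le> c}"
  have W0: "\<And>x. 0 \<le> W x" using W by (simp add: weak_bound_def)
  have A: "?A > 0" by (rule sobolev_pos)
  have "\<exists>F. finite F \<and> F \<subseteq> X \<and> (\<forall>E. finite E \<and> E \<subseteq> X - F \<longrightarrow> (\<Sum>x\<in>E. W x * (?r ^ lev x)\<^sup>2) \<le> 1 / (4 * ?A\<^sup>2))"
  proof (rule bounded_finite_sums_tail)
    show "(\<Sum>x\<in>E. W x * (?r ^ lev x)\<^sup>2) \<le> M * N" if "finite E" "E \<subseteq> X" for E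
    proof -
      have "\<forall>x\<in>E. 0 < W x \<and> W x \<le> c" using that by (auto simp: X_def)
      then show ?thesis using L that(1) unfolding layered_def by blast
    qed
  qed (use A in simp)
  then obtain F where F0: "finite F \<and> F \<subseteq> X \<and>
    (\<forall>E. finite E \<and> E \<subseteq> X - F \<longrightarrow> (\<Sum>x\<in>E. W x * (?r ^ lev x)\<^sup>2) \<le> 1 / (4 * ?A\<^sup>2))"
    by (rule exE)
  note F = F0[THEN conjunct1] F0[THEN conjunct2, THEN conjunct1]
    F0[THEN conjunct2, THEN conjunct2, rule_format, OF conjI]
  have fc: "finite {x. W x > c}" using W c by (simp add: weak_bound_def)
  have "(\<Sum>x\<in>E. W x * (cmod (u x))\<^sup>2) \<le> Q0 u"
    if u: "u \<in> H1" and E: "finite E" "E \<inter> (F \<union> {x. W x > c}) = {}" for u E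
  proof -
    define Y where "Y = {x\<in>E. 0 < W x}"
    have Y: "finite Y" "Y \<subseteq> X - F" "\<And>x. x \<in> Y \<Longrightarrow> 0 < W x \<and> W x \<le> c"
      using E by (auto simp: Y_def X_def not_less)
    have g: "grad u \<in> ell2" using u by (rule grad_H1)
    have "(\<Sum>x\<in>E. W x * (cmod (u x))\<^sup>2) = (\<Sum>x\<in>Y. W x * (cmod (u x))\<^sup>2)"
      using E(1) W0 unfolding Y_def by (intro sum.mono_neutral_right) (auto simp: less_le)
    also have "\<dots> \<le> Q0 u / 4 + 2 * (\<Sum>x\<in>Y. W x * (cmod (avg (lev x) u x))\<^sup>2)"
      by (rule layered_sum_bound[OF L Y(1,3) g])
    also have "(\<Sum>x\<in>Y. W x * (cmod (avg (lev x) u x))\<^sup>2) \<le> (\<Sum>x\<in>Y. W x * (?A * ?r ^ lev x * gnorm u)\<^sup>2)"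
      using W0 avg_bound[OF u] by (intro sum_mono mult_left_mono power_mono) auto
    also have "\<dots> = (\<Sum>x\<in>Y. W x * (?r ^ lev x)\<^sup>2) * (?A\<^sup>2 * Q0 u)"
      unfolding sum_distrib_right
      by (intro sum.cong) (simp_all add: power_mult_distrib gnorm_eq[OF g] Q0_nonneg mult_ac)
    also have "\<dots> \<le> 1 / (4 * ?A\<^sup>2) * (?A\<^sup>2 * Q0 u)"
      using Q0_nonneg[of u] by (intro mult_right_mono F(3) Y) auto
    also have "\<dots> = Q0 u / 4" using A by simp
    finally show ?thesis using Q0_nonneg[of u] by simp
  qed
  then show ?thesis using F fc by (intro exI[of _ "F \<union> {x. W x > c}"]) auto
qed

end

section \<open>The Birman--Schwinger operator\<close>

text \<open>
  The map \<open>u \<mapsto> V\<^sup>1\<^sup>/\<^sup>2 u\<close> turns the form of \<open>V\<close> into the \<open>\<ell>\<^sub>2\<close> inner product.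
\<close>
definition weighted :: "('x \<Rightarrow> real) \<Rightarrow> ('x \<Rightarrow> complex) \<Rightarrow> 'x \<Rightarrow> complex" where
  "weighted V u = (\<lambda>x. complex_of_real (sqrt (V x)) * u x)"

lemma weighted_add: "weighted V (u + v) = weighted V u + weighted V v" by (auto simp: weighted_def fun_eq_iff algebra_simps)
lemma weighted_scale: "weighted V (cscale c u) = cscale c (weighted V u)" by (auto simp: weighted_def fun_eq_iff algebra_simps)

lemma cmod_weighted_sq: "0 \<le> V x \<Longrightarrow> (cmod (weighted V u x))\<^sup>2 = V x * (cmod (u x))\<^sup>2"
  by (simp add: weighted_def norm_mult power_mult_distrib)

lemma b_form_eq: "(\<And>x. 0 \<le> V x) \<Longrightarrow> b_form V u = sqsum (weighted V u)"
  by (simp add: b_form_def sqsum_def cmod_weighted_sq)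

lemma b_sesq_eq: "(\<And>x. 0 \<le> V x) \<Longrightarrow> b_sesq V u v = ip2 (weighted V u) (weighted V v)"
proof -
  assume V: "\<And>x. 0 \<le> V x"
  have "complex_of_real (V x) = complex_of_real (sqrt (V x)) * complex_of_real (sqrt (V x))" for x
    using V[of x] by (simp add: of_real_mult[symmetric] del: of_real_mult)
  then have "complex_of_real (V x) * u x * cnj (v x) = weighted V u x * cnj (weighted V v x)" for x
    by (simp add: weighted_def mult_ac)
  then show ?thesis by (simp add: b_sesq_def ip2_def)
qed

text \<open>
  The decay of the potential that makes \<open>B\<^sub>V\<close> compact, expressed by its form.
\<close>
locale tail_potential = lattice_ge3 dim for dim :: "'d::finite itself" +
  fixes V :: "int ^ 'd \<Rightarrow> real"
  assumes V0: "\<And>x. 0 \<le> V x"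
    and finite_above: "\<And>t. t > 0 \<Longrightarrow> finite {x. V x > t}"
    and tail: "\<And>e. e > 0 \<Longrightarrow> \<exists>F. finite F \<and>
      (\<forall>u\<in>H1. \<forall>E. finite E \<and> E \<inter> F = {} \<longrightarrow> (\<Sum>x\<in>E. V x * (cmod (u x))\<^sup>2) \<le> e * Q0 u)"
begin

lemma Q0_eq_nrm: "u \<in> H1 \<Longrightarrow> Q0 u = (hnorm Q0_inner u)\<^sup>2" for u :: "int ^ 'd \<Rightarrow> complex"
  by (simp add: hnorm_Q0_inner gnorm_eq grad_H1 Q0_nonneg)

lemma weighted_split_bound:
  assumes e: "e > 0"
  shows "\<exists>F. finite F \<and> (\<forall>u\<in>H1. weighted V u \<in> ell2 \<and>
     sqsum (weighted V u) \<le> (\<Sum>x\<in>F. V x) * (\<Sum>x\<in>F. (cmod (u x))\<^sup>2) + e * Q0 u)"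
proof -
  obtain F where F: "finite F"
    "\<And>u E. u \<in> H1 \<Longrightarrow> finite E \<and> E \<inter> F = {} \<Longrightarrow> (\<Sum>x\<in>E. V x * (cmod (u x))\<^sup>2) \<le> e * Q0 u"
    using tail[OF e] by blast
  have "weighted V u \<in> ell2 \<and> sqsum (weighted V u) \<le> (\<Sum>x\<in>F. V x) * (\<Sum>x\<in>F. (cmod (u x))\<^sup>2) + e * Q0 u"
    if u: "u \<in> H1" for u
  proof -
    have "(\<Sum>x\<in>E. (cmod (weighted V u x))\<^sup>2) \<le> (\<Sum>x\<in>F. V x) * (\<Sum>x\<in>F. (cmod (u x))\<^sup>2) + e * Q0 u"
      if E: "finite E" for E
    proof -
      have "(\<Sum>x\<in>E. (cmod (weighted V u x))\<^sup>2) = (\<Sum>x\<in>E \<inter> F. V x * (cmod (u x))\<^sup>2) + (\<Sum>x\<in>E - F. V x * (cmod (u x))\<^sup>2)"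
        using E by (simp add: cmod_weighted_sq V0 sum.Int_Diff[of E _ F])
      also have "\<dots> \<le> (\<Sum>x\<in>F. V x) * (\<Sum>x\<in>F. (cmod (u x))\<^sup>2) + e * Q0 u"
      proof (intro add_mono F(2)[OF u])
        have "(\<Sum>x\<in>E \<inter> F. V x * (cmod (u x))\<^sup>2) \<le> (\<Sum>x\<in>F. V x * (cmod (u x))\<^sup>2)"
          using F(1) V0 by (intro sum_mono2) auto
        also have "\<dots> \<le> (\<Sum>x\<in>F. (\<Sum>y\<in>F. V y) * (cmod (u x))\<^sup>2)"
          using F(1) V0 by (intro sum_mono mult_right_mono member_le_sum) auto
        finally show "(\<Sum>x\<in>E \<inter> F. V x * (cmod (u x))\<^sup>2) \<le> (\<Sum>x\<in>F. V x) * (\<Sum>x\<in>F. (cmod (u x))\<^sup>2)"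
          by (simp add: sum_distrib_left)
      qed (use E in auto)
      finally show ?thesis .
    qed
    then show ?thesis using ell2_if_bounded by blast
  qed
  then show ?thesis using F(1) by blast
qed

lemma form_bound: "\<exists>K\<ge>0. \<forall>u\<in>H1. weighted V u \<in> ell2 \<and> sqsum (weighted V u) \<le> K * Q0 u"
proof -
  obtain F where F: "finite F" "\<And>u. u \<in> H1 \<Longrightarrow> weighted V u \<in> ell2 \<and>
     sqsum (weighted V u) \<le> (\<Sum>x\<in>F. V x) * (\<Sum>x\<in>F. (cmod (u x))\<^sup>2) + 1 * Q0 u"
    using weighted_split_bound[of 1] by auto
  let ?K = "(\<Sum>x\<in>F. V x) * (card F * (sobolev CARD('d))\<^sup>2) + 1"
  have S: "0 \<le> (\<Sum>x\<in>F. V x)" using V0 by (intro sum_nonneg) auto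
  have "sqsum (weighted V u) \<le> ?K * Q0 u" if u: "u \<in> H1" for u
  proof -
    have "(\<Sum>x\<in>F. (cmod (u x))\<^sup>2) \<le> (\<Sum>x\<in>F. (sobolev CARD('d) * gnorm u)\<^sup>2)"
      using point_evaluation_bound[OF u] by (intro sum_mono power_mono) auto
    also have "\<dots> = card F * (sobolev CARD('d))\<^sup>2 * Q0 u"
      by (simp add: power_mult_distrib gnorm_eq grad_H1[OF u] Q0_nonneg)
    finally have "(\<Sum>x\<in>F. V x) * (\<Sum>x\<in>F. (cmod (u x))\<^sup>2) \<le> (\<Sum>x\<in>F. V x) * (card F * (sobolev CARD('d))\<^sup>2 * Q0 u)"
      using S by (rule mult_left_mono)
    then show ?thesis using F(2)[OF u] by (simp add: algebra_simps)
  qed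
  then show ?thesis using F(2) S by (intro exI[of _ ?K]) auto
qed

lemma weighted_ell2: "u \<in> H1 \<Longrightarrow> weighted V u \<in> ell2"
  using form_bound by blast

lemma b_form_bounded_potential: "b_form_bounded V"
proof -
  obtain K where K: "\<And>u. u \<in> H1 \<Longrightarrow> weighted V u \<in> ell2 \<and> sqsum (weighted V u) \<le> K * Q0 u" using form_bound by blast
  show ?thesis unfolding b_form_bounded_def
  proof (intro exI[of _ K] ballI conjI)
    fix u :: "int ^ 'd \<Rightarrow> complex" assume u: "u \<in> H1"
    have "weighted V u \<in> ell2" using K[OF u] by blast
    then show "(\<lambda>x. V x * (cmod (u x))\<^sup>2) summable_on UNIV"
      using ell2_summable[of "weighted V u"] by (simp add: cmod_weighted_sq V0)
    show "\<bar>b_form V u\<bar> \<le> K * Q0 u"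
      using K[OF u] sqsum_nonneg[of "weighted V u"] by (simp add: b_form_eq V0)
  qed
qed

lemma birman_schwinger_ex1:
  assumes u: "u \<in> H1"
  shows "\<exists>!w. w \<in> H1 \<and> (\<forall>v\<in>H1. Q0_inner w v = b_sesq V u v)"
proof -
  obtain K where K: "K \<ge> 0" "\<And>u. u \<in> H1 \<Longrightarrow> weighted V u \<in> ell2 \<and> sqsum (weighted V u) \<le> K * Q0 u" using form_bound by blast
  have "\<exists>w\<in>H1. \<forall>v\<in>H1. b_sesq V v u = Q0_inner v w"
  proof (rule H1.Riesz_representation)
    fix v w :: "int ^ 'd \<Rightarrow> complex" and c assume v: "v \<in> H1"
    show "w \<in> H1 \<Longrightarrow> b_sesq V (v + w) u = b_sesq V v u + b_sesq V w u"
      using u v by (simp add: b_sesq_eq V0 weighted_add ell2.ip_add_left weighted_ell2)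
    show "b_sesq V (cscale c v) u = c * b_sesq V v u"
      using u v by (simp add: b_sesq_eq V0 weighted_scale ell2.ip_scale_left weighted_ell2)
    have "cmod (b_sesq V v u) \<le> sqrt (sqsum (weighted V v)) * sqrt (sqsum (weighted V u))"
      using u v by (simp add: b_sesq_eq V0 ip2_complex_Cauchy_Schwarz weighted_ell2)
    also have "\<dots> \<le> sqrt (K * Q0 v) * sqrt (sqsum (weighted V u))"
      using K(2)[OF v] by (intro mult_right_mono) (auto simp: sqsum_nonneg)
    also have "\<dots> = sqrt K * sqrt (sqsum (weighted V u)) * hnorm Q0_inner v"
      using v by (simp add: real_sqrt_mult Q0_eq_nrm)
    finally show "cmod (b_sesq V v u) \<le> sqrt K * sqrt (sqsum (weighted V u)) * hnorm Q0_inner v" .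
  qed
  then obtain w where w: "w \<in> H1" "\<And>v. v \<in> H1 \<Longrightarrow> b_sesq V v u = Q0_inner v w" by blast
  have w2: "Q0_inner w v = b_sesq V u v" if v: "v \<in> H1" for v
  proof -
    have "Q0_inner w v = cnj (b_sesq V v u)" using H1.ip_cnj[OF v w(1)] w(2)[OF v] by simp
    also have "\<dots> = b_sesq V u v"
      using ell2.ip_cnj[OF weighted_ell2[OF v] weighted_ell2[OF u]] by (simp add: b_sesq_eq V0)
    finally show ?thesis .
  qed
  show ?thesis
  proof (rule ex1I[of _ w])
    show "w \<in> H1 \<and> (\<forall>v\<in>H1. Q0_inner w v = b_sesq V u v)" using w w2 by blast
    show "z = w" if "z \<in> H1 \<and> (\<forall>v\<in>H1. Q0_inner z v = b_sesq V u v)" for z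
      using that w w2 by (intro H1.eq_if_ip_eq) auto
  qed
qed

lemma birman_schwinger:
  assumes "u \<in> H1"
  shows "birman_schwinger V u \<in> H1"
    "v \<in> H1 \<Longrightarrow> Q0_inner (birman_schwinger V u) v = b_sesq V u v"
  using theI'[OF birman_schwinger_ex1[OF assms]] unfolding birman_schwinger_def by blast+

lemma birman_schwinger_form: "u \<in> H1 \<Longrightarrow> Re (Q0_inner (birman_schwinger V u) u) = b_form V u"
  by (simp add: birman_schwinger b_sesq_eq b_form_eq V0 ip2_self weighted_ell2)

lemma birman_schwinger_linear: "linear_op H1 (birman_schwinger V)"
  unfolding linear_op_def
proof (intro conjI ballI allI)
  show "birman_schwinger V u \<in> H1" if "u \<in> H1" for u using birman_schwinger(1)[OF that] .
next
  fix u v :: "int ^ 'd \<Rightarrow> complex" assume uv: "u \<in> H1" "v \<in> H1"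
  then have s: "u + v \<in> H1" by (rule H1_add)
  show "birman_schwinger V (u + v) = birman_schwinger V u + birman_schwinger V v"
  proof (rule H1.eq_if_ip_eq)
    fix w :: "int ^ 'd \<Rightarrow> complex" assume w: "w \<in> H1"
    have "Q0_inner (birman_schwinger V u + birman_schwinger V v) w = b_sesq V u w + b_sesq V v w"
      using uv w by (simp add: H1.ip_add_left birman_schwinger)
    also have "\<dots> = b_sesq V (u + v) w"
      using uv w by (simp add: b_sesq_eq V0 weighted_add ell2.ip_add_left weighted_ell2)
    finally show "Q0_inner (birman_schwinger V (u + v)) w = Q0_inner (birman_schwinger V u + birman_schwinger V v) w"
      using birman_schwinger(2)[OF s w] by simp
  qed (use uv s in \<open>auto intro: birman_schwinger H1_add\<close>)
next
  fix c and u :: "int ^ 'd \<Rightarrow> complex" assume u: "u \<in> H1"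
  then have s: "cscale c u \<in> H1" by (rule H1_scale)
  show "birman_schwinger V (cscale c u) = cscale c (birman_schwinger V u)"
  proof (rule H1.eq_if_ip_eq)
    fix w :: "int ^ 'd \<Rightarrow> complex" assume w: "w \<in> H1"
    have "Q0_inner (cscale c (birman_schwinger V u)) w = c * b_sesq V u w"
      using u w by (simp add: H1.ip_scale_left birman_schwinger)
    also have "\<dots> = b_sesq V (cscale c u) w"
      using u w by (simp add: b_sesq_eq V0 weighted_scale ell2.ip_scale_left weighted_ell2)
    finally show "Q0_inner (birman_schwinger V (cscale c u)) w = Q0_inner (cscale c (birman_schwinger V u)) w"
      using birman_schwinger(2)[OF s w] by simp
  qed (use u s in \<open>auto intro: birman_schwinger H1_scale\<close>)
qed

text \<open>
  Since \<open>\<parallel>B\<^sub>V u\<parallel>\<^sup>2 = b\<^sub>V(u, B\<^sub>V u)\<close>, the Cauchy--Schwarz inequality for the form and its boundedness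
  control \<open>B\<^sub>V u\<close> by \<open>b\<^sub>V[u]\<close>. This transfers compactness from the form to the operator.
\<close>
lemma birman_schwinger_norm_bound:
  "\<exists>K\<ge>0. \<forall>u\<in>H1. (hnorm Q0_inner (birman_schwinger V u))\<^sup>2 \<le> K * sqsum (weighted V u) \<and>
      sqsum (weighted V u) \<le> K * Q0 u"
proof -
  obtain K where K: "K \<ge> 0" "\<And>u. u \<in> H1 \<Longrightarrow> weighted V u \<in> ell2 \<and> sqsum (weighted V u) \<le> K * Q0 u" using form_bound by blast
  have "(hnorm Q0_inner (birman_schwinger V u))\<^sup>2 \<le> K * sqsum (weighted V u)" if u: "u \<in> H1" for u
  proof -
    let ?w = "birman_schwinger V u"
    have w: "?w \<in> H1" using birman_schwinger(1)[OF u] .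
    have "(hnorm Q0_inner ?w)\<^sup>2 = Re (ip2 (weighted V u) (weighted V ?w))"
      using birman_schwinger(2)[OF u w] by (simp add: H1.nrm_sq w b_sesq_eq V0)
    also have "\<dots> \<le> sqrt (sqsum (weighted V u)) * sqrt (sqsum (weighted V ?w))"
      using ip2_complex_Cauchy_Schwarz[OF weighted_ell2[OF u] weighted_ell2[OF w]] complex_Re_le_cmod order_trans by blast
    also have "\<dots> \<le> sqrt (sqsum (weighted V u)) * sqrt (K * Q0 ?w)"
      using K(2)[OF w] by (intro mult_left_mono) (auto simp: sqsum_nonneg)
    also have "\<dots> = sqrt (K * sqsum (weighted V u)) * hnorm Q0_inner ?w"
      using w by (simp add: real_sqrt_mult Q0_eq_nrm)
    finally have "hnorm Q0_inner ?w * hnorm Q0_inner ?w \<le> sqrt (K * sqsum (weighted V u)) * hnorm Q0_inner ?w"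
      by (simp add: power2_eq_square)
    then have "hnorm Q0_inner ?w \<le> sqrt (K * sqsum (weighted V u))"
    proof (cases "hnorm Q0_inner ?w = 0")
      case True then show ?thesis using K(1) sqsum_nonneg[of "weighted V u"] by simp
    next
      case False
      then have "0 < hnorm Q0_inner ?w" using H1.nrm_nonneg[OF w] by linarith
      then show ?thesis using \<open>hnorm Q0_inner ?w * _ \<le> _\<close> by (rule mult_right_le_imp_le[rotated])
    qed
    then have "(hnorm Q0_inner ?w)\<^sup>2 \<le> (sqrt (K * sqsum (weighted V u)))\<^sup>2" using w by (intro power_mono) auto
    then show ?thesis using K(1) sqsum_nonneg[of "weighted V u"] by simp
  qed
  then show ?thesis using K by blast
qed

lemma birman_schwinger_bounded: "\<exists>C. \<forall>u\<in>H1. hnorm Q0_inner (birman_schwinger V u) \<le> C * hnorm Q0_inner u"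
proof -
  obtain K where K: "K \<ge> 0" "\<And>u. u \<in> H1 \<Longrightarrow> (hnorm Q0_inner (birman_schwinger V u))\<^sup>2 \<le> K * sqsum (weighted V u) \<and>
      sqsum (weighted V u) \<le> K * Q0 u" using birman_schwinger_norm_bound by blast
  have "hnorm Q0_inner (birman_schwinger V u) \<le> K * hnorm Q0_inner u" if u: "u \<in> H1" for u
  proof (rule power2_le_imp_le)
    have "(hnorm Q0_inner (birman_schwinger V u))\<^sup>2 \<le> K * (K * Q0 u)"
      using K(2)[OF u] K(1) by (meson mult_left_mono order_trans)
    then show "(hnorm Q0_inner (birman_schwinger V u))\<^sup>2 \<le> (K * hnorm Q0_inner u)\<^sup>2"
      by (simp add: Q0_eq_nrm[OF u] power_mult_distrib power2_eq_square mult_ac)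
  qed (use K u in simp)
  then show ?thesis by blast
qed

lemma birman_schwinger_nonneg_selfadjoint: "nonneg_selfadjoint_op H1 Q0_inner (birman_schwinger V)"
  unfolding nonneg_selfadjoint_op_def bounded_op_def
proof (intro conjI ballI)
  show "linear_op H1 (birman_schwinger V)" by (rule birman_schwinger_linear)
  show "\<exists>C. \<forall>u\<in>H1. hnorm Q0_inner (birman_schwinger V u) \<le> C * hnorm Q0_inner u"
    by (rule birman_schwinger_bounded)
  fix u v :: "int ^ 'd \<Rightarrow> complex" assume u: "u \<in> H1"
  show "0 \<le> Re (Q0_inner (birman_schwinger V u) u)"
    using u by (simp add: birman_schwinger_form b_form_eq V0 sqsum_nonneg)
  assume v: "v \<in> H1"
  have "Q0_inner u (birman_schwinger V v) = cnj (b_sesq V v u)"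
    using H1.ip_cnj[OF birman_schwinger(1)[OF v] u] birman_schwinger(2)[OF v u] by simp
  also have "\<dots> = b_sesq V u v"
    using ell2.ip_cnj[OF weighted_ell2[OF v] weighted_ell2[OF u]] by (simp add: b_sesq_eq V0)
  finally show "Q0_inner (birman_schwinger V u) v = Q0_inner u (birman_schwinger V v)"
    using birman_schwinger(2)[OF u v] by simp
qed

lemma birman_schwinger_compact: "compact_op H1 Q0_inner (birman_schwinger V)"
proof (rule H1.compact_opI)
  show "countable (UNIV :: (int ^ 'd) set)" by simp
  show "linear_op H1 (birman_schwinger V)" by (rule birman_schwinger_linear)
  show "cmod (u x) \<le> sobolev CARD('d) * hnorm Q0_inner u" if "u \<in> H1" for u :: "int ^ 'd \<Rightarrow> complex" and x
    using point_evaluation_bound[OF that] by (simp add: hnorm_Q0_inner that)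
  fix e :: real assume e: "e > 0"
  obtain K where K: "K \<ge> 0" "\<And>u. u \<in> H1 \<Longrightarrow> (hnorm Q0_inner (birman_schwinger V u))\<^sup>2 \<le> K * sqsum (weighted V u) \<and>
      sqsum (weighted V u) \<le> K * Q0 u" using birman_schwinger_norm_bound by blast
  have e': "e / (K + 1) > 0" using e K by simp
  obtain F where F: "finite F" "\<And>u. u \<in> H1 \<Longrightarrow>
     sqsum (weighted V u) \<le> (\<Sum>x\<in>F. V x) * (\<Sum>x\<in>F. (cmod (u x))\<^sup>2) + e / (K + 1) * Q0 u"
    using weighted_split_bound[OF e'] by blast
  have S: "0 \<le> (\<Sum>x\<in>F. V x)" using V0 by (intro sum_nonneg) auto
  have "(hnorm Q0_inner (birman_schwinger V u))\<^sup>2 \<le>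
      K * (\<Sum>x\<in>F. V x) * (\<Sum>x\<in>F. (cmod (u x))\<^sup>2) + e * (hnorm Q0_inner u)\<^sup>2" if u: "u \<in> H1" for u
  proof -
    have "(hnorm Q0_inner (birman_schwinger V u))\<^sup>2 \<le>
        K * ((\<Sum>x\<in>F. V x) * (\<Sum>x\<in>F. (cmod (u x))\<^sup>2) + e / (K + 1) * Q0 u)"
      using K(2)[OF u] F(2)[OF u] K(1) by (meson mult_left_mono order_trans)
    also have "\<dots> = K * (\<Sum>x\<in>F. V x) * (\<Sum>x\<in>F. (cmod (u x))\<^sup>2) + (K / (K + 1)) * (e * Q0 u)"
      by (simp add: distrib_left)
    also have "(K / (K + 1)) * (e * Q0 u) \<le> 1 * (e * Q0 u)"
      using K(1) e Q0_nonneg[of u] by (intro mult_right_mono) auto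
    finally show ?thesis by (simp add: Q0_eq_nrm[OF u])
  qed
  then show "\<exists>F D. finite F \<and> 0 \<le> D \<and> (\<forall>u\<in>H1. (hnorm Q0_inner (birman_schwinger V u))\<^sup>2
      \<le> D * (\<Sum>x\<in>F. (cmod (u x))\<^sup>2) + e * (hnorm Q0_inner u)\<^sup>2)"
    using F(1) K(1) S by (intro exI[of _ F] exI[of _ "K * (\<Sum>x\<in>F. V x)"]) auto
qed

end

section \<open>The Schroedinger operator and the Birman--Schwinger principle\<close>

text \<open>
  Summation by parts, one coordinate direction at a time, by translation invariance of the inner
  product.
\<close>
lemma laplacian_ell2:
  fixes u :: "int ^ 'd::finite \<Rightarrow> complex"
  assumes u: "u \<in> ell2"
  shows "laplacian u \<in> ell2" "hnorm ip2 (laplacian u) \<le> 4 * CARD('d) * hnorm ip2 u"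
    "v \<in> ell2 \<Longrightarrow> ip2 (laplacian u) v = - Q0_inner u v"
proof -
  define w where "w j = ((\<lambda>x. u (x + axis j 1)) - u) + ((\<lambda>x. u (x + - axis j 1)) - u)" for j :: 'd
  have tr: "(\<lambda>x. u (x + y)) \<in> ell2" "hnorm ip2 (\<lambda>x. u (x + y)) = hnorm ip2 u" for y
    using u ell2_translate[OF u, of y] by (auto simp: hnorm_ip2 sqsum_translate)
  have lap: "laplacian u = sum w UNIV"
    by (auto simp: laplacian_def fun_eq_iff sum_fun_apply w_def intro!: sum.cong)
  have wj: "w j \<in> ell2" "hnorm ip2 (w j) \<le> 4 * hnorm ip2 u" for j
  proof -
    show "w j \<in> ell2" unfolding w_def by (intro ell2_add ell2_diff tr u)
    have tri: "hnorm ip2 (w j) \<le> hnorm ip2 ((\<lambda>x. u (x + axis j 1)) - u) + hnorm ip2 ((\<lambda>x. u (x + - axis j 1)) - u)"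
      unfolding w_def by (intro ell2.nrm_triangle ell2_diff tr u)
    have d: "hnorm ip2 ((\<lambda>x. u (x + y)) - u) \<le> hnorm ip2 u + hnorm ip2 u" for y
      using ell2.nrm_minus_le[OF tr(1) u, of y] by (simp only: tr(2))
    show "hnorm ip2 (w j) \<le> 4 * hnorm ip2 u"
      using tri d[of "axis j 1"] d[of "- axis j 1"] by argo
  qed
  have s: "sum w UNIV \<in> ell2" "hnorm ip2 (sum w UNIV) \<le> (\<Sum>j\<in>UNIV. hnorm ip2 (w j))"
    using ell2.nrm_sum_le[of UNIV w] wj(1) by auto
  show "laplacian u \<in> ell2" using s(1) by (simp add: lap)
  have "(\<Sum>j\<in>UNIV. hnorm ip2 (w j)) \<le> (\<Sum>j\<in>(UNIV::'d set). 4 * hnorm ip2 u)" by (intro sum_mono wj(2))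
  then show "hnorm ip2 (laplacian u) \<le> 4 * CARD('d) * hnorm ip2 u"
    unfolding lap using s(2) by (simp add: mult_ac)
  assume v: "v \<in> ell2"
  have trv: "(\<lambda>x. v (x + y)) \<in> ell2" for y by (rule ell2_translate[OF v])
  let ?D = "\<lambda>j u. (\<lambda>x. u (x + axis j 1)) - u"
  have "Q0_inner u v = (\<Sum>\<^sub>\<infinity>x\<in>UNIV. \<Sum>j\<in>UNIV. ?D j u x * cnj (?D j v x))"
    by (simp add: Q0_inner_def)
  also have "\<dots> = (\<Sum>j\<in>UNIV. ip2 (?D j u) (?D j v))"
    unfolding ip2_def
    by (rule infsum_finite_sum) (auto intro!: ell2_product_summable[of "?D _ u" "?D _ v", simplified] ell2_diff tr trv u v)
  also have "\<dots> = (\<Sum>j\<in>UNIV. - ip2 (w j) v)"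
  proof (rule sum.cong)
    fix j :: 'd
    let ?t = "axis j 1 :: int ^ 'd"
    have "ip2 u (\<lambda>x. v (x + ?t)) = ip2 (\<lambda>x. u (x + - ?t)) v"
      using ip2_translate[of "\<lambda>x. u (x + - ?t)" ?t v] by simp
    moreover have "ip2 (\<lambda>x. u (x + ?t)) (\<lambda>x. v (x + ?t)) = ip2 u v" by (rule ip2_translate)
    ultimately show "ip2 (?D j u) (?D j v) = - ip2 (w j) v"
      unfolding w_def
      by (simp only: ell2.ip_diff_left ell2.ip_diff_right ell2.ip_add_left ell2_diff tr trv u v) simp
  qed simp
  also have "\<dots> = - (\<Sum>j\<in>UNIV. ip2 (w j) v)" by (simp add: sum_negf)
  also have "(\<Sum>j\<in>UNIV. ip2 (w j) v) = ip2 (laplacian u) v"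
  proof -
    have "laplacian u = lincomb UNIV (\<lambda>_. 1) w"
      by (auto simp: lap fun_eq_iff lincomb_apply sum_fun_apply)
    then show ?thesis using ell2.ip_lincomb_left[OF v, of UNIV w "\<lambda>_. 1"] wj(1) by simp
  qed
  finally show "ip2 (laplacian u) v = - Q0_inner u v" by simp
qed

definition mult_op :: "('x \<Rightarrow> real) \<Rightarrow> ('x \<Rightarrow> complex) \<Rightarrow> 'x \<Rightarrow> complex" where
  "mult_op W u = (\<lambda>x. complex_of_real (W x) * u x)"

lemma mult_op_linear: "mult_op W (u + v) = mult_op W u + mult_op W v" "mult_op W (cscale c u) = cscale c (mult_op W u)"
  by (auto simp: mult_op_def fun_eq_iff algebra_simps)

locale vanishing_potential =
  fixes W :: "int ^ 'd::finite \<Rightarrow> real"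
  assumes W0: "\<And>x. 0 \<le> W x" and finW: "\<And>t. t > 0 \<Longrightarrow> finite {x. W x > t}"
begin

lemma bounded_W: "\<exists>C\<ge>0. \<forall>x. W x \<le> C"
proof -
  have "W x \<le> 1 + (\<Sum>y\<in>{y. W y > 1}. W y)" for x
  proof (cases "W x > 1")
    case True
    then have "W x \<le> (\<Sum>y\<in>{y. W y > 1}. W y)" using finW[of 1] W0 by (intro member_le_sum) auto
    then show ?thesis by simp
  next
    case False
    moreover have "0 \<le> (\<Sum>y\<in>{y. W y > 1}. W y)" using W0 by (intro sum_nonneg)
    ultimately show ?thesis by simp
  qed
  then show ?thesis using W0 by (meson order_trans)
qed

lemma mult_op_split_bound:
  assumes e: "e > 0"
  shows "\<exists>F D. finite F \<and> 0 \<le> D \<and> (\<forall>u\<in>ell2. mult_op W u \<in> ell2 \<and>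
     sqsum (mult_op W u) \<le> D * (\<Sum>x\<in>F. (cmod (u x))\<^sup>2) + e * sqsum u)"
proof -
  obtain C where C: "C \<ge> 0" "\<And>x. W x \<le> C" using bounded_W by blast
  define F where "F = {x. W x > sqrt e}"
  have F: "finite F" unfolding F_def using e by (intro finW) simp
  have "mult_op W u \<in> ell2 \<and> sqsum (mult_op W u) \<le> C\<^sup>2 * (\<Sum>x\<in>F. (cmod (u x))\<^sup>2) + e * sqsum u"
    if u: "u \<in> ell2" for u
  proof -
    have "(\<Sum>x\<in>E. (cmod (mult_op W u x))\<^sup>2) \<le> C\<^sup>2 * (\<Sum>x\<in>F. (cmod (u x))\<^sup>2) + e * sqsum u"
      if E: "finite E" for E
    proof -
      have "(\<Sum>x\<in>E. (cmod (mult_op W u x))\<^sup>2) =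
          (\<Sum>x\<in>E \<inter> F. (W x)\<^sup>2 * (cmod (u x))\<^sup>2) + (\<Sum>x\<in>E - F. (W x)\<^sup>2 * (cmod (u x))\<^sup>2)"
        using E by (simp add: mult_op_def norm_mult power_mult_distrib sum.Int_Diff[of E _ F])
      also have "\<dots> \<le> (\<Sum>x\<in>F. C\<^sup>2 * (cmod (u x))\<^sup>2) + (\<Sum>x\<in>E - F. e * (cmod (u x))\<^sup>2)"
      proof (rule add_mono)
        have "(\<Sum>x\<in>E \<inter> F. (W x)\<^sup>2 * (cmod (u x))\<^sup>2) \<le> (\<Sum>x\<in>E \<inter> F. C\<^sup>2 * (cmod (u x))\<^sup>2)"
          using C W0 by (intro sum_mono mult_right_mono power_mono) auto
        also have "\<dots> \<le> (\<Sum>x\<in>F. C\<^sup>2 * (cmod (u x))\<^sup>2)" using F by (intro sum_mono2) auto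
        finally show "(\<Sum>x\<in>E \<inter> F. (W x)\<^sup>2 * (cmod (u x))\<^sup>2) \<le> (\<Sum>x\<in>F. C\<^sup>2 * (cmod (u x))\<^sup>2)" .
        show "(\<Sum>x\<in>E - F. (W x)\<^sup>2 * (cmod (u x))\<^sup>2) \<le> (\<Sum>x\<in>E - F. e * (cmod (u x))\<^sup>2)"
        proof (intro sum_mono mult_right_mono)
          fix x assume "x \<in> E - F"
          then have "W x \<le> sqrt e" by (simp add: F_def not_less)
          then have "(W x)\<^sup>2 \<le> (sqrt e)\<^sup>2" using W0 by (intro power_mono) auto
          then show "(W x)\<^sup>2 \<le> e" using e by simp
        qed simp
      qed
      also have "\<dots> = C\<^sup>2 * (\<Sum>x\<in>F. (cmod (u x))\<^sup>2) + e * (\<Sum>x\<in>E - F. (cmod (u x))\<^sup>2)"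
        by (simp add: sum_distrib_left)
      also have "e * (\<Sum>x\<in>E - F. (cmod (u x))\<^sup>2) \<le> e * sqsum u"
        using e E u by (intro mult_left_mono finite_sum_le_sqsum) auto
      finally show ?thesis by simp
    qed
    then show ?thesis using ell2_if_bounded by blast
  qed
  then show ?thesis using F by (intro exI[of _ F] exI[of _ "C\<^sup>2"]) auto
qed

lemma mult_op_ell2: "u \<in> ell2 \<Longrightarrow> mult_op W u \<in> ell2"
  using mult_op_split_bound[of 1] by auto

lemma mult_op_linear_op: "linear_op ell2 (mult_op W)"
  unfolding linear_op_def using mult_op_ell2 by (simp add: mult_op_linear)

lemma mult_op_compact: "compact_op ell2 ip2 (mult_op W)"
proof (rule ell2.compact_opI)
  show "countable (UNIV :: (int ^ 'd) set)" by simp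
  show "linear_op ell2 (mult_op W)" by (rule mult_op_linear_op)
  show "cmod (u x) \<le> 1 * hnorm ip2 u" if "u \<in> ell2" for u :: "int ^ 'd \<Rightarrow> complex" and x
    using cmod_sq_le_sqsum[OF that, of x] that by (simp add: hnorm_ip2 real_le_rsqrt)
  fix e :: real assume "e > 0"
  from mult_op_split_bound[OF this]
  show "\<exists>F D. finite F \<and> 0 \<le> D \<and> (\<forall>u\<in>ell2. (hnorm ip2 (mult_op W u))\<^sup>2
      \<le> D * (\<Sum>x\<in>F. (cmod (u x))\<^sup>2) + e * (hnorm ip2 u)\<^sup>2)"
    by (simp add: hnorm_ip2 mult_op_ell2 sqsum_nonneg)
qed

text \<open>
  The operator \<open>- H\<^sub>W = \<Delta> + W\<close>, whose positive eigenvalues are to be counted.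
\<close>
definition neg_schr where "neg_schr u = laplacian u + mult_op W u"

lemma neg_schr_ell2: "u \<in> ell2 \<Longrightarrow> neg_schr u \<in> ell2"
  unfolding neg_schr_def by (intro ell2_add laplacian_ell2(1) mult_op_ell2)

lemma neg_schr_symmetric: "ell2.symmetric_op neg_schr"
  unfolding ell2.symmetric_op_def linear_op_def
proof (intro conjI ballI allI)
  fix u v :: "int ^ 'd \<Rightarrow> complex" assume u: "u \<in> ell2"
  show "neg_schr u \<in> ell2" using u by (rule neg_schr_ell2)
  show "neg_schr (cscale c u) = cscale c (neg_schr u)" for c
    by (auto simp: neg_schr_def mult_op_def laplacian_def fun_eq_iff algebra_simps sum_distrib_left)
  assume v: "v \<in> ell2"
  show "neg_schr (u + v) = neg_schr u + neg_schr v"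
    by (auto simp: neg_schr_def mult_op_def laplacian_def fun_eq_iff algebra_simps sum.distrib[symmetric] intro!: sum.cong)
  have "ip2 (mult_op W u) v = ip2 u (mult_op W v)"
    by (simp add: ip2_def mult_op_def mult_ac)
  moreover have "ip2 (laplacian u) v = ip2 u (laplacian v)"
  proof -
    have "ip2 u (laplacian v) = cnj (- Q0_inner v u)"
      using ell2.ip_cnj[OF laplacian_ell2(1)[OF v] u] laplacian_ell2(3)[OF v u] by simp
    also have "\<dots> = - Q0_inner u v"
      using ell2.ip_cnj[of "grad v" "grad u"] u v by (simp add: Q0_inner_eq_ip2 grad_ell2_of_ell2)
    finally show ?thesis using laplacian_ell2(3)[OF u v] by simp
  qed
  ultimately show "ip2 (neg_schr u) v = ip2 u (neg_schr v)"
    unfolding neg_schr_def using u v by (simp add: ell2.ip_add_left ell2.ip_add_right laplacian_ell2(1) mult_op_ell2)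
qed

lemma neg_schr_form:
  assumes u: "u \<in> ell2"
  shows "Re (ip2 (neg_schr u) u) = b_form W u - Q0 u"
proof -
  have weighted: "weighted W u \<in> ell2"
  proof -
    obtain C where C: "C \<ge> 0" "\<And>x. W x \<le> C" using bounded_W by blast
    have "(\<lambda>x. (cmod (weighted W u x))\<^sup>2) summable_on UNIV"
      by (rule summable_on_comparison_test[OF summable_on_cmult_right[OF ell2_summable[OF u], of C]])
         (use C W0 in \<open>auto simp: cmod_weighted_sq intro!: mult_right_mono\<close>)
    then show ?thesis by (simp add: ell2_def)
  qed
  have "complex_of_real (W x) = complex_of_real (sqrt (W x)) * complex_of_real (sqrt (W x))" for x
    using W0[of x] by (simp add: of_real_mult[symmetric] del: of_real_mult)
  then have "ip2 (mult_op W u) u = ip2 (weighted W u) (weighted W u)"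
    unfolding ip2_def by (intro infsum_cong) (simp add: weighted_def mult_op_def mult_ac)
  also have "\<dots> = complex_of_real (b_form W u)" using weighted by (simp add: ip2_self b_form_eq W0)
  finally have "ip2 (mult_op W u) u = complex_of_real (b_form W u)" .
  moreover have "ip2 (laplacian u) u = - complex_of_real (Q0 u)"
    using u grad_ell2_of_ell2(1)[OF u]
    by (simp add: laplacian_ell2(3) Q0_inner_eq_ip2 ip2_self Q0_eq_sqsum)
  ultimately show ?thesis
    unfolding neg_schr_def using u by (simp add: ell2.ip_add_left laplacian_ell2(1) mult_op_ell2)
qed

lemma neg_schr_form_le: "u \<in> ell2 \<Longrightarrow> Re (ip2 (neg_schr u) u) \<le> Re (ip2 (mult_op W u) u)"
  using grad_ell2_of_ell2(1)[of u] Q0_nonneg[of u] unfolding neg_schr_def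
  by (simp add: ell2.ip_add_left laplacian_ell2 mult_op_ell2 Q0_inner_eq_ip2 ip2_self Q0_eq_sqsum)

lemma neg_schr_bounded: "\<exists>C. \<forall>u\<in>ell2. hnorm ip2 (neg_schr u) \<le> C * hnorm ip2 u"
proof -
  obtain C where C: "C \<ge> 0" "\<And>x. W x \<le> C" using bounded_W by blast
  have "hnorm ip2 (neg_schr u) \<le> (4 * CARD('d) + C) * hnorm ip2 u" if u: "u \<in> ell2" for u
  proof -
    have "sqsum (mult_op W u) \<le> C\<^sup>2 * sqsum u"
    proof (rule ell2_if_bounded(2))
      fix E :: "(int ^ 'd) set" assume E: "finite E"
      have "(\<Sum>x\<in>E. (cmod (mult_op W u x))\<^sup>2) \<le> (\<Sum>x\<in>E. C\<^sup>2 * (cmod (u x))\<^sup>2)"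
        using C W0 by (intro sum_mono) (auto simp: mult_op_def norm_mult power_mult_distrib intro!: mult_right_mono power_mono)
      also have "\<dots> = C\<^sup>2 * (\<Sum>x\<in>E. (cmod (u x))\<^sup>2)" by (simp add: sum_distrib_left)
      also have "\<dots> \<le> C\<^sup>2 * sqsum u" using E u by (intro mult_left_mono finite_sum_le_sqsum) auto
      finally show "(\<Sum>x\<in>E. (cmod (mult_op W u x))\<^sup>2) \<le> C\<^sup>2 * sqsum u" .
    qed
    then have "sqrt (sqsum (mult_op W u)) \<le> sqrt (C\<^sup>2 * sqsum u)" by simp
    then have "hnorm ip2 (mult_op W u) \<le> C * hnorm ip2 u"
      using C u by (simp add: hnorm_ip2 mult_op_ell2 real_sqrt_mult)
    moreover have "hnorm ip2 (neg_schr u) \<le> hnorm ip2 (laplacian u) + hnorm ip2 (mult_op W u)"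
      unfolding neg_schr_def using u by (intro ell2.nrm_triangle laplacian_ell2(1) mult_op_ell2)
    ultimately show ?thesis using laplacian_ell2(2)[OF u] by (simp add: distrib_right)
  qed
  then show ?thesis by blast
qed

lemma N_minus_eq: "N_minus W = eig_count ell2 neg_schr {0<..}"
proof -
  have "schroedinger W = (\<lambda>u. - neg_schr u)"
    by (auto simp: schroedinger_def neg_schr_def mult_op_def fun_eq_iff)
  then show ?thesis unfolding N_minus_def using ell2.eig_count_uminus[OF neg_schr_symmetric] by simp
qed

lemma N_minus_variational:
  fixes v :: "'i \<Rightarrow> int ^ 'd \<Rightarrow> complex"
  assumes "finite I" "\<And>i. i \<in> I \<Longrightarrow> v i \<in> ell2"
    and pos: "\<And>c. \<exists>i\<in>I. c i \<noteq> 0 \<Longrightarrow> Q0 (lincomb I c v) < b_form W (lincomb I c v)"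
  shows "enat (card I) \<le> N_minus W"
proof -
  obtain C where C: "\<And>u. u \<in> ell2 \<Longrightarrow> hnorm ip2 (neg_schr u) \<le> C * hnorm ip2 u" using neg_schr_bounded by blast
  show ?thesis unfolding N_minus_eq
  proof (rule ell2.variational_principle[OF neg_schr_symmetric C mult_op_compact neg_schr_form_le _ assms(1,2)])
    fix c :: "'i \<Rightarrow> complex" assume c: "\<exists>i\<in>I. c i \<noteq> 0"
    have "lincomb I c v \<in> ell2" using assms(2) by (intro ell2.lincomb_in)
    then show "0 * (hnorm ip2 (lincomb I c v))\<^sup>2 < Re (ip2 (neg_schr (lincomb I c v)) (lincomb I c v))"
      using pos[OF c] by (simp add: neg_schr_form)
  qed auto
qed

lemma N_minus_subspace:
  assumes "enat m \<le> N_minus W"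
  shows "\<exists>E. card E = m \<and> finite E \<and> E \<subseteq> ell2 \<and>
     (\<forall>c. (\<exists>e\<in>E. c e \<noteq> 0) \<longrightarrow> Q0 (lincomb E c (\<lambda>e. e)) < b_form W (lincomb E c (\<lambda>e. e)))"
proof -
  obtain E where E: "ell2.eigenvectors neg_schr {0<..} E" "card E = m"
    using assms unfolding N_minus_eq ell2.eig_count_ge_iff[OF neg_schr_symmetric] by blast
  have o: "ell2.orthonormal E" using E by (simp add: ell2.eigenvectors_def)
  have lin: "linear_op ell2 neg_schr" using neg_schr_symmetric by (simp add: ell2.symmetric_op_def)
  have "Q0 (lincomb E c (\<lambda>e. e)) < b_form W (lincomb E c (\<lambda>e. e))" if "\<exists>e\<in>E. c e \<noteq> 0" for c
  proof -
    have "lincomb E c (\<lambda>e. e) \<in> ell2" using ell2.orthonormalD(2)[OF o] by (intro ell2.lincomb_in)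
    then show ?thesis using ell2.eigenvectors_form_greater[OF lin E(1) that] by (simp add: neg_schr_form)
  qed
  then show ?thesis using E ell2.orthonormalD(1,2)[OF o] by blast
qed

end

context tail_potential
begin

lemma scaled_vanishing_potential: "\<alpha> > 0 \<Longrightarrow> vanishing_potential (\<lambda>x. \<alpha> * V x)"
proof
  assume a: "\<alpha> > 0"
  show "0 \<le> \<alpha> * V x" for x using a V0 by simp
  show "finite {x. \<alpha> * V x > t}" if "t > 0" for t
    using finite_above[of "t / \<alpha>"] a that by (simp add: field_simps)
qed

lemma b_form_scale: "b_form (\<lambda>x. \<alpha> * V x) u = \<alpha> * b_form V u"
  by (simp add: b_form_def mult.assoc infsum_cmult_right')

lemma birman_schwinger_symmetric: "H1.symmetric_op (birman_schwinger V)"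
  using H1.nonneg_selfadjoint_symmetric[OF birman_schwinger_nonneg_selfadjoint] .

text \<open>
  The span of the eigenvectors in \<open>\<ell>\<^sub>2\<close> is a test space in \<open>H\<^sup>1\<close>, because \<open>\<ell>\<^sub>2 \<subseteq> H\<^sup>1\<close>.
\<close>
lemma N_minus_le_n_plus:
  assumes a: "\<alpha> > 0" and m: "enat m \<le> N_minus (\<lambda>x. \<alpha> * V x)"
  shows "enat m \<le> n_plus H1 (1 / \<alpha>) (birman_schwinger V)"
proof -
  interpret vanishing_potential "\<lambda>x. \<alpha> * V x" by (rule scaled_vanishing_potential[OF a])
  obtain E where E: "card E = m" "finite E" "E \<subseteq> ell2"
    "\<And>c. \<exists>e\<in>E. c e \<noteq> 0 \<Longrightarrow> Q0 (lincomb E c (\<lambda>e. e)) < b_form (\<lambda>x. \<alpha> * V x) (lincomb E c (\<lambda>e. e))"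
    using N_minus_subspace[OF m] by blast
  have EH: "e \<in> H1" if "e \<in> E" for e using that E(3) ell2_subset_H1 by blast
  obtain C where C: "\<And>u. u \<in> H1 \<Longrightarrow> hnorm Q0_inner (birman_schwinger V u) \<le> C * hnorm Q0_inner u"
    using birman_schwinger_bounded by blast
  have "enat (card E) \<le> eig_count H1 (birman_schwinger V) {1 / \<alpha><..}"
  proof (rule H1.variational_principle[OF birman_schwinger_symmetric C birman_schwinger_compact _ _ E(2) EH])
    fix c :: "(int ^ 'd \<Rightarrow> complex) \<Rightarrow> complex" assume c: "\<exists>e\<in>E. c e \<noteq> 0"
    let ?u = "lincomb E c (\<lambda>e. e)"
    have u: "?u \<in> H1" using EH by (intro H1.lincomb_in)
    have "Q0 ?u < \<alpha> * b_form V ?u" using E(4)[OF c] by (simp add: b_form_scale)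
    then show "1 / \<alpha> * (hnorm Q0_inner ?u)\<^sup>2 < Re (Q0_inner (birman_schwinger V ?u) ?u)"
      using a u by (simp add: birman_schwinger_form Q0_eq_nrm[symmetric] field_simps)
  qed (use a in auto)
  then show ?thesis using E(1) by (simp add: n_plus_def)
qed

text \<open>
  Eigenvectors of \<open>B\<^sub>V\<close> need not lie in \<open>\<ell>\<^sub>2\<close>. They are replaced by finitely supported approximants;
  the form \<open>b\<^sub>V - s Q\<^sub>0\<close> is diagonal with entries at least \<open>\<delta> > 0\<close> in the eigenvectors, so it stays
  positive definite if all its entries change by little.
\<close>
lemma n_plus_le_N_minus:
  assumes a: "\<alpha> > 0" and m: "enat m \<le> n_plus H1 (1 / \<alpha>) (birman_schwinger V)"
  shows "enat m \<le> N_minus (\<lambda>x. \<alpha> * V x)"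
proof (cases "m = 0")
  case True then show ?thesis by (simp add: zero_enat_def[symmetric])
next
  case False
  interpret vanishing_potential "\<lambda>x. \<alpha> * V x" by (rule scaled_vanishing_potential[OF a])
  let ?B = "birman_schwinger V" and ?s = "1 / \<alpha>"
  obtain E where E: "H1.eigenvectors ?B {?s<..} E" "card E = m"
    using m unfolding n_plus_def H1.eig_count_ge_iff[OF birman_schwinger_symmetric] by blast
  have oE: "H1.orthonormal E" using E by (simp add: H1.eigenvectors_def)
  note finE = H1.orthonormalD(1)[OF oE] and EH = H1.orthonormalD(2)[OF oE]
  have "\<forall>e\<in>E. \<exists>t. ?s < t \<and> ?B e = cscale (complex_of_real t) e"
    using E(1) by (auto simp: H1.eigenvectors_def)
  then obtain \<mu> where \<mu>: "\<And>e. e \<in> E \<Longrightarrow> ?s < \<mu> e" "\<And>e. e \<in> E \<Longrightarrow> ?B e = cscale (complex_of_real (\<mu> e)) e" by metis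
  have neE: "E \<noteq> {}" using E(2) False by auto
  define \<delta> where "\<delta> = Min ((\<lambda>e. \<mu> e - ?s) ` E)"
  have \<delta>: "\<delta> > 0" unfolding \<delta>_def using finE neE \<mu>(1) by (subst Min_gr_iff) auto
  have \<delta>_le: "\<delta> \<le> \<mu> e - ?s" if "e \<in> E" for e unfolding \<delta>_def using finE that by (intro Min_le) auto
  have "\<exists>f. (\<forall>n. finite {x. f n x \<noteq> 0}) \<and> (\<lambda>n::nat. hnorm Q0_inner (f n - e)) \<longlonglongrightarrow> 0" if e: "e \<in> E" for e
  proof -
    obtain f where f: "\<And>n. finite {x. f n x \<noteq> 0}" "(\<lambda>n::nat. hnorm ip2 (grad (f n) - grad e)) \<longlonglongrightarrow> 0"
      using H1D[OF EH[OF e]] by blast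
    have "hnorm Q0_inner (f n - e) = hnorm ip2 (grad (f n) - grad e)" for n
      using hnorm_Q0_inner[OF H1_diff[OF finite_support_H1[OF f(1)] EH[OF e]]] by (simp add: grad_diff)
    then show ?thesis using f by (intro exI[of _ f]) simp
  qed
  then obtain f where f: "\<And>e n. e \<in> E \<Longrightarrow> finite {x. f e n x \<noteq> 0}"
     "\<And>e. e \<in> E \<Longrightarrow> (\<lambda>n::nat. hnorm Q0_inner (f e n - e)) \<longlonglongrightarrow> 0" by metis
  have fH: "f e n \<in> H1" if "e \<in> E" for e n using f(1)[OF that] by (rule finite_support_H1)
  define C where "C u = ?B u - cscale (complex_of_real ?s) u" for u
  have linB: "linear_op H1 ?B" by (rule birman_schwinger_linear)
  have CH: "C u \<in> H1" if "u \<in> H1" for u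
    unfolding C_def using that by (intro H1_diff birman_schwinger(1) H1_scale)
  have linC: "linear_op H1 C"
    unfolding linear_op_def using CH H1.linear_opD[OF linB]
    by (auto simp: C_def fun_eq_iff algebra_simps)
  obtain D where D: "\<And>u. u \<in> H1 \<Longrightarrow> hnorm Q0_inner (?B u) \<le> D * hnorm Q0_inner u"
    using birman_schwinger_bounded by blast
  have C_bd: "hnorm Q0_inner (C u) \<le> (D + ?s) * hnorm Q0_inner u" if u: "u \<in> H1" for u
  proof -
    have "hnorm Q0_inner (C u) \<le> hnorm Q0_inner (?B u) + hnorm Q0_inner (cscale (complex_of_real ?s) u)"
      unfolding C_def using u by (intro H1.nrm_minus_le birman_schwinger(1) H1_scale)
    moreover have "hnorm Q0_inner (cscale (complex_of_real ?s) u) = ?s * hnorm Q0_inner u"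
      using H1.nrm_scale[OF u, of "complex_of_real ?s"] a by (simp add: norm_divide)
    ultimately show ?thesis using D[OF u] by (simp add: distrib_right)
  qed
  have C_form: "Re (Q0_inner (C u) u) = b_form V u - ?s * Q0 u" if u: "u \<in> H1" for u
    unfolding C_def using u birman_schwinger_form[OF u]
    by (simp add: H1.ip_diff_left birman_schwinger(1) H1_scale H1.ip_scale_left H1.ip_self Q0_eq_nrm del: of_real_power)
  have C_E: "Q0_inner (C e) e' = (if e = e' then complex_of_real (\<mu> e - ?s) else 0)" if "e \<in> E" "e' \<in> E" for e e'
  proof -
    have "C e = cscale (complex_of_real (\<mu> e - ?s)) e"
      by (simp add: C_def \<mu>(2)[OF that(1)]) (auto simp: fun_eq_iff algebra_simps)
    then show ?thesis using that EH H1.orthonormal_ip[OF oE that] by (simp add: H1.ip_scale_left)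
  qed
  have C_lim: "(\<lambda>n. hnorm Q0_inner (C (f e n) - C e)) \<longlonglongrightarrow> 0" if e: "e \<in> E" for e
  proof (rule Lim_null_comparison)
    show "(\<lambda>n. (D + ?s) * hnorm Q0_inner (f e n - e)) \<longlonglongrightarrow> 0"
      by (rule tendsto_mult_right_zero[OF f(2)[OF e]])
    have "norm (hnorm Q0_inner (C (f e n) - C e)) \<le> (D + ?s) * hnorm Q0_inner (f e n - e)" for n
    proof -
      have "C (f e n) - C e = C (f e n - e)" using H1.linear_opD(4)[OF linC fH[OF e] EH[OF e]] by simp
      moreover have "0 \<le> hnorm Q0_inner (C (f e n - e))" using fH[OF e] EH[OF e] CH H1_diff by simp
      ultimately show ?thesis using C_bd[OF H1_diff[OF fH[OF e] EH[OF e]]] by (simp only: real_norm_def abs_of_nonneg)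
    qed
    then show "\<forall>\<^sub>F n in sequentially. norm (hnorm Q0_inner (C (f e n) - C e)) \<le> (D + ?s) * hnorm Q0_inner (f e n - e)"
      by (intro always_eventually allI)
  qed
  \<comment> \<open>an error of \<open>\<eta>\<close> in each of the \<open>m\<^sup>2\<close> entries changes the form by at most \<open>\<eta> m \<parallel>c\<parallel>\<^sup>2 = \<delta>/2 \<parallel>c\<parallel>\<^sup>2\<close>\<close>
  define \<eta> where "\<eta> = \<delta> / (2 * m)"
  have \<eta>: "\<eta> > 0" "\<eta> * m = \<delta> / 2" using \<delta> False by (auto simp: \<eta>_def)
  have lim: "(\<lambda>n. Q0_inner (C (f e n)) (f e' n)) \<longlonglongrightarrow> Q0_inner (C e) e'" if "e \<in> E" "e' \<in> E" for e e'
    by (rule H1.ip_tendsto2[OF CH[OF fH[OF that(1)]] fH[OF that(2)] CH[OF EH[OF that(1)]] EH[OF that(2)]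
        C_lim[OF that(1)] f(2)[OF that(2)]])
  have "\<forall>\<^sub>F n in sequentially. \<forall>p\<in>E \<times> E. dist (Q0_inner (C (f (fst p) n)) (f (snd p) n)) (Q0_inner (C (fst p)) (snd p)) < \<eta>"
    using finE lim \<eta>(1) by (intro eventually_ball_finite) (auto dest: tendstoD)
  then obtain n where n: "\<And>e e'. e \<in> E \<Longrightarrow> e' \<in> E \<Longrightarrow>
      cmod (Q0_inner (C (f e n)) (f e' n) - Q0_inner (C e) e') < \<eta>"
    unfolding eventually_sequentially dist_norm by fastforce
  define g where "g e = f e n" for e
  have gH: "g e \<in> H1" and g2: "g e \<in> ell2" if "e \<in> E" for e
    using fH[OF that] ell2_finite_support[OF f(1)[OF that]] by (auto simp: g_def)
  have "enat (card E) \<le> N_minus (\<lambda>x. \<alpha> * V x)"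
  proof (rule N_minus_variational[OF finE g2])
    fix c :: "(int ^ 'd \<Rightarrow> complex) \<Rightarrow> complex" assume c: "\<exists>e\<in>E. c e \<noteq> 0"
    let ?u = "lincomb E c g"
    have u: "?u \<in> H1" using gH by (intro H1.lincomb_in)
    define S where "S = (\<Sum>e\<in>E. (cmod (c e))\<^sup>2)"
    obtain e0 where e0: "e0 \<in> E" "c e0 \<noteq> 0" using c by blast
    have S: "S > 0" unfolding S_def using finE e0 by (intro sum_pos2[of E e0]) auto
    define R where "R e e' = Q0_inner (C (g e)) (g e') - Q0_inner (C e) e'" for e e'
    have R: "cmod (R e e') \<le> \<eta>" if "e \<in> E" "e' \<in> E" for e e'
      using n[OF that] by (simp add: R_def g_def less_imp_le)
    have "Q0_inner (C ?u) ?u = (\<Sum>e\<in>E. c e * Q0_inner (C (g e)) ?u)"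
    proof -
      have "C ?u = lincomb E c (\<lambda>e. C (g e))" using gH by (intro H1.linear_op_lincomb[OF linC])
      then show ?thesis using u gH CH by (simp add: H1.ip_lincomb_left)
    qed
    also have "\<dots> = (\<Sum>e\<in>E. \<Sum>e'\<in>E. c e * (cnj (c e') * Q0_inner (C (g e)) (g e')))"
      using gH CH by (intro sum.cong) (simp_all add: H1.ip_lincomb_right sum_distrib_left)
    also have "\<dots> = (\<Sum>e\<in>E. \<Sum>e'\<in>E. (if e = e' then complex_of_real ((\<mu> e - ?s) * (cmod (c e))\<^sup>2) else 0)
        + c e * cnj (c e') * R e e')"
      by (intro sum.cong refl)
         (auto simp: R_def C_E algebra_simps complex_norm_square simp del: of_real_power)
    also have "\<dots> = (\<Sum>e\<in>E. complex_of_real ((\<mu> e - ?s) * (cmod (c e))\<^sup>2)) + (\<Sum>e\<in>E. \<Sum>e'\<in>E. c e * cnj (c e') * R e e')"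
      using finE by (simp add: sum.distrib)
    finally have exp: "Q0_inner (C ?u) ?u = complex_of_real (\<Sum>e\<in>E. (\<mu> e - ?s) * (cmod (c e))\<^sup>2)
        + (\<Sum>e\<in>E. \<Sum>e'\<in>E. c e * cnj (c e') * R e e')" by simp
    have "cmod (\<Sum>e\<in>E. \<Sum>e'\<in>E. c e * cnj (c e') * R e e') \<le> (\<Sum>e\<in>E. \<Sum>e'\<in>E. cmod (c e) * cmod (c e') * \<eta>)"
      using R by (intro sum_norm_le) (auto simp: norm_mult intro!: mult_left_mono)
    also have "\<dots> = \<eta> * (\<Sum>e\<in>E. cmod (c e))\<^sup>2"
      by (simp add: power2_eq_square sum_product sum_distrib_left mult_ac)
    also have "\<dots> \<le> \<eta> * (S * m)"
      using sum_squared_le_sum_of_squares[of "\<lambda>e. cmod (c e)" E] \<eta>(1) E(2)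
      by (intro mult_left_mono) (auto simp: S_def)
    also have "\<dots> = \<delta> / 2 * S" using \<eta>(2) by (simp add: mult_ac)
    finally have err: "cmod (\<Sum>e\<in>E. \<Sum>e'\<in>E. c e * cnj (c e') * R e e') \<le> \<delta> / 2 * S" .
    have "\<delta> * S \<le> (\<Sum>e\<in>E. (\<mu> e - ?s) * (cmod (c e))\<^sup>2)"
      unfolding S_def sum_distrib_left using \<delta>_le by (intro sum_mono mult_right_mono) auto
    moreover have "Re (Q0_inner (C ?u) ?u) = (\<Sum>e\<in>E. (\<mu> e - ?s) * (cmod (c e))\<^sup>2)
        + Re (\<Sum>e\<in>E. \<Sum>e'\<in>E. c e * cnj (c e') * R e e')" unfolding exp by simp
    moreover have "- (\<delta> / 2 * S) \<le> Re (\<Sum>e\<in>E. \<Sum>e'\<in>E. c e * cnj (c e') * R e e')"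
      using err abs_Re_le_cmod[of "\<Sum>e\<in>E. \<Sum>e'\<in>E. c e * cnj (c e') * R e e'"] by linarith
    moreover have "\<delta> / 2 * S > 0" "\<delta> * S = \<delta> / 2 * S + \<delta> / 2 * S" using \<delta> S by auto
    ultimately have "0 < Re (Q0_inner (C ?u) ?u)" by linarith
    then have "?s * Q0 ?u < b_form V ?u" by (simp add: C_form[OF u])
    then show "Q0 ?u < b_form (\<lambda>x. \<alpha> * V x) ?u" using a by (simp add: b_form_scale field_simps)
  qed
  then show ?thesis using E(2) by simp
qed

lemma Birman_Schwinger_principle:
  "\<alpha> > 0 \<Longrightarrow> N_minus (\<lambda>x. \<alpha> * V x) = n_plus H1 (1 / \<alpha>) (birman_schwinger V)"
  using N_minus_le_n_plus n_plus_le_N_minus by (intro enat_eqI) blast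

lemma n_plus_abs: "s > 0 \<Longrightarrow> n_plus H1 s (abs_op H1 Q0_inner (birman_schwinger V)) = n_plus H1 s (birman_schwinger V)"
  by (intro H1.n_plus_abs_op birman_schwinger_nonneg_selfadjoint) simp

text \<open>
  On the span of the eigenvectors of \<open>B\<^sub>V\<close> for eigenvalues above \<open>1/\<alpha>\<close> the form \<open>\<alpha> b\<^sub>V\<close> exceeds \<open>Q\<^sub>0\<close>,
  so the dimension bound applies to \<open>W = \<alpha>V\<close>.
\<close>
lemma n_plus_bound:
  assumes W: "weak_bound q (\<lambda>x. \<alpha> * V x) N" and a: "\<alpha> > 0" and c: "c > 0" "M \<ge> 0" and L: "layered c M (\<lambda>x. \<alpha> * V x) lev N"
    and m: "enat m \<le> n_plus H1 (1 / \<alpha>) (birman_schwinger V)"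
  shows "real m \<le> (c powr (- q) + 4 * (sobolev CARD('d))\<^sup>2 * M) * N"
proof -
  let ?B = "birman_schwinger V" and ?s = "1 / \<alpha>"
  obtain E where E: "H1.eigenvectors ?B {?s<..} E" "card E = m"
    using m unfolding n_plus_def H1.eig_count_ge_iff[OF birman_schwinger_symmetric] by blast
  have oE: "H1.orthonormal E" using E by (simp add: H1.eigenvectors_def)
  note finE = H1.orthonormalD(1)[OF oE] and EH = H1.orthonormalD(2)[OF oE]
  have "real (card E) \<le> (c powr (- q) + 4 * (sobolev CARD('d))\<^sup>2 * M) * N"
  proof (rule dimension_bound[OF W c L finE EH])
    fix b :: "(int ^ 'd \<Rightarrow> complex) \<Rightarrow> complex" assume b: "\<exists>e\<in>E. b e \<noteq> 0"
    let ?u = "lincomb E b (\<lambda>e. e)"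
    have u: "?u \<in> H1" using EH by (intro H1.lincomb_in)
    have pos: "?s * (hnorm Q0_inner ?u)\<^sup>2 < b_form V ?u"
      using H1.eigenvectors_form_greater[OF birman_schwinger_linear E(1) b] birman_schwinger_form[OF u] by simp
    have "?u \<noteq> 0"
    proof
      assume z: "?u = 0"
      have "b_form V ?u = 0" unfolding z by (simp add: b_form_def)
      then show False using pos unfolding z by simp
    qed
    moreover have "(\<lambda>x. \<alpha> * V x * (cmod (?u x))\<^sup>2) summable_on UNIV"
      using summable_on_cmult_right[OF ell2_summable[OF weighted_ell2[OF u]], of \<alpha>]
      by (simp add: cmod_weighted_sq V0 mult.assoc)
    moreover have "Q0 ?u \<le> b_form (\<lambda>x. \<alpha> * V x) ?u"
      using pos a by (simp add: b_form_scale Q0_eq_nrm[OF u] field_simps)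
    ultimately show "?u \<noteq> 0 \<and> (\<lambda>x. \<alpha> * V x * (cmod (?u x))\<^sup>2) summable_on UNIV \<and> Q0 ?u \<le> b_form (\<lambda>x. \<alpha> * V x) ?u"
      by blast
  qed
  then show ?thesis using E(2) by simp
qed

end

section \<open>Weak sequence spaces and the spectral estimate\<close>
lemma finite_norm_bounded_lattice: "finite {x :: int ^ 'd::finite. norm (\<chi> i. real_of_int (x $ i)) \<le> R}"
proof (rule finite_subset)
  let ?S = "{- \<lceil>R\<rceil>..\<lceil>R\<rceil>}"
  show "finite ((\<lambda>f. \<chi> i. f i) ` PiE UNIV (\<lambda>_::'d. ?S))" by (intro finite_imageI finite_PiE) auto
  show "{x :: int ^ 'd. norm (\<chi> i. real_of_int (x $ i)) \<le> R} \<subseteq> (\<lambda>f. \<chi> i. f i) ` PiE UNIV (\<lambda>_. ?S)"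
  proof
    fix x :: "int ^ 'd" assume x: "x \<in> {x. norm (\<chi> i. real_of_int (x $ i)) \<le> R}"
    have "x $ i \<in> ?S" for i
    proof -
      have "\<bar>real_of_int (x $ i)\<bar> \<le> R"
        using component_le_norm_cart[of "\<chi> i. real_of_int (x $ i)" i] x by simp
      then show ?thesis by (simp add: abs_le_iff) linarith
    qed
    then show "x \<in> (\<lambda>f. \<chi> i. f i) ` PiE UNIV (\<lambda>_. ?S)"
      by (intro image_eqI[of _ _ "\<lambda>i. x $ i"]) auto
  qed
qed

lemma weak_lq_finite:
  fixes V :: "int ^ 'd::finite \<Rightarrow> real"
  assumes "V \<in> weak_lq q" "t > 0"
  shows "finite {x. V x > t}"
proof -
  have "\<forall>\<^sub>F x in filtercomap (\<lambda>x :: int ^ 'd. norm (\<chi> i. real_of_int (x $ i))) at_top. V x < t"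
    using assms by (auto simp: weak_lq_def vanishes_at_infinity_def intro: order_tendstoD)
  then obtain R where R: "\<And>x :: int ^ 'd. R \<le> norm (\<chi> i. real_of_int (x $ i)) \<Longrightarrow> V x < t"
    unfolding eventually_filtercomap eventually_at_top_linorder by blast
  show ?thesis
  proof (rule finite_subset[OF _ finite_norm_bounded_lattice[of R]], rule subsetI, rule ccontr)
    fix x assume x: "x \<in> {x. V x > t}" "x \<notin> {x. norm (\<chi> i. real_of_int (x $ i)) \<le> R}"
    then have "R \<le> norm (\<chi> i. real_of_int (x $ i))" by simp
    from R[OF this] x(1) show False by simp
  qed
qed

text \<open>
  The dictionary between the quasi-norm \<open>s n(s)\<^sup>1\<^sup>/\<^sup>q \<le> R\<close> and the counting estimate \<open>n(s) \<le> (R/s)\<^sup>q\<close>,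
  used for \<open>V\<close> as well as for \<open>B\<^sub>V\<close>.
\<close>
lemma le_powr_iff:
  assumes "s > 0" "q > 0" "R \<ge> 0"
  shows "s * real n powr (1 / q) \<le> R \<longleftrightarrow> real n \<le> (R / s) powr q"
proof -
  have "s * real n powr (1 / q) \<le> R \<longleftrightarrow> real n powr (1 / q) \<le> R / s" using assms by (simp add: field_simps)
  also have "\<dots> \<longleftrightarrow> (real n powr (1 / q)) powr q \<le> (R / s) powr q"
    using powr_mono2[of q "real n powr (1 / q)" "R / s"] powr_less_mono2[of q "R / s" "real n powr (1 / q)"]
      assms by (auto simp: not_le[symmetric])
  also have "(real n powr (1 / q)) powr q = real n" using assms by (simp add: powr_powr)
  finally show ?thesis .
qed

lemma weak_lq_norm_bound:
  assumes "V \<in> weak_lq q" "s > 0"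
  shows "s * real (nu s V) powr (1 / q) \<le> weak_lq_norm q V"
  unfolding weak_lq_norm_def using assms by (intro cSUP_upper) (auto simp: weak_lq_def)

lemma weak_lq_norm_nonneg: "V \<in> weak_lq q \<Longrightarrow> 0 \<le> weak_lq_norm q V"
  using weak_lq_norm_bound[of V q 1] by (meson order_trans mult_nonneg_nonneg powr_ge_zero zero_le_one zero_less_one)

lemma weak_bound_scaled:
  fixes V :: "int ^ 'd::finite \<Rightarrow> real"
  assumes V: "V \<in> weak_lq q" "\<And>x. 0 \<le> V x" and q: "q > 0" and a: "\<alpha> > 0"
  shows "weak_bound q (\<lambda>x. \<alpha> * V x) ((\<alpha> * weak_lq_norm q V) powr q)"
  unfolding weak_bound_def
proof (intro conjI allI impI)
  show "0 \<le> \<alpha> * V x" for x using a V(2) by simp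
  fix t :: real assume t: "t > 0"
  have e: "{x. \<alpha> * V x > t} = {x. V x > t / \<alpha>}" using a by (auto simp: field_simps)
  show "finite {x. \<alpha> * V x > t}" unfolding e using V(1) a t by (intro weak_lq_finite) auto
  have "nu (t / \<alpha>) V = card {x. V x > t / \<alpha>}" using V(2) by (simp add: nu_def)
  moreover have "real (nu (t / \<alpha>) V) \<le> (weak_lq_norm q V / (t / \<alpha>)) powr q"
    using weak_lq_norm_bound[OF V(1), of "t / \<alpha>"] a t
      le_powr_iff[OF _ q weak_lq_norm_nonneg[OF V(1)], of "t / \<alpha>" "nu (t / \<alpha>) V"] by simp
  moreover have "(weak_lq_norm q V / (t / \<alpha>)) powr q = (\<alpha> * weak_lq_norm q V) powr q * t powr (- q)"
    using a t weak_lq_norm_nonneg[OF V(1)] by (simp add: powr_divide powr_minus divide_simps mult.commute)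
  ultimately show "real (card {x. \<alpha> * V x > t}) \<le> (\<alpha> * weak_lq_norm q V) powr q * t powr (- q)"
    unfolding e by simp
qed

theorem theorem3p1:
  fixes q :: real
  assumes "CARD('d::finite) \<ge> 3" and "0 < q" and "q < real CARD('d) / 2"
  shows "\<exists>C>0. \<forall>V :: int ^ 'd \<Rightarrow> real. V \<in> weak_lq q \<and> (\<forall>x. 0 \<le> V x) \<longrightarrow>
           b_form_bounded V \<and>
           birman_schwinger V \<in> Sigma_class H1 Q0_inner q \<and>
           Sigma_norm H1 Q0_inner q (birman_schwinger V) \<le> C * weak_lq_norm q V \<and>
           (\<forall>\<alpha>>0. ereal_of_enat (N_minus (\<lambda>x. \<alpha> * V x))
                    \<le> ereal (C powr q * \<alpha> powr q * weak_lq_norm q V powr q)) \<and>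
           (\<forall>K>0. Sigma_norm H1 Q0_inner q (birman_schwinger V) \<le> K * weak_lq_norm q V \<longleftrightarrow>
                  (\<forall>\<alpha>>0. ereal_of_enat (N_minus (\<lambda>x. \<alpha> * V x))
                    \<le> ereal (K powr q * \<alpha> powr q * weak_lq_norm q V powr q)))"
proof -
  interpret lattice_ge3 "TYPE('d)" by unfold_locales (rule assms(1))
  obtain c M where c: "c > 0" "M \<ge> 0"
    and L: "\<And>(W :: int ^ 'd \<Rightarrow> real) N. weak_bound q W N \<Longrightarrow> \<exists>lev. layered c M W lev N"
    using exists_layering[OF assms(1,3)] by blast
  define C0 where "C0 = c powr (- q) + 4 * (sobolev CARD('d))\<^sup>2 * M"
  have C0: "C0 > 0" unfolding C0_def using c by (intro add_pos_nonneg) auto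
  define C where "C = C0 powr (1 / q)"
  have C: "C > 0" "C powr q = C0" using C0 assms(2) by (auto simp: C_def powr_powr)
  show ?thesis
  proof (intro exI[of _ C] conjI C(1) allI impI)
    fix V :: "int ^ 'd \<Rightarrow> real" assume "V \<in> weak_lq q \<and> (\<forall>x. 0 \<le> V x)"
    then have V: "V \<in> weak_lq q" and V0: "\<And>x. 0 \<le> V x" by auto
    let ?nv = "weak_lq_norm q V" and ?B = "birman_schwinger V"
    have nv: "?nv \<ge> 0" using V by (rule weak_lq_norm_nonneg)
    note wb = weak_bound_scaled[OF V V0 assms(2)]
    \<comment> \<open>a tail of size \<open>e\<close> for \<open>V\<close> is a tail of size one for \<open>V / e\<close>\<close>
    interpret tail_potential "TYPE('d)" V
    proof
      show "0 \<le> V x" for x by (rule V0)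
      show "finite {x. V x > t}" if "t > 0" for t using weak_lq_finite[OF V that] .
      fix e :: real assume e: "e > 0"
      then have a: "1 / e > 0" by simp
      obtain lev where lev: "layered c M (\<lambda>x. 1 / e * V x) lev ((1 / e * ?nv) powr q)" using L[OF wb[OF a]] by blast
      obtain F where F: "finite F" "\<And>u E. u \<in> H1 \<Longrightarrow> finite E \<and> E \<inter> F = {} \<Longrightarrow>
          (\<Sum>x\<in>E. 1 / e * V x * (cmod (u x))\<^sup>2) \<le> Q0 u"
        using tail_bound[OF wb[OF a] c(1) lev] by blast
      have "(\<Sum>x\<in>E. V x * (cmod (u x))\<^sup>2) \<le> e * Q0 u" if "u \<in> H1" "finite E \<and> E \<inter> F = {}" for u E
      proof -
        have "(\<Sum>x\<in>E. 1 / e * V x * (cmod (u x))\<^sup>2) = (\<Sum>x\<in>E. V x * (cmod (u x))\<^sup>2) / e"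
          by (simp add: sum_divide_distrib)
        then have "(\<Sum>x\<in>E. V x * (cmod (u x))\<^sup>2) / e \<le> Q0 u" using F(2)[OF that] by (simp only:)
        then show ?thesis using e by (simp only: pos_divide_le_eq mult.commute)
      qed
      then show "\<exists>F. finite F \<and> (\<forall>u\<in>H1. \<forall>E. finite E \<and> E \<inter> F = {} \<longrightarrow>
          (\<Sum>x\<in>E. V x * (cmod (u x))\<^sup>2) \<le> e * Q0 u)" using F(1) by blast
    qed
    have count: "real m \<le> C0 * (\<alpha> * ?nv) powr q" if al: "\<alpha> > 0" "enat m \<le> n_plus H1 (1 / \<alpha>) ?B" for m \<alpha>
    proof -
      obtain lev where "layered c M (\<lambda>x. \<alpha> * V x) lev ((\<alpha> * ?nv) powr q)" using L[OF wb[OF al(1)]] by blast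
      from n_plus_bound[OF wb[OF al(1)] al(1) c this al(2)] show ?thesis by (simp add: C0_def)
    qed
    have fin: "n_plus H1 s ?B \<noteq> \<infinity>" if "s > 0" for s
    proof
      assume inf: "n_plus H1 s ?B = \<infinity>"
      have le: "real m \<le> C0 * (1 / s * ?nv) powr q" for m
        by (rule count) (use that inf in auto)
      obtain m where "C0 * (1 / s * ?nv) powr q < real m" using reals_Archimedean2 by blast
      then show False using le[of m] by simp
    qed
    define n where "n s = the_enat (n_plus H1 s ?B)" for s
    have n: "n_plus H1 s ?B = enat (n s)" if "s > 0" for s
      using fin[OF that] by (auto simp: n_def)
    have N: "ereal_of_enat (N_minus (\<lambda>x. \<alpha> * V x)) = ereal (real (n (1 / \<alpha>)))" if "\<alpha> > 0" for \<alpha>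
      using Birman_Schwinger_principle[OF that] n[of "1 / \<alpha>"] that by simp
    have S: "Sigma_fun H1 Q0_inner q ?B s = s * real (n s) powr (1 / q)" if "s > 0" for s
      by (simp add: Sigma_fun_def n_plus_abs[OF that] n_def)
    have le_iff: "s * real (n s) powr (1 / q) \<le> K * ?nv \<longleftrightarrow>
        real (n s) \<le> K powr q * (1 / s) powr q * ?nv powr q" if "s > 0" "K > 0" for s K
      using le_powr_iff[OF that(1) assms(2), of "K * ?nv" "n s"] that nv
      by (simp add: powr_mult powr_divide)
    have bound: "s * real (n s) powr (1 / q) \<le> C * ?nv" if s: "s > 0" for s
      unfolding le_iff[OF s C(1)] using count[of "1 / s" "n s"] n[OF s] s nv
      by (simp add: C(2) powr_mult powr_divide mult.assoc)
    have bdd: "bdd_above (Sigma_fun H1 Q0_inner q ?B ` {0<..})"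
      using bound S by (intro bdd_aboveI[of _ "C * ?nv"]) auto
    have norm_le: "Sigma_norm H1 Q0_inner q ?B \<le> K * ?nv \<longleftrightarrow> (\<forall>s>0. s * real (n s) powr (1 / q) \<le> K * ?nv)" for K
    proof -
      have "Sigma_norm H1 Q0_inner q ?B \<le> K * ?nv \<longleftrightarrow> (\<forall>s\<in>{0<..}. Sigma_fun H1 Q0_inner q ?B s \<le> K * ?nv)"
        unfolding Sigma_norm_def using bdd by (intro cSUP_le_iff) auto
      then show ?thesis using S by auto
    qed
    \<comment> \<open>the substitution \<open>s = 1/\<alpha>\<close> in the Birman--Schwinger principle\<close>
    have equiv: "Sigma_norm H1 Q0_inner q ?B \<le> K * ?nv \<longleftrightarrow>
        (\<forall>\<alpha>>0. ereal_of_enat (N_minus (\<lambda>x. \<alpha> * V x)) \<le> ereal (K powr q * \<alpha> powr q * ?nv powr q))" if K: "K > 0" for K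
    proof -
      have "(\<forall>s>0. s * real (n s) powr (1 / q) \<le> K * ?nv) \<longleftrightarrow>
          (\<forall>\<alpha>>0. real (n (1 / \<alpha>)) \<le> K powr q * \<alpha> powr q * ?nv powr q)"
      proof (intro iffI allI impI)
        fix \<alpha> :: real assume h: "\<forall>s>0. s * real (n s) powr (1 / q) \<le> K * ?nv" "\<alpha> > 0"
        then show "real (n (1 / \<alpha>)) \<le> K powr q * \<alpha> powr q * ?nv powr q"
          using le_iff[of "1 / \<alpha>" K] h(1)[rule_format, of "1 / \<alpha>"] K by simp
      next
        fix s :: real assume h: "\<forall>\<alpha>>0. real (n (1 / \<alpha>)) \<le> K powr q * \<alpha> powr q * ?nv powr q" "s > 0"
        then show "s * real (n s) powr (1 / q) \<le> K * ?nv"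
          using le_iff[OF h(2) K] h(1)[rule_format, of "1 / s"] by simp
      qed
      then show ?thesis unfolding norm_le using N by simp
    qed
    show "b_form_bounded V" by (rule b_form_bounded_potential)
    show "?B \<in> Sigma_class H1 Q0_inner q"
      unfolding Sigma_class_def using birman_schwinger_compact bdd fin n_plus_abs by simp
    show nC: "Sigma_norm H1 Q0_inner q ?B \<le> C * ?nv" unfolding norm_le using bound by blast
    show "ereal_of_enat (N_minus (\<lambda>x. \<alpha> * V x)) \<le> ereal (C powr q * \<alpha> powr q * ?nv powr q)" if "\<alpha> > 0" for \<alpha>
      using equiv[OF C(1)] nC that by blast
    show "Sigma_norm H1 Q0_inner q ?B \<le> K * ?nv \<longleftrightarrow>
        (\<forall>\<alpha>>0. ereal_of_enat (N_minus (\<lambda>x. \<alpha> * V x)) \<le> ereal (K powr q * \<alpha> powr q * ?nv powr q))" if "K > 0" for K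
      by (rule equiv[OF that])
  qed
qed

end
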